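(* Let $\Psi_Y(t,u):=\sum_{n=0}^{\infty}Y_{F_n}(t)\,u^n$ be the generating function of the inverse $Z$-polynomials of the fan graphs $F_n$, where $F_0$ is the single-vertex graph. Then, as formal power series in $u$, $$\Psi_Y(t,u)=\frac{2(-1+u+tu)}{-3+4(1+t)u+\sqrt{1-4tu^{2}}}.$$
   Context: All graphs are finite and loopless (parallel edges allowed). For a graph $G$, $c(G)$ is its number of connected components and $\mathrm{rk}(G)=|V(G)|-c(G)$ is the rank of its graphic matroid $\mathsf{M}(G)$. A composition of $G$ is a partition of $V(G)$ into vertex sets of connected induced subgraphs; $\mathcal{C}(G)$ is the set of compositions and $|C|$ is the number of parts of $C$. Compositions correspond bijectively to flats of $\mathsf{M}(G)$: $C$ corresponds to the set of edges with both endpoints in a common part of $C$. For $C\in\mathcal{C}(G)$, $G[C]$ is the subgraph whose edge set is that flat and whose vertices are the endpoints of these edges, with $\mathrm{rk}(G[C])=|V(G)|-|C|$, and $G/C$ is the graph obtained from $G$ by contracting all edges of that flat. $\chi_G(t)$ is the chromatic polynomial of $G$. The inverse Kazhdan--Lusztig polynomials $Q_G(t)\in\mathbb{Z}[t]$ are uniquely determined by: (i) if $\mathrm{rk}(G)=0$ then $Q_G(t)=1$; (ii) if $\mathrm{rk}(G)>0$ then $\deg Q_G(t)<\frac12\mathrm{rk}(G)$ and $$(-t)^{\mathrm{rk}(G)}Q_G(t^{-1})=\sum_{C\in\mathcal{C}(G)}(-1)^{\mathrm{rk}(G[C])}Q_{G[C]}(t)\cdot t^{|C|}\chi_{G/C}(t^{-1}).$$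 The inverse $Z$-polynomial of $G$ is $$Y_G(t):=(-1)^{\mathrm{rk}(G)}\sum_{C\in\mathcal{C}(G)}(-1)^{\mathrm{rk}(G[C])}Q_{G[C]}(t)\cdot t^{\mathrm{rk}(G/C)}\mu_{G/C},$$ where $\mu_G$ is the Möbius invariant of $\mathsf{M}(G)$, i.e. the Möbius function $\mu(\hat0,\hat1)$ of its lattice of flats. For $n\ge1$ the fan graph $F_n$ is the graph on vertices $0,1,\dots,n$ obtained from the path $1,2,\dots,n$ by joining vertex $0$ to every vertex of the path. $\sqrt{1-4tu^2}$ denotes the formal power series square root with constant term $1$. *)

theory Defs
  imports
    "HOL-Library.Disjoint_Sets"
    "HOL-Library.FuncSet"
    "HOL-Computational_Algebra.Computational_Algebra"
begin

section \<open>Finite loopless multigraphs\<close>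

text \<open>Edges are named objects, so that parallel edges are possible; \<open>ends\<close> gives the pair of
  endpoints of an edge as a two-element set. Only the values of \<open>ends\<close> on \<open>edges\<close> matter.\<close>

record ('v, 'e) multigraph =
  verts :: "'v set"
  edges :: "'e set"
  ends :: "'e \<Rightarrow> 'v set"

definition loopless_multigraph :: "('v, 'e) multigraph \<Rightarrow> bool" where
  "loopless_multigraph G \<longleftrightarrow> finite (verts G) \<and> finite (edges G) \<and>
     (\<forall>e\<in>edges G. ends G e \<subseteq> verts G \<and> card (ends G e) = 2)"

definition adjacency :: "('v, 'e) multigraph \<Rightarrow> ('v \<times> 'v) set" where
  "adjacency G = {(x, y). \<exists>e\<in>edges G. ends G e = {x, y}}"

definition connectivity :: "('v, 'e) multigraph \<Rightarrow> ('v \<times> 'v) set" where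
  "connectivity G = (adjacency G)\<^sup>* \<inter> verts G \<times> verts G"

definition num_components :: "('v, 'e) multigraph \<Rightarrow> nat" where
  "num_components G = card (verts G // connectivity G)"

definition rk :: "('v, 'e) multigraph \<Rightarrow> nat" where
  "rk G = card (verts G) - num_components G"

definition induced :: "('v, 'e) multigraph \<Rightarrow> 'v set \<Rightarrow> ('v, 'e) multigraph" where
  "induced G P = G\<lparr>verts := P, edges := {e \<in> edges G. ends G e \<subseteq> P}\<rparr>"

section \<open>Compositions, restriction and contraction\<close>

definition compositions :: "('v, 'e) multigraph \<Rightarrow> 'v set set set" where
  "compositions G =
     {C. partition_on (verts G) C \<and> (\<forall>P\<in>C. num_components (induced G P) = 1)}"

definition flat_of :: "('v, 'e) multigraph \<Rightarrow> 'v set set \<Rightarrow> 'e set" where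
  "flat_of G C = {e \<in> edges G. \<exists>P\<in>C. ends G e \<subseteq> P}"

text \<open>The graph \<open>G[C]\<close>; vertices that are not incident to an edge of the flat are dropped.\<close>

definition restrict_graph :: "('v, 'e) multigraph \<Rightarrow> 'v set set \<Rightarrow> ('v, 'e) multigraph" where
  "restrict_graph G C =
     G\<lparr>verts := (\<Union>e\<in>flat_of G C. ends G e), edges := flat_of G C\<rparr>"

text \<open>The graph \<open>G/C\<close>. The parts of \<open>C\<close> are the connected components of the spanning subgraph whose
  edges are the flat, hence they are the vertices of the contraction.\<close>

definition contract_graph :: "('v, 'e) multigraph \<Rightarrow> 'v set set \<Rightarrow> ('v set, 'e) multigraph" where
  "contract_graph G C =
     \<lparr>verts = C, edges = edges G - flat_of G C,
      ends = (\<lambda>e. {P \<in> C. P \<inter> ends G e \<noteq> {}})\<rparr>"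

section \<open>Chromatic polynomial and Moebius invariant\<close>

definition proper_colourings :: "('v, 'e) multigraph \<Rightarrow> nat \<Rightarrow> ('v \<Rightarrow> nat) set" where
  "proper_colourings G k =
     {f \<in> verts G \<rightarrow>\<^sub>E {..<k}. \<forall>e\<in>edges G. inj_on f (ends G e)}"

definition chromatic_poly :: "('v, 'e) multigraph \<Rightarrow> int poly" where
  "chromatic_poly G = (THE p. \<forall>k. poly p (int k) = int (card (proper_colourings G k)))"

text \<open>The flats of the graphic matroid of \<open>G\<close>, via its rank function on sets of edges.\<close>

definition flats :: "('v, 'e) multigraph \<Rightarrow> 'e set set" where
  "flats G = {F. F \<subseteq> edges G \<and>
     (\<forall>e\<in>edges G - F. rk (G\<lparr>edges := F\<rparr>) < rk (G\<lparr>edges := insert e F\<rparr>))}"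

text \<open>The Moebius function of the finite poset \<open>L\<close>. The guard \<open>finite L\<close> only serves termination.\<close>

function moebius :: "'a::order set \<Rightarrow> 'a \<Rightarrow> 'a \<Rightarrow> int" where
  "moebius L x y =
     (if x = y then 1
      else if finite L \<and> x < y then - (\<Sum>z\<in>{z\<in>L. x \<le> z \<and> z < y}. moebius L x z)
      else 0)"
  by auto
termination
proof (relation "measure (\<lambda>(L, x, y). card {z\<in>L. z < y})")
  fix L :: "'a set" and x y z
  assume "finite L \<and> x < y" and z: "z \<in> {z\<in>L. x \<le> z \<and> z < y}"
  then have "{w\<in>L. w < z} \<subset> {w\<in>L. w < y}" and "finite {w\<in>L. w < y}"
    by (auto dest: less_trans)
  then show "((L, x, z), (L, x, y)) \<in> measure (\<lambda>(L, x, y). card {z\<in>L. z < y})"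
    by (simp add: psubset_card_mono)
qed simp

declare moebius.simps [simp del]

text \<open>As \<open>G\<close> is loopless, the least flat is the empty set.\<close>

definition moebius_invariant :: "('v, 'e) multigraph \<Rightarrow> int" where
  "moebius_invariant G = moebius (flats G) {} (edges G)"

section \<open>Inverse Kazhdan--Lusztig polynomials and the inverse Z-polynomial\<close>

text \<open>Identities involving \<open>t\<close> and its inverse are stated in the fraction field of \<open>\<int>[t]\<close>;
  \<open>poly_at q x\<close> is the polynomial \<open>q\<close> evaluated at an element \<open>x\<close> of that field.\<close>

abbreviation tvar :: "int poly fract" where
  "tvar \<equiv> to_fract [:0, 1:]"

definition poly_at :: "int poly \<Rightarrow> int poly fract \<Rightarrow> int poly fract" where
  "poly_at q x = poly (map_poly of_int q) x"

definition inverse_KL_condition ::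
    "(('v, 'e) multigraph \<Rightarrow> int poly) \<Rightarrow> ('v, 'e) multigraph \<Rightarrow> bool" where
  "inverse_KL_condition Q G \<longleftrightarrow>
     (rk G = 0 \<longrightarrow> Q G = 1) \<and>
     (rk G > 0 \<longrightarrow> 2 * degree (Q G) < rk G \<and>
        (- tvar) ^ rk G * poly_at (Q G) (inverse tvar) =
        (\<Sum>C\<in>compositions G. (- 1) ^ rk (restrict_graph G C) * poly_at (Q (restrict_graph G C)) tvar *
           (tvar ^ card C * poly_at (chromatic_poly (contract_graph G C)) (inverse tvar))))"

text \<open>The condition at \<open>G\<close> refers only to \<open>G\<close> itself and to the graphs \<open>G[C]\<close>. A family of polynomials
  satisfying it may therefore be considered on any class of graphs closed under forming \<open>G[C]\<close>
  (for instance on all finite loopless graphs), and all such families have the same value at \<open>G\<close>.\<close>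

definition inverse_KL_family ::
    "('v, 'e) multigraph set \<Rightarrow> (('v, 'e) multigraph \<Rightarrow> int poly) \<Rightarrow> bool" where
  "inverse_KL_family \<G> Q \<longleftrightarrow>
     (\<forall>G\<in>\<G>. loopless_multigraph G \<and> (\<forall>C\<in>compositions G. restrict_graph G C \<in> \<G>) \<and>
        inverse_KL_condition Q G)"

definition inverse_KL :: "('v, 'e) multigraph \<Rightarrow> int poly" where
  "inverse_KL G = (THE q. \<exists>\<G> Q. G \<in> \<G> \<and> inverse_KL_family \<G> Q \<and> q = Q G)"

definition inverse_Z :: "('v, 'e) multigraph \<Rightarrow> int poly" where
  "inverse_Z G = (- 1) ^ rk G *
     (\<Sum>C\<in>compositions G. (- 1) ^ rk (restrict_graph G C) * inverse_KL (restrict_graph G C) *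
        monom (moebius_invariant (contract_graph G C)) (rk (contract_graph G C)))"

section \<open>Fan graphs\<close>

text \<open>\<open>fan 0\<close> is the graph with the single vertex \<open>0\<close> and no edges.\<close>

definition fan :: "nat \<Rightarrow> (nat, nat set) multigraph" where
  "fan n = \<lparr>verts = {0..n},
     edges = {{0, i} |i. 1 \<le> i \<and> i \<le> n} \<union> {{i, i + 1} |i. 1 \<le> i \<and> i < n},
     ends = (\<lambda>e. e)\<rparr>"

section \<open>Formal power series in \<open>u\<close>\<close>

text \<open>Power series in \<open>u\<close> have coefficients in the field \<open>\<rat>(t)\<close>, so that the library division
  applies.\<close>

abbreviation t_fps :: "int poly fract fps" where
  "t_fps \<equiv> fps_const tvar"

abbreviation u_fps :: "int poly fract fps" where
  "u_fps \<equiv> fps_X"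

text \<open>The first argument of \<open>fps_radical\<close> selects the root of the constant term: here it is 1.\<close>

definition fps_sqrt1 :: "int poly fract fps \<Rightarrow> int poly fract fps" where
  "fps_sqrt1 f = fps_radical (\<lambda>_ _. 1) 2 f"

definition Psi_Y :: "int poly fract fps" where
  "Psi_Y = Abs_fps (\<lambda>n. to_fract (inverse_Z (fan n)))"

end

theory Submission
  imports Defs "HOL-Combinatorics.Transposition"
begin

text \<open>The idea is to replace sums over compositions by sums over colourings. For a composition \<open>C\<close> with
  flat \<open>F\<close>, \<open>\<chi>\<^bsub>G/C\<^esub>(k)\<close> counts the colourings of \<open>G\<close> by \<open>k\<close> colours whose set of monochromatic edges is
  exactly \<open>F\<close>; and a set of edges that is not a flat is not the monochromatic set of any colouring.
  So the sum of \<open>w(F) \<chi>\<^bsub>G/C\<^esub>(k)\<close> over all compositions, for any weight \<open>w\<close> of edge sets, is the sum of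
  \<open>w(monochromatic edges of c)\<close> over all colourings \<open>c\<close>. The right-hand side of the defining identity
  of \<open>Q\<^bsub>G\<^esub>\<close> is such a sum at \<open>k = 1/t\<close>. The inverse Z-polynomial collects the coefficients at \<open>x\<close> of
  the same sum as a polynomial in \<open>x\<close>, because the Moebius invariant of a connected graph is the
  coefficient at \<open>x\<close> of its chromatic polynomial (\<open>moebius_invariant_eq_coeff\<close>). Both use the weight \<open>(-1/t)\<^sup>r \<cdot> Q\<close>, where \<open>r\<close> is
  the rank.

  The polynomials \<open>Q\<close> exist and are unique by a general argument on rank functions. Inclusion and
  exclusion over all edge sets instead of flats turns the defining identity into the statement that
  the Boolean Moebius transform of the weights is palindromic (\<open>rank_KL_identity\<close>). A palindromic
  polynomial that lowers the degree of a given polynomial below half of the rank exists and is unique,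
  so the transform is determined recursively. Uniqueness also makes \<open>Q\<close> multiplicative on direct sums
  (\<open>rank_KL_union\<close>).

  A colouring of the fan \<open>F\<^sub>n\<close> in which the hub has colour \<open>0\<close> is a word of length \<open>n\<close>, and by
  multiplicativity its weight is the product over the maximal runs of the word: a run of \<open>0\<close> spans a
  smaller fan, a run of any other letter spans a path. Summing over words by runs gives, with
  \<open>\<phi> = \<Sum> (-1)\<^sup>n Q\<^bsub>F\<^sub>n\<^esub> u\<^sup>n\<close>, \<open>s = 1 + u + t u\<close> and \<open>\<^sup>*\<close> the substitution \<open>t \<mapsto> 1/t\<close>, \<open>u \<mapsto> t u\<close>,

  \<open>1/\<phi>\<^sup>* = 1/\<phi> - (1 - t) u / s\<close> and \<open>1/\<Psi>(-u) = 1/\<phi> + t u / s\<close>.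

  The first equation and the degree bounds determine \<open>\<phi>\<close>, namely \<open>1/\<phi> = 1 + (u + c) / s\<close> with
  \<open>c = (1 - sqrt (1 - 4 t u\<^sup>2)) / 2\<close> (\<open>inverse_phi\<close>). The second one then gives \<open>\<Psi>\<close>.\<close>

section \<open>Linked vertices and the graphic rank\<close>

definition linked :: "('e \<Rightarrow> 'v set) \<Rightarrow> 'e set \<Rightarrow> ('v \<times> 'v) set" where
  "linked \<epsilon> A = {(x, y). \<exists>e\<in>A. \<epsilon> e = {x, y}}\<^sup>*"

text \<open>Connectivity only enters through the edge set, so components and ranks are parametrised by a
  bare vertex set, endpoint map and edge set; the graphs \<open>G[C]\<close> then all share the endpoint map
  of \<open>G\<close>.\<close>

definition components :: "'v set \<Rightarrow> ('e \<Rightarrow> 'v set) \<Rightarrow> 'e set \<Rightarrow> 'v set set" where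
  "components V \<epsilon> A = V // (linked \<epsilon> A \<inter> V \<times> V)"

definition rank_in :: "'v set \<Rightarrow> ('e \<Rightarrow> 'v set) \<Rightarrow> 'e set \<Rightarrow> nat" where
  "rank_in V \<epsilon> A = card V - card (components V \<epsilon> A)"

definition graphic_rank :: "('e \<Rightarrow> 'v set) \<Rightarrow> 'e set \<Rightarrow> nat" where
  "graphic_rank \<epsilon> A = rank_in (\<Union>e\<in>A. \<epsilon> e) \<epsilon> A"

lemma num_components_eq: "num_components G = card (components (verts G) (ends G) (edges G))"
  by (simp add: num_components_def components_def connectivity_def adjacency_def linked_def)

lemma rk_eq: "rk G = rank_in (verts G) (ends G) (edges G)"
  by (simp add: rk_def num_components_eq rank_in_def)

lemma linked_refl [simp]: "(x, x) \<in> linked \<epsilon> A"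
  by (simp add: linked_def)

lemma linked_sym: "(x, y) \<in> linked \<epsilon> A \<Longrightarrow> (y, x) \<in> linked \<epsilon> A"
proof -
  have "sym {(x, y). \<exists>e\<in>A. \<epsilon> e = {x, y}}"
    by (rule symI) (simp add: insert_commute)
  then show "(x, y) \<in> linked \<epsilon> A \<Longrightarrow> (y, x) \<in> linked \<epsilon> A"
    unfolding linked_def by (meson sym_rtrancl symD)
qed

lemma linked_trans: "(x, y) \<in> linked \<epsilon> A \<Longrightarrow> (y, z) \<in> linked \<epsilon> A \<Longrightarrow> (x, z) \<in> linked \<epsilon> A"
  unfolding linked_def by (rule rtrancl_trans)

lemma linked_mono: "A \<subseteq> B \<Longrightarrow> (x, y) \<in> linked \<epsilon> A \<Longrightarrow> (x, y) \<in> linked \<epsilon> B"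
  unfolding linked_def
  by (erule rtrancl_mono [THEN subsetD, rotated]) auto

lemma linked_edge: "e \<in> A \<Longrightarrow> \<epsilon> e = {x, y} \<Longrightarrow> (x, y) \<in> linked \<epsilon> A"
  unfolding linked_def by (rule r_into_rtrancl) auto

lemma linked_empty: "linked \<epsilon> {} = Id"
  by (simp add: linked_def)

lemma linked_induct [consumes 1, case_names base step]:
  assumes "(x, y) \<in> linked \<epsilon> A" "P x"
    and "\<And>y z e. (x, y) \<in> linked \<epsilon> A \<Longrightarrow> e \<in> A \<Longrightarrow> \<epsilon> e = {y, z} \<Longrightarrow> P y \<Longrightarrow> P z"
  shows "P y"
  using assms(1) unfolding linked_def
proof (induction rule: rtrancl_induct)
  case base
  then show ?case by (rule assms(2))
next
  case (step y z)
  then show ?case using assms(3) unfolding linked_def by blast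
qed

text \<open>Walks are compared by mapping them edge by edge. Besides graph maps, this covers the collapse of
  a part of a graph to one vertex and, with \<open>\<rho> = id\<close>, edges that are redundant for connectivity.\<close>

lemma linked_image:
  assumes "(x, y) \<in> linked \<epsilon> A"
    and "\<And>e x y. e \<in> A \<Longrightarrow> \<epsilon> e = {x, y} \<Longrightarrow> (\<rho> x, \<rho> y) \<in> linked \<epsilon>' B"
  shows "(\<rho> x, \<rho> y) \<in> linked \<epsilon>' B"
  using assms(1)
proof (induction rule: linked_induct)
  case (step y z e)
  have "(\<rho> y, \<rho> z) \<in> linked \<epsilon>' B" using assms(2) step.hyps by blast
  with step.IH show ?case by (rule linked_trans)
qed simp

lemma linked_insert:
  assumes "\<epsilon> e = {x, y}"
  shows "(a, b) \<in> linked \<epsilon> (insert e A) \<longleftrightarrow> (a, b) \<in> linked \<epsilon> A \<or>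
    (a, x) \<in> linked \<epsilon> A \<and> (y, b) \<in> linked \<epsilon> A \<or> (a, y) \<in> linked \<epsilon> A \<and> (x, b) \<in> linked \<epsilon> A"
proof
  assume "(a, b) \<in> linked \<epsilon> (insert e A)"
  then show "(a, b) \<in> linked \<epsilon> A \<or> (a, x) \<in> linked \<epsilon> A \<and> (y, b) \<in> linked \<epsilon> A \<or>
      (a, y) \<in> linked \<epsilon> A \<and> (x, b) \<in> linked \<epsilon> A"
  proof (induction rule: linked_induct)
    case (step v w f)
    show ?case
    proof (cases "f \<in> A")
      case True
      then have "(v, w) \<in> linked \<epsilon> A" using step.hyps(3) by (rule linked_edge)
      then show ?thesis using step.IH linked_trans by metis
    next
      case False
      then have "v = x \<and> w = y \<or> v = y \<and> w = x"
        using step.hyps assms by (auto simp: doubleton_eq_iff)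
      then show ?thesis using step.IH linked_sym linked_trans linked_refl by metis
    qed
  qed simp
next
  have xy: "(x, y) \<in> linked \<epsilon> (insert e A)"
    using assms by (rule linked_edge [rotated]) simp
  have up: "(u, v) \<in> linked \<epsilon> (insert e A)" if "(u, v) \<in> linked \<epsilon> A" for u v
    using that by (rule linked_mono [rotated]) auto
  assume "(a, b) \<in> linked \<epsilon> A \<or> (a, x) \<in> linked \<epsilon> A \<and> (y, b) \<in> linked \<epsilon> A \<or>
      (a, y) \<in> linked \<epsilon> A \<and> (x, b) \<in> linked \<epsilon> A"
  then show "(a, b) \<in> linked \<epsilon> (insert e A)"
    using up xy linked_sym [OF xy] linked_trans by metis
qed

lemma equiv_linked: "equiv V (linked \<epsilon> A \<inter> V \<times> V)"
proof (rule equivI)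
  show "trans (linked \<epsilon> A \<inter> V \<times> V)"
    by (rule transI) (use linked_trans in fast)
  show "sym (linked \<epsilon> A \<inter> V \<times> V)"
    by (rule symI) (use linked_sym in fast)
qed (auto simp: refl_on_def)

lemma partition_components: "partition_on V (components V \<epsilon> A)"
  unfolding components_def by (rule partition_on_quotient [OF equiv_linked])

lemma components_eq_image: "components V \<epsilon> A = (\<lambda>v. {w \<in> V. (v, w) \<in> linked \<epsilon> A}) ` V"
  unfolding components_def quotient_def by (auto simp: image_iff Image_def)

lemma finite_components: "finite V \<Longrightarrow> finite (components V \<epsilon> A)"
  by (simp add: components_eq_image)

lemma card_components_le: "finite V \<Longrightarrow> card (components V \<epsilon> A) \<le> card V"
  by (simp add: components_eq_image card_image_le)

lemma component_eq_iff:
  assumes "v \<in> V" "w \<in> V"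
  shows "{z \<in> V. (v, z) \<in> linked \<epsilon> A} = {z \<in> V. (w, z) \<in> linked \<epsilon> A} \<longleftrightarrow> (v, w) \<in> linked \<epsilon> A"
proof
  assume eq: "{z \<in> V. (v, z) \<in> linked \<epsilon> A} = {z \<in> V. (w, z) \<in> linked \<epsilon> A}"
  have "w \<in> {z \<in> V. (w, z) \<in> linked \<epsilon> A}" using assms by simp
  then show "(v, w) \<in> linked \<epsilon> A" unfolding eq [symmetric] by simp
next
  assume "(v, w) \<in> linked \<epsilon> A"
  then have "(v, z) \<in> linked \<epsilon> A \<longleftrightarrow> (w, z) \<in> linked \<epsilon> A" for z
    using linked_sym linked_trans by metis
  then show "{z \<in> V. (v, z) \<in> linked \<epsilon> A} = {z \<in> V. (w, z) \<in> linked \<epsilon> A}"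
    by simp
qed

text \<open>This is the increment by 0 or 1 of the graphic rank. All further facts about the rank are proved
  by adding edges one at a time.\<close>

lemma card_components_insert:
  assumes "finite V" "\<epsilon> e = {x, y}" "x \<in> V" "y \<in> V"
  shows "card (components V \<epsilon> A) =
    card (components V \<epsilon> (insert e A)) + (if (x, y) \<in> linked \<epsilon> A then 0 else 1)"
proof (cases "(x, y) \<in> linked \<epsilon> A")
  case True
  have "(id a, id b) \<in> linked \<epsilon> A" if "(a, b) \<in> linked \<epsilon> (insert e A)" for a b
    using that
  proof (rule linked_image)
    fix f v w assume f: "f \<in> insert e A" "\<epsilon> f = {v, w}"
    show "(id v, id w) \<in> linked \<epsilon> A"
    proof (cases "f \<in> A")
      case False
      then have "v = x \<and> w = y \<or> v = y \<and> w = x"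
        using f assms(2) by (auto simp: doubleton_eq_iff)
      then show ?thesis using True linked_sym by auto
    qed (use f linked_edge in auto)
  qed
  then have "linked \<epsilon> (insert e A) = linked \<epsilon> A"
    by (auto intro: linked_mono [OF subset_insertI])
  then show ?thesis using True by (simp add: components_def)
next
  case False
  let ?cl = "\<lambda>v. {z \<in> V. (v, z) \<in> linked \<epsilon> A}"
  let ?cl' = "\<lambda>v. {z \<in> V. (v, z) \<in> linked \<epsilon> (insert e A)}"
  let ?W = "{v \<in> V. (v, x) \<notin> linked \<epsilon> A \<and> (v, y) \<notin> linked \<epsilon> A}"
  note ins = linked_insert [of \<epsilon> e x y, OF assms(2)]
  have far: "?cl' v = ?cl v" if "v \<in> ?W" for v
    using that by (auto simp: ins)
  have near: "?cl' v = ?cl' x" if "v \<in> V - ?W" for v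
  proof -
    have "(v, x) \<in> linked \<epsilon> (insert e A)" "v \<in> V" using that by (auto simp: ins)
    then show ?thesis using component_eq_iff [of v V x \<epsilon> "insert e A"] assms(3) by blast
  qed
  have split: "V = ?W \<union> (V - ?W)" by auto
  have "components V \<epsilon> (insert e A) = ?cl' ` ?W \<union> ?cl' ` (V - ?W)"
    unfolding components_eq_image image_Un [symmetric] split [symmetric] ..
  also have "?cl' ` ?W = ?cl ` ?W"
    by (rule image_cong [OF refl far])
  also have "?cl' ` (V - ?W) = {?cl' x}"
  proof -
    have "x \<in> V - ?W" using assms by auto
    then show ?thesis using near by blast
  qed
  finally have c': "components V \<epsilon> (insert e A) = insert (?cl' x) (?cl ` ?W)" by simp
  have "?cl' x \<notin> ?cl ` ?W"
  proof
    assume "?cl' x \<in> ?cl ` ?W"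
    then obtain v where v: "v \<in> ?W" "?cl' x = ?cl v" by auto
    have "x \<in> ?cl' x" using assms by simp
    then have "x \<in> ?cl v" unfolding v(2) .
    then show False using v(1) by auto
  qed
  with c' have n': "card (components V \<epsilon> (insert e A)) = Suc (card (?cl ` ?W))"
    using assms(1) by simp
  have "components V \<epsilon> A = ?cl ` ?W \<union> ?cl ` (V - ?W)"
    unfolding components_eq_image image_Un [symmetric] split [symmetric] ..
  also have "?cl ` (V - ?W) = {?cl x, ?cl y}"
  proof -
    have "?cl v = ?cl x \<or> ?cl v = ?cl y" if "v \<in> V - ?W" for v
    proof -
      have "v \<in> V" "(v, x) \<in> linked \<epsilon> A \<or> (v, y) \<in> linked \<epsilon> A" using that by auto
      then show ?thesis
        using component_eq_iff [of v V x \<epsilon> A] component_eq_iff [of v V y \<epsilon> A] assms(3,4) by blast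
    qed
    moreover have "x \<in> V - ?W" "y \<in> V - ?W" using assms by auto
    ultimately show ?thesis by blast
  qed
  finally have c: "components V \<epsilon> A = insert (?cl x) (insert (?cl y) (?cl ` ?W))" by auto
  have "?cl x \<noteq> ?cl y"
    using False component_eq_iff [of x V y \<epsilon> A] assms(3,4) by blast
  moreover have "?cl v \<notin> ?cl ` ?W" if "v = x \<or> v = y" for v
  proof
    assume "?cl v \<in> ?cl ` ?W"
    then obtain w where w: "w \<in> ?W" "?cl v = ?cl w" by auto
    then have "(w, v) \<in> linked \<epsilon> A"
      using component_eq_iff [of w V v \<epsilon> A] that assms(3,4) by blast
    then show False using w(1) that by auto
  qed
  ultimately show ?thesis
    using False n' c assms(1) by simp
qed

lemma rank_in_empty: "rank_in V \<epsilon> {} = 0"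
proof (cases "finite V")
  case True
  have "components V \<epsilon> {} = (\<lambda>v. {v}) ` V"
    by (auto simp: components_eq_image linked_empty image_iff)
  then show ?thesis by (simp add: rank_in_def card_image)
qed (simp add: rank_in_def)

lemma rank_in_insert:
  assumes "finite V" "\<epsilon> e = {x, y}" "x \<in> V" "y \<in> V"
  shows "rank_in V \<epsilon> (insert e A) = rank_in V \<epsilon> A + (if (x, y) \<in> linked \<epsilon> A then 0 else 1)"
  using card_components_insert [of V \<epsilon> e x y A, OF assms] card_components_le [OF assms(1), of \<epsilon> A]
    card_components_le [OF assms(1), of \<epsilon> "insert e A"]
  by (auto simp: rank_in_def)

text \<open>Isolated vertices do not contribute to the rank: each of them is a component of its own.\<close>

lemma rank_in_verts_cong:
  assumes "finite A" "\<And>e. e \<in> A \<Longrightarrow> card (\<epsilon> e) = 2"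
    and "finite V" "\<And>e. e \<in> A \<Longrightarrow> \<epsilon> e \<subseteq> V" "finite V'" "\<And>e. e \<in> A \<Longrightarrow> \<epsilon> e \<subseteq> V'"
  shows "rank_in V \<epsilon> A = rank_in V' \<epsilon> A"
  using assms(1,2,4,6)
proof (induction A)
  case empty
  then show ?case by (simp add: rank_in_empty)
next
  case (insert e A)
  obtain x y where xy: "\<epsilon> e = {x, y}"
    using insert.prems(1)[of e] by (auto simp: card_2_iff)
  moreover have "x \<in> V" "y \<in> V" "x \<in> V'" "y \<in> V'"
    using xy insert.prems(2,3)[of e] by auto
  ultimately show ?case
    using insert by (simp add: rank_in_insert [of _ _ e x y] assms(3,5))
qed

lemma graphic_rank_eq:
  assumes "finite A" "\<And>e. e \<in> A \<Longrightarrow> card (\<epsilon> e) = 2" "finite V" "\<And>e. e \<in> A \<Longrightarrow> \<epsilon> e \<subseteq> V"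
  shows "rank_in V \<epsilon> A = graphic_rank \<epsilon> A"
  unfolding graphic_rank_def
  by (rule rank_in_verts_cong) (use assms in \<open>auto intro: card_ge_0_finite\<close>)

lemma graphic_rank_empty [simp]: "graphic_rank \<epsilon> {} = 0"
  by (simp add: graphic_rank_def rank_in_empty)

lemma graphic_rank_insert:
  assumes "finite A" "\<And>e. e \<in> A \<Longrightarrow> card (\<epsilon> e) = 2" "\<epsilon> e = {x, y}" "x \<noteq> y"
  shows "graphic_rank \<epsilon> (insert e A) = graphic_rank \<epsilon> A + (if (x, y) \<in> linked \<epsilon> A then 0 else 1)"
proof -
  let ?V = "{x, y} \<union> (\<Union>e\<in>A. \<epsilon> e)"
  have fin: "finite ?V" using assms(1,2) by (auto intro: card_ge_0_finite)
  have "rank_in ?V \<epsilon> (insert e A) = graphic_rank \<epsilon> (insert e A)"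
    by (rule graphic_rank_eq) (use assms fin in auto)
  moreover have "rank_in ?V \<epsilon> A = graphic_rank \<epsilon> A"
    by (rule graphic_rank_eq) (use assms fin in auto)
  ultimately show ?thesis
    using rank_in_insert [of ?V \<epsilon> e x y A] fin assms(3) by simp
qed

lemma graphic_rank_mono:
  assumes "finite B" "\<And>e. e \<in> B \<Longrightarrow> card (\<epsilon> e) = 2" "A \<subseteq> B"
  shows "graphic_rank \<epsilon> A \<le> graphic_rank \<epsilon> B"
proof -
  have "graphic_rank \<epsilon> A \<le> graphic_rank \<epsilon> (A \<union> D)" if "finite D" "D \<subseteq> B" for D
    using that
  proof (induction D)
    case (insert e D)
    obtain x y where xy: "\<epsilon> e = {x, y}" "x \<noteq> y"
      using assms(2)[of e] insert.prems by (auto simp: card_2_iff)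
    have "graphic_rank \<epsilon> (insert e (A \<union> D)) =
        graphic_rank \<epsilon> (A \<union> D) + (if (x, y) \<in> linked \<epsilon> (A \<union> D) then 0 else 1)"
      using assms insert.prems finite_subset [OF assms(3,1)] insert.hyps xy
      by (intro graphic_rank_insert) auto
    then show ?case using insert by auto
  qed simp
  from this [of "B - A"] show ?thesis
    using assms by (simp add: Un_absorb1)
qed

lemma graphic_rank_singleton:
  assumes "card (\<epsilon> e) = 2"
  shows "graphic_rank \<epsilon> {e} = 1"
proof -
  obtain x y where "\<epsilon> e = {x, y}" "x \<noteq> y" using assms by (auto simp: card_2_iff)
  then show ?thesis using graphic_rank_insert [of "{}" \<epsilon> e x y] by (simp add: linked_empty)
qed

lemma graphic_rank_eq_0_iff:
  assumes "finite A" "\<And>e. e \<in> A \<Longrightarrow> card (\<epsilon> e) = 2"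
  shows "graphic_rank \<epsilon> A = 0 \<longleftrightarrow> A = {}"
proof
  assume r: "graphic_rank \<epsilon> A = 0"
  show "A = {}"
  proof (rule ccontr)
    assume "A \<noteq> {}"
    then obtain e where "e \<in> A" by auto
    then show False
      using graphic_rank_mono [of A \<epsilon> "{e}"] graphic_rank_singleton [of \<epsilon> e] assms r by simp
  qed
qed simp

text \<open>If \<open>A\<close> and \<open>B\<close> share at most the vertex \<open>z\<close>, then collapsing the vertices of \<open>A\<close> to \<open>z\<close>
  turns a walk in \<open>A \<union> B\<close> into a walk in \<open>B\<close>. So the edges of \<open>A\<close> create no connection between
  vertices of \<open>B\<close>, and the rank is additive.\<close>

lemma graphic_rank_union:
  assumes "finite A" "finite B" "\<And>e. e \<in> A \<union> B \<Longrightarrow> card (\<epsilon> e) = 2"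
    and share: "(\<Union>e\<in>A. \<epsilon> e) \<inter> (\<Union>e\<in>B. \<epsilon> e) \<subseteq> {z}"
  shows "graphic_rank \<epsilon> (A \<union> B) = graphic_rank \<epsilon> A + graphic_rank \<epsilon> B"
proof -
  define \<rho> where "\<rho> v = (if v \<in> (\<Union>e\<in>A. \<epsilon> e) then z else v)" for v
  have keep: "\<rho> v = v" if "v \<in> \<epsilon> e" "e \<in> B" for v e
    using that share unfolding \<rho>_def by auto
  have "graphic_rank \<epsilon> (A \<union> D) = graphic_rank \<epsilon> A + graphic_rank \<epsilon> D" if "finite D" "D \<subseteq> B" for D
    using that
  proof (induction D)
    case (insert e D)
    obtain x y where xy: "\<epsilon> e = {x, y}" "x \<noteq> y"
      using assms(3)[of e] insert.prems by (auto simp: card_2_iff)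
    have "(x, y) \<in> linked \<epsilon> (A \<union> D) \<longleftrightarrow> (x, y) \<in> linked \<epsilon> D"
    proof
      assume "(x, y) \<in> linked \<epsilon> (A \<union> D)"
      then have "(\<rho> x, \<rho> y) \<in> linked \<epsilon> D"
      proof (rule linked_image)
        fix f a b assume f: "f \<in> A \<union> D" "\<epsilon> f = {a, b}"
        show "(\<rho> a, \<rho> b) \<in> linked \<epsilon> D"
        proof (cases "f \<in> A")
          case True
          then have "\<rho> a = z" "\<rho> b = z" using f(2) unfolding \<rho>_def by auto
          then show ?thesis by simp
        next
          case False
          then have "f \<in> D" "f \<in> B" using f insert.prems by auto
          then show ?thesis using keep [of a f] keep [of b f] f(2) linked_edge by auto
        qed
      qed
      then show "(x, y) \<in> linked \<epsilon> D"
        using keep [of x e] keep [of y e] xy insert.prems by simp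
    next
      assume "(x, y) \<in> linked \<epsilon> D"
      then show "(x, y) \<in> linked \<epsilon> (A \<union> D)" by (rule linked_mono [rotated]) simp
    qed
    moreover have "graphic_rank \<epsilon> (insert e (A \<union> D)) =
        graphic_rank \<epsilon> (A \<union> D) + (if (x, y) \<in> linked \<epsilon> (A \<union> D) then 0 else 1)"
      using assms insert xy by (intro graphic_rank_insert) auto
    moreover have "graphic_rank \<epsilon> (insert e D) =
        graphic_rank \<epsilon> D + (if (x, y) \<in> linked \<epsilon> D then 0 else 1)"
      using assms insert xy by (intro graphic_rank_insert) auto
    ultimately show ?case using insert by simp
  qed simp
  from this [of B] show ?thesis using assms(2) by simp
qed

lemma graphic_rank_image:
  assumes "finite A" "\<And>e. e \<in> A \<Longrightarrow> card (\<epsilon> e) = 2" "inj g"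
    and "inj_on f A" "\<And>e. e \<in> A \<Longrightarrow> \<epsilon>' (f e) = g ` \<epsilon> e"
  shows "graphic_rank \<epsilon>' (f ` A) = graphic_rank \<epsilon> A"
  using assms(1,2,4,5)
proof (induction A)
  case (insert e A)
  obtain x y where xy: "\<epsilon> e = {x, y}" "x \<noteq> y"
    using insert.prems(1)[of e] by (auto simp: card_2_iff)
  have gxy: "\<epsilon>' (f e) = {g x, g y}" "g x \<noteq> g y"
    using insert.prems(3)[of e] xy assms(3) by (auto simp: inj_def)
  have "(g x, g y) \<in> linked \<epsilon>' (f ` A) \<longleftrightarrow> (x, y) \<in> linked \<epsilon> A"
  proof
    assume "(g x, g y) \<in> linked \<epsilon>' (f ` A)"
    then have "(inv g (g x), inv g (g y)) \<in> linked \<epsilon> A"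
    proof (rule linked_image)
      fix d a b assume "d \<in> f ` A" "\<epsilon>' d = {a, b}"
      then obtain d' where d': "d' \<in> A" "{a, b} = g ` \<epsilon> d'" using insert.prems(3) by auto
      have "\<epsilon> d' = inv g ` g ` \<epsilon> d'" using assms(3) by (simp add: image_comp)
      also have "\<dots> = {inv g a, inv g b}" by (simp flip: d'(2))
      finally show "(inv g a, inv g b) \<in> linked \<epsilon> A" by (rule linked_edge [OF d'(1)])
    qed
    then show "(x, y) \<in> linked \<epsilon> A" using assms(3) by simp
  next
    assume "(x, y) \<in> linked \<epsilon> A"
    then show "(g x, g y) \<in> linked \<epsilon>' (f ` A)"
    proof (rule linked_image)
      fix d a b assume "d \<in> A" "\<epsilon> d = {a, b}"
      then show "(g a, g b) \<in> linked \<epsilon>' (f ` A)"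
        using insert.prems(3)[of d] by (intro linked_edge [of "f d"]) auto
    qed
  qed
  moreover have "graphic_rank \<epsilon>' (insert (f e) (f ` A)) =
      graphic_rank \<epsilon>' (f ` A) + (if (g x, g y) \<in> linked \<epsilon>' (f ` A) then 0 else 1)"
  proof (rule graphic_rank_insert)
    show "\<epsilon>' (f e) = {g x, g y}" "g x \<noteq> g y" by (fact gxy)+
    fix d assume "d \<in> f ` A"
    then obtain d' where "d' \<in> A" "d = f d'" by auto
    then show "card (\<epsilon>' d) = 2"
      using insert.prems(1,3)[of d'] assms(3) by (simp add: card_image inj_on_subset)
  qed (use insert in simp)
  moreover have "graphic_rank \<epsilon> (insert e A) =
      graphic_rank \<epsilon> A + (if (x, y) \<in> linked \<epsilon> A then 0 else 1)"
    using insert xy by (intro graphic_rank_insert) auto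
  ultimately show ?case using insert by simp
qed simp

section \<open>Colourings and compositions\<close>

definition part_of :: "'v set set \<Rightarrow> 'v \<Rightarrow> 'v set" where
  "part_of C v = (THE P. P \<in> C \<and> v \<in> P)"

lemma part_of_eq:
  assumes "partition_on V C" "P \<in> C" "v \<in> P"
  shows "part_of C v = P"
  unfolding part_of_def
proof (rule the_equality)
  fix P' assume "P' \<in> C \<and> v \<in> P'"
  then show "P' = P"
    using assms disjointD [OF partition_onD2 [OF assms(1)], of P' P] by auto
qed (use assms in simp)

lemma part_of_mem:
  assumes "partition_on V C" "v \<in> V"
  shows "part_of C v \<in> C" "v \<in> part_of C v"
proof -
  obtain P where "P \<in> C" "v \<in> P" using assms partition_onD1 by blast
  then show "part_of C v \<in> C" "v \<in> part_of C v" using part_of_eq [OF assms(1)] by auto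
qed

lemma bij_betw_colour_parts:
  assumes C: "partition_on V C"
  shows "bij_betw (\<lambda>g. \<lambda>v\<in>V. g (part_of C v)) (C \<rightarrow>\<^sub>E K)
    {c \<in> V \<rightarrow>\<^sub>E K. \<forall>P\<in>C. \<forall>x\<in>P. \<forall>y\<in>P. c x = c y}"
proof -
  have sub: "v \<in> V" if "v \<in> P" "P \<in> C" for v P
    using C that partition_onD1 by blast
  have ne: "(SOME v. v \<in> P) \<in> P" if "P \<in> C" for P
    using partition_onD3 [OF C] that some_in_eq by metis
  show ?thesis
  proof (rule bij_betw_byWitness [where f' = "\<lambda>c. \<lambda>P\<in>C. c (SOME v. v \<in> P)"])
    show "\<forall>g\<in>C \<rightarrow>\<^sub>E K. (\<lambda>P\<in>C. (\<lambda>v\<in>V. g (part_of C v)) (SOME v. v \<in> P)) = g"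
    proof
      fix g assume g: "g \<in> C \<rightarrow>\<^sub>E K"
      show "(\<lambda>P\<in>C. (\<lambda>v\<in>V. g (part_of C v)) (SOME v. v \<in> P)) = g"
      proof
        fix P
        have "(SOME v. v \<in> P) \<in> V" "part_of C (SOME v. v \<in> P) = P" if "P \<in> C"
          using that sub [OF ne that] part_of_eq [OF C that ne] by auto
        then show "(\<lambda>P\<in>C. (\<lambda>v\<in>V. g (part_of C v)) (SOME v. v \<in> P)) P = g P"
          using PiE_arb [OF g, of P] by (cases "P \<in> C") simp_all
      qed
    qed
    show "\<forall>c\<in>{c \<in> V \<rightarrow>\<^sub>E K. \<forall>P\<in>C. \<forall>x\<in>P. \<forall>y\<in>P. c x = c y}.
        (\<lambda>v\<in>V. (\<lambda>P\<in>C. c (SOME v. v \<in> P)) (part_of C v)) = c"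
    proof
      fix c assume c: "c \<in> {c \<in> V \<rightarrow>\<^sub>E K. \<forall>P\<in>C. \<forall>x\<in>P. \<forall>y\<in>P. c x = c y}"
      show "(\<lambda>v\<in>V. (\<lambda>P\<in>C. c (SOME v. v \<in> P)) (part_of C v)) = c"
      proof
        fix v
        show "(\<lambda>v\<in>V. (\<lambda>P\<in>C. c (SOME v. v \<in> P)) (part_of C v)) v = c v"
        proof (cases "v \<in> V")
          case True
          note p = part_of_mem [OF C True]
          have "c (SOME w. w \<in> part_of C v) = c v"
            using c p ne [OF p(1)] by blast
          with True p(1) show ?thesis by (simp only: restrict_apply if_True)
        next
          case False
          have "c \<in> V \<rightarrow>\<^sub>E K" using c by blast
          from PiE_arb [OF this False] show ?thesis using False by simp
        qed
      qed
    qed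
    show "(\<lambda>g. \<lambda>v\<in>V. g (part_of C v)) ` (C \<rightarrow>\<^sub>E K)
        \<subseteq> {c \<in> V \<rightarrow>\<^sub>E K. \<forall>P\<in>C. \<forall>x\<in>P. \<forall>y\<in>P. c x = c y}"
    proof (rule image_subsetI)
      fix g assume g: "g \<in> C \<rightarrow>\<^sub>E K"
      have "(\<lambda>v\<in>V. g (part_of C v)) \<in> V \<rightarrow>\<^sub>E K"
        using g part_of_mem(1) [OF C] by (intro restrict_PiE_iff [THEN iffD2]) (auto simp: PiE_mem)
      moreover have "(\<lambda>v\<in>V. g (part_of C v)) x = g P" if "P \<in> C" "x \<in> P" for P x
        using that sub part_of_eq [OF C] by simp
      ultimately show "(\<lambda>v\<in>V. g (part_of C v)) \<in>
          {c \<in> V \<rightarrow>\<^sub>E K. \<forall>P\<in>C. \<forall>x\<in>P. \<forall>y\<in>P. c x = c y}" by simp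
    qed
    show "(\<lambda>c. \<lambda>P\<in>C. c (SOME v. v \<in> P)) `
        {c \<in> V \<rightarrow>\<^sub>E K. \<forall>P\<in>C. \<forall>x\<in>P. \<forall>y\<in>P. c x = c y} \<subseteq> C \<rightarrow>\<^sub>E K"
    proof (rule image_subsetI)
      fix c assume c: "c \<in> {c \<in> V \<rightarrow>\<^sub>E K. \<forall>P\<in>C. \<forall>x\<in>P. \<forall>y\<in>P. c x = c y}"
      show "(\<lambda>P\<in>C. c (SOME v. v \<in> P)) \<in> C \<rightarrow>\<^sub>E K"
      proof (intro restrict_PiE_iff [THEN iffD2] ballI)
        fix P assume "P \<in> C"
        then have "(SOME v. v \<in> P) \<in> V" using sub ne by blast
        moreover have "c \<in> V \<rightarrow>\<^sub>E K" using c by blast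
        ultimately show "c (SOME v. v \<in> P) \<in> K" by (rule PiE_mem [rotated])
      qed
    qed
  qed
qed

text \<open>The edges used here have two endpoints, so that failing to be injective on the endpoints means
  giving both the same colour.\<close>

definition monochromatic :: "('e \<Rightarrow> 'v set) \<Rightarrow> 'e set \<Rightarrow> ('v \<Rightarrow> 'c) \<Rightarrow> 'e set" where
  "monochromatic \<epsilon> E c = {e \<in> E. \<not> inj_on c (\<epsilon> e)}"

lemma not_inj_on_pair: "x \<noteq> y \<Longrightarrow> \<not> inj_on c {x, y} \<longleftrightarrow> c x = c y"
  by auto

lemma colour_linked:
  assumes "(x, y) \<in> linked \<epsilon> A" "\<And>e. e \<in> A \<Longrightarrow> card (\<epsilon> e) = 2"
    and "\<And>e. e \<in> A \<Longrightarrow> \<not> inj_on c (\<epsilon> e)"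
  shows "c x = c y"
  using assms(1)
proof (induction rule: linked_induct)
  case (step y z e)
  have "y \<noteq> z" using assms(2) [OF step.hyps(2)] step.hyps(3) by auto
  then show ?case
    using assms(3) [OF step.hyps(2)] step.hyps(3) step.IH not_inj_on_pair [of y z c] by simp
qed simp

lemma same_component_iff:
  assumes "x \<in> V" "y \<in> V"
  shows "(\<exists>P\<in>components V \<epsilon> A. x \<in> P \<and> y \<in> P) \<longleftrightarrow> (x, y) \<in> linked \<epsilon> A"
proof
  assume "\<exists>P\<in>components V \<epsilon> A. x \<in> P \<and> y \<in> P"
  then obtain v where "(v, x) \<in> linked \<epsilon> A" "(v, y) \<in> linked \<epsilon> A"
    unfolding components_eq_image by blast
  then show "(x, y) \<in> linked \<epsilon> A" using linked_sym linked_trans by metis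
next
  assume "(x, y) \<in> linked \<epsilon> A"
  then show "\<exists>P\<in>components V \<epsilon> A. x \<in> P \<and> y \<in> P"
    unfolding components_eq_image using assms by (auto intro!: bexI [of _ x])
qed

text \<open>Such a colouring is constant on components and arbitrary otherwise. So numbers of components,
  and with them ranks, can be read off from numbers of colourings.\<close>

lemma card_colourings_constant_on:
  assumes "finite V" "\<And>e. e \<in> A \<Longrightarrow> card (\<epsilon> e) = 2" "\<And>e. e \<in> A \<Longrightarrow> \<epsilon> e \<subseteq> V"
  shows "card {c \<in> V \<rightarrow>\<^sub>E {..<k}. \<forall>e\<in>A. \<not> inj_on c (\<epsilon> e)} = k ^ card (components V \<epsilon> A)"
proof -
  let ?C = "components V \<epsilon> A"
  have "{c \<in> V \<rightarrow>\<^sub>E {..<k}. \<forall>e\<in>A. \<not> inj_on c (\<epsilon> e)} =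
      {c \<in> V \<rightarrow>\<^sub>E {..<k}. \<forall>P\<in>?C. \<forall>x\<in>P. \<forall>y\<in>P. c x = c y}"
  proof (rule Collect_cong, rule conj_cong [OF refl])
    fix c :: "'a \<Rightarrow> nat"
    show "(\<forall>e\<in>A. \<not> inj_on c (\<epsilon> e)) \<longleftrightarrow> (\<forall>P\<in>?C. \<forall>x\<in>P. \<forall>y\<in>P. c x = c y)"
    proof
      assume L: "\<forall>e\<in>A. \<not> inj_on c (\<epsilon> e)"
      show "\<forall>P\<in>?C. \<forall>x\<in>P. \<forall>y\<in>P. c x = c y"
      proof (intro ballI)
        fix P x y assume P: "P \<in> ?C" "x \<in> P" "y \<in> P"
        then have "x \<in> V" "y \<in> V" by (auto simp: components_eq_image)
        then have "(x, y) \<in> linked \<epsilon> A" using P same_component_iff [of x V y \<epsilon> A] by blast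
        then show "c x = c y" using colour_linked [of x y \<epsilon> A c] assms(2) L by blast
      qed
    next
      assume R: "\<forall>P\<in>?C. \<forall>x\<in>P. \<forall>y\<in>P. c x = c y"
      show "\<forall>e\<in>A. \<not> inj_on c (\<epsilon> e)"
      proof
        fix e assume e: "e \<in> A"
        then obtain x y where xy: "\<epsilon> e = {x, y}" "x \<noteq> y"
          using assms(2) [of e] by (auto simp: card_2_iff)
        then have "x \<in> V" "y \<in> V" using assms(3) [OF e] by auto
        then have "c x = c y"
          using same_component_iff [of x V y \<epsilon> A] linked_edge [of e A \<epsilon> x y, OF e xy(1)] R by blast
        then show "\<not> inj_on c (\<epsilon> e)" using xy not_inj_on_pair [of x y c] by simp
      qed
    qed
  qed
  also have "card \<dots> = card (?C \<rightarrow>\<^sub>E {..<k})"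
    by (rule bij_betw_same_card [OF bij_betw_colour_parts, symmetric])
      (rule partition_components)
  also have "\<dots> = k ^ card ?C"
    by (simp add: card_funcsetE finite_components assms(1))
  finally show ?thesis .
qed

lemma loopless_finite: "loopless_multigraph G \<Longrightarrow> finite (verts G) \<and> finite (edges G)"
  by (simp add: loopless_multigraph_def)

lemma loopless_ends:
  assumes "loopless_multigraph G" "e \<in> edges G"
  shows "ends G e \<subseteq> verts G" "card (ends G e) = 2"
  using assms by (auto simp: loopless_multigraph_def)

lemma loopless_endsE:
  assumes "loopless_multigraph G" "e \<in> edges G"
  obtains x y where "ends G e = {x, y}" "x \<noteq> y" "x \<in> verts G" "y \<in> verts G"
  using loopless_ends [OF assms] by (auto simp: card_2_iff)

lemma flat_of_subset: "flat_of G C \<subseteq> edges G"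
  by (auto simp: flat_of_def)

lemma compositions_partition: "C \<in> compositions G \<Longrightarrow> partition_on (verts G) C"
  by (simp add: compositions_def)

lemma num_components_induced:
  "num_components (induced G P) = card (components P (ends G) {e \<in> edges G. ends G e \<subseteq> P})"
  by (simp add: num_components_eq induced_def)

lemma composition_linked:
  assumes "C \<in> compositions G" "P \<in> C" "x \<in> P" "y \<in> P"
  shows "(x, y) \<in> linked (ends G) (flat_of G C)"
proof -
  let ?A = "{e \<in> edges G. ends G e \<subseteq> P}"
  have "card (components P (ends G) ?A) = 1"
    using assms by (simp add: compositions_def num_components_induced)
  then obtain X where X: "components P (ends G) ?A = {X}" by (auto simp: card_1_singleton_iff)
  have "X = P"
    using X partition_onD1 [OF partition_components [of P "ends G" ?A]] by auto
  then have "(x, y) \<in> linked (ends G) ?A"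
    using same_component_iff [OF assms(3,4), of "ends G" ?A] X assms by auto
  moreover have "?A \<subseteq> flat_of G C" using assms by (auto simp: flat_of_def)
  ultimately show ?thesis using linked_mono by metis
qed

lemma linked_flat_of:
  assumes "C \<in> compositions G" "(x, y) \<in> linked (ends G) (flat_of G C)" "P \<in> C" "x \<in> P"
  shows "y \<in> P"
  using assms(2)
proof (induction rule: linked_induct)
  case (step y z e)
  then obtain P' where P': "P' \<in> C" "ends G e \<subseteq> P'" by (auto simp: flat_of_def)
  then have "y \<in> P'" "z \<in> P'" using step.hyps by auto
  then show ?case
    using step.IH P'(1) assms(3) disjointD [OF partition_onD2 [OF compositions_partition [OF assms(1)]], of P P']
    by auto
qed (rule assms(4))

text \<open>The edges of the flat connect each part and do not leave it. In particular a composition is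
  determined by its flat.\<close>

lemma components_flat_of:
  assumes "C \<in> compositions G"
  shows "components (verts G) (ends G) (flat_of G C) = C"
proof -
  note part = compositions_partition [OF assms]
  have cls: "{w \<in> verts G. (v, w) \<in> linked (ends G) (flat_of G C)} = part_of C v" if "v \<in> verts G" for v
  proof (intro equalityI subsetI)
    fix w assume "w \<in> {w \<in> verts G. (v, w) \<in> linked (ends G) (flat_of G C)}"
    then show "w \<in> part_of C v"
      using linked_flat_of [OF assms] part_of_mem [OF part that] by blast
  next
    fix w assume "w \<in> part_of C v"
    then show "w \<in> {w \<in> verts G. (v, w) \<in> linked (ends G) (flat_of G C)}"
      using composition_linked [OF assms] part_of_mem [OF part that] partition_onD1 [OF part] by blast
  qed
  have "components (verts G) (ends G) (flat_of G C) = part_of C ` verts G"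
    unfolding components_eq_image by (rule image_cong [OF refl cls])
  also have "\<dots> = C"
  proof (intro equalityI subsetI)
    fix P assume P: "P \<in> C"
    then obtain v where v: "v \<in> P" using partition_onD3 [OF part] by (metis ex_in_conv)
    then have "v \<in> verts G" using P partition_onD1 [OF part] by blast
    then show "P \<in> part_of C ` verts G" using part_of_eq [OF part P v] by blast
  qed (use part_of_mem [OF part] in blast)
  finally show ?thesis .
qed

lemma inj_on_flat_of: "inj_on (flat_of G) (compositions G)"
  by (rule inj_onI) (metis components_flat_of)

lemma components_in_compositions:
  assumes "A \<subseteq> edges G" "loopless_multigraph G"
  shows "components (verts G) (ends G) A \<in> compositions G"
proof -
  have "card (components P (ends G) {e \<in> edges G. ends G e \<subseteq> P}) = 1"
    if P: "P \<in> components (verts G) (ends G) A" for P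
  proof -
    let ?D = "{e \<in> edges G. ends G e \<subseteq> P}"
    obtain v where v: "v \<in> verts G" "P = {w \<in> verts G. (v, w) \<in> linked (ends G) A}"
      using P by (auto simp: components_eq_image)
    have v_link: "w \<in> verts G \<and> (v, w) \<in> linked (ends G) ?D" if "(v, w) \<in> linked (ends G) A" for w
      using that
    proof (induction rule: linked_induct)
      case (step y z e)
      then have e: "e \<in> edges G" using assms(1) by auto
      have z: "z \<in> verts G" using loopless_ends(1) [OF assms(2) e] step.hyps(3) by auto
      have "(v, z) \<in> linked (ends G) A"
        using step.hyps(1) linked_edge [of e A "ends G" y z, OF step.hyps(2,3)] by (rule linked_trans)
      then have "e \<in> ?D" using e z step v by auto
      then have "(y, z) \<in> linked (ends G) ?D" using step.hyps(3) by (rule linked_edge)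
      from linked_trans [OF conjunct2 [OF step.IH] this] show ?case using z by blast
    qed (use v in simp)
    have "{w \<in> P. (u, w) \<in> linked (ends G) ?D} = P" if "u \<in> P" for u
    proof -
      have "(v, u) \<in> linked (ends G) ?D" using v_link [of u] v that by auto
      moreover have "(v, w) \<in> linked (ends G) ?D" if "w \<in> P" for w
        using v_link [of w] v that by auto
      ultimately show ?thesis using linked_trans [OF linked_sym] by fast
    qed
    moreover have "v \<in> P" using v by simp
    ultimately have "components P (ends G) ?D = {P}" by (auto simp: components_eq_image)
    then show ?thesis by simp
  qed
  then show ?thesis
    unfolding compositions_def num_components_induced using partition_components by blast
qed

lemma flat_of_components:
  assumes "loopless_multigraph G"
  shows "flat_of G (components (verts G) (ends G) A) =
    {e \<in> edges G. \<forall>x y. ends G e = {x, y} \<longrightarrow> (x, y) \<in> linked (ends G) A}"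
proof (intro equalityI subsetI)
  fix e assume "e \<in> flat_of G (components (verts G) (ends G) A)"
  then obtain P where e: "e \<in> edges G" and P: "P \<in> components (verts G) (ends G) A" "ends G e \<subseteq> P"
    by (auto simp: flat_of_def)
  have "(x, y) \<in> linked (ends G) A" if "ends G e = {x, y}" for x y
    using P that loopless_ends(1) [OF assms e] same_component_iff [of x "verts G" y "ends G" A] by auto
  then show "e \<in> {e \<in> edges G. \<forall>x y. ends G e = {x, y} \<longrightarrow> (x, y) \<in> linked (ends G) A}"
    using e by simp
next
  fix e assume e: "e \<in> {e \<in> edges G. \<forall>x y. ends G e = {x, y} \<longrightarrow> (x, y) \<in> linked (ends G) A}"
  then have eE: "e \<in> edges G" by simp
  obtain x y where xy: "ends G e = {x, y}" "x \<in> verts G" "y \<in> verts G"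
    by (rule loopless_endsE [OF assms eE])
  have "(x, y) \<in> linked (ends G) A" using e xy(1) by blast
  then obtain P where "P \<in> components (verts G) (ends G) A" "x \<in> P" "y \<in> P"
    using same_component_iff [OF xy(2,3), of "ends G" A] by blast
  then show "e \<in> flat_of G (components (verts G) (ends G) A)"
    unfolding flat_of_def using eE xy(1) by auto
qed

text \<open>Along a walk of monochromatic edges the colour is constant, so every edge whose ends are linked
  by monochromatic edges is monochromatic itself.\<close>

lemma monochromatic_is_flat:
  assumes "loopless_multigraph G"
  shows "flat_of G (components (verts G) (ends G) (monochromatic (ends G) (edges G) c)) =
    monochromatic (ends G) (edges G) c"
proof (intro equalityI subsetI)
  let ?M = "monochromatic (ends G) (edges G) c"
  fix e assume e: "e \<in> flat_of G (components (verts G) (ends G) ?M)"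
  then have eE: "e \<in> edges G" by (simp add: flat_of_def)
  obtain x y where xy: "ends G e = {x, y}" "x \<noteq> y" by (rule loopless_endsE [OF assms eE])
  have "(x, y) \<in> linked (ends G) ?M"
    using e xy(1) unfolding flat_of_components [OF assms] by blast
  then have "c x = c y"
    by (rule colour_linked) (auto simp: monochromatic_def loopless_ends [OF assms])
  then show "e \<in> ?M" using eE xy not_inj_on_pair [of x y c] by (simp add: monochromatic_def)
next
  let ?M = "monochromatic (ends G) (edges G) c"
  fix e assume e: "e \<in> ?M"
  then have "e \<in> edges G" by (simp add: monochromatic_def)
  moreover have "(x, y) \<in> linked (ends G) ?M" if "ends G e = {x, y}" for x y
    using e that by (rule linked_edge)
  ultimately show "e \<in> flat_of G (components (verts G) (ends G) ?M)"
    unfolding flat_of_components [OF assms] by blast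
qed

text \<open>An edge that survives the contraction joins two different parts, and a colouring of the parts
  gives its ends in \<open>G\<close> the colours of these parts.\<close>

lemma contract_edge_colour:
  assumes G: "loopless_multigraph G" and C: "partition_on (verts G) C"
    and e: "e \<in> edges G - flat_of G C"
  shows "inj_on g (ends (contract_graph G C) e) \<longleftrightarrow>
    inj_on (\<lambda>v\<in>verts G. g (part_of C v)) (ends G e)"
    and "card (ends (contract_graph G C) e) = 2"
proof -
  have eE: "e \<in> edges G" using e by blast
  obtain x y where xy: "ends G e = {x, y}" "x \<noteq> y" "x \<in> verts G" "y \<in> verts G"
    by (rule loopless_endsE [OF G eE])
  note px = part_of_mem [OF C xy(3)] and py = part_of_mem [OF C xy(4)]
  have "{P \<in> C. P \<inter> ends G e \<noteq> {}} = {part_of C x, part_of C y}"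
  proof (intro equalityI subsetI)
    fix P assume "P \<in> {P \<in> C. P \<inter> ends G e \<noteq> {}}"
    then have "P \<in> C" "x \<in> P \<or> y \<in> P" using xy(1) by auto
    then show "P \<in> {part_of C x, part_of C y}" using part_of_eq [OF C] by blast
  qed (use px py xy(1) in auto)
  then have ends: "ends (contract_graph G C) e = {part_of C x, part_of C y}"
    by (simp add: contract_graph_def)
  have ne: "part_of C x \<noteq> part_of C y"
  proof
    assume "part_of C x = part_of C y"
    then have "ends G e \<subseteq> part_of C x" using px(2) py(2) xy(1) by simp
    then have "e \<in> flat_of G C" unfolding flat_of_def using eE px(1) by blast
    then show False using e by blast
  qed
  show "card (ends (contract_graph G C) e) = 2" using ends ne by simp
  show "inj_on g (ends (contract_graph G C) e) \<longleftrightarrow>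
      inj_on (\<lambda>v\<in>verts G. g (part_of C v)) (ends G e)"
    using not_inj_on_pair [OF ne, of g] not_inj_on_pair [OF xy(2), of "\<lambda>v\<in>verts G. g (part_of C v)"]
    by (simp add: ends xy)
qed

lemma loopless_contract:
  assumes "loopless_multigraph G" "partition_on (verts G) C"
  shows "loopless_multigraph (contract_graph G C)"
  unfolding loopless_multigraph_def
proof (intro conjI ballI)
  show "finite (verts (contract_graph G C))"
    using assms loopless_finite finite_elements by (auto simp: contract_graph_def)
  show "finite (edges (contract_graph G C))"
    using assms loopless_finite by (auto simp: contract_graph_def)
  fix e assume "e \<in> edges (contract_graph G C)"
  then show "card (ends (contract_graph G C) e) = 2"
    using contract_edge_colour(2) [OF assms] by (simp add: contract_graph_def)
  show "ends (contract_graph G C) e \<subseteq> verts (contract_graph G C)"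
    by (auto simp: contract_graph_def)
qed

lemma constant_on_parts_iff:
  assumes G: "loopless_multigraph G" and C: "C \<in> compositions G"
  shows "(\<forall>P\<in>C. \<forall>x\<in>P. \<forall>y\<in>P. c x = c y) \<longleftrightarrow>
    flat_of G C \<subseteq> monochromatic (ends G) (edges G) c"
proof
  assume L: "\<forall>P\<in>C. \<forall>x\<in>P. \<forall>y\<in>P. c x = c y"
  show "flat_of G C \<subseteq> monochromatic (ends G) (edges G) c"
  proof
    fix e assume "e \<in> flat_of G C"
    then obtain P where e: "e \<in> edges G" and P: "P \<in> C" "ends G e \<subseteq> P" by (auto simp: flat_of_def)
    obtain x y where "ends G e = {x, y}" "x \<noteq> y" by (rule loopless_endsE [OF G e])
    then show "e \<in> monochromatic (ends G) (edges G) c"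
      using L P e not_inj_on_pair [of x y c] by (simp add: monochromatic_def)
  qed
next
  assume R: "flat_of G C \<subseteq> monochromatic (ends G) (edges G) c"
  show "\<forall>P\<in>C. \<forall>x\<in>P. \<forall>y\<in>P. c x = c y"
  proof (intro ballI)
    fix P x y assume "P \<in> C" "x \<in> P" "y \<in> P"
    then have "(x, y) \<in> linked (ends G) (flat_of G C)" by (rule composition_linked [OF C])
    then show "c x = c y"
      by (rule colour_linked)
        (use R flat_of_subset [of G C] loopless_ends [OF G] in \<open>auto simp: monochromatic_def\<close>)
  qed
qed

text \<open>The condition \<open>Q\<close> on the monochromatic edges of the contraction is arbitrary because two cases are
  needed: no such edges (proper colourings), and all edges (which gives the number of components).\<close>

lemma card_contract_colourings:
  assumes G: "loopless_multigraph G" and C: "C \<in> compositions G"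
  shows "card {g \<in> C \<rightarrow>\<^sub>E {..<k}. Q {e \<in> edges G - flat_of G C. \<not> inj_on g (ends (contract_graph G C) e)}} =
    card {c \<in> verts G \<rightarrow>\<^sub>E {..<k::nat}. flat_of G C \<subseteq> monochromatic (ends G) (edges G) c \<and>
      Q (monochromatic (ends G) (edges G) c - flat_of G C)}"
proof -
  note part = compositions_partition [OF C]
  let ?f = "\<lambda>g. \<lambda>v\<in>verts G. g (part_of C v)"
  let ?B = "{c \<in> verts G \<rightarrow>\<^sub>E {..<k}. flat_of G C \<subseteq> monochromatic (ends G) (edges G) c}"
  have bij: "bij_betw ?f (C \<rightarrow>\<^sub>E {..<k}) ?B"
    unfolding constant_on_parts_iff [OF G C, symmetric] by (rule bij_betw_colour_parts [OF part])
  have mono: "{e \<in> edges G - flat_of G C. \<not> inj_on g (ends (contract_graph G C) e)} =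
      monochromatic (ends G) (edges G) (?f g) - flat_of G C" for g :: "'a set \<Rightarrow> nat"
    using contract_edge_colour(1) [OF G part, of _ g] by (auto simp: monochromatic_def)
  have "bij_betw ?f {g \<in> C \<rightarrow>\<^sub>E {..<k}. Q (monochromatic (ends G) (edges G) (?f g) - flat_of G C)}
      {c \<in> ?B. Q (monochromatic (ends G) (edges G) c - flat_of G C)}"
  proof (rule bij_betw_subset [OF bij])
    show "?f ` {g \<in> C \<rightarrow>\<^sub>E {..<k}. Q (monochromatic (ends G) (edges G) (?f g) - flat_of G C)} =
        {c \<in> ?B. Q (monochromatic (ends G) (edges G) c - flat_of G C)}" (is "?f ` ?S = ?T")
    proof (intro equalityI subsetI)
      fix c assume c: "c \<in> ?T"
      then obtain g where "g \<in> C \<rightarrow>\<^sub>E {..<k}" "c = ?f g"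
        using bij unfolding bij_betw_def by blast
      then show "c \<in> ?f ` ?S" using c by blast
    next
      fix c assume "c \<in> ?f ` ?S"
      then obtain g where g: "g \<in> ?S" "c = ?f g" by blast
      then have "c \<in> ?B" using bij unfolding bij_betw_def by blast
      then show "c \<in> ?T" using g by simp
    qed
  qed simp
  from bij_betw_same_card [OF this] show ?thesis
    unfolding mono by simp
qed

lemma card_proper_colourings_contract:
  assumes G: "loopless_multigraph G" and C: "C \<in> compositions G"
  shows "card (proper_colourings (contract_graph G C) k) =
    card {c \<in> verts G \<rightarrow>\<^sub>E {..<k}. monochromatic (ends G) (edges G) c = flat_of G C}"
proof -
  have "proper_colourings (contract_graph G C) k =
      {g \<in> C \<rightarrow>\<^sub>E {..<k}. {e \<in> edges G - flat_of G C. \<not> inj_on g (ends (contract_graph G C) e)} = {}}"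
    by (auto simp: proper_colourings_def contract_graph_def)
  moreover have "F \<subseteq> M \<and> M - F = {} \<longleftrightarrow> M = F" for F M :: "'b set"
    by blast
  ultimately show ?thesis
    using card_contract_colourings [OF G C, of k "\<lambda>X. X = {}"] by simp
qed

text \<open>A graph with \<open>c\<close> components has \<open>2 ^ c\<close> colourings by two colours that are constant along
  all edges, and these are the same for a graph and its contractions.\<close>

lemma num_components_contract:
  assumes G: "loopless_multigraph G" and C: "C \<in> compositions G"
  shows "num_components (contract_graph G C) = num_components G"
proof -
  let ?H = "contract_graph G C"
  have H: "loopless_multigraph ?H" by (rule loopless_contract [OF G compositions_partition [OF C]])
  have "2 ^ num_components ?H = card {g \<in> verts ?H \<rightarrow>\<^sub>E {..<2::nat}. \<forall>e\<in>edges ?H. \<not> inj_on g (ends ?H e)}"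
    unfolding num_components_eq
    by (rule card_colourings_constant_on [symmetric])
      (use H in \<open>auto simp: loopless_multigraph_def\<close>)
  also have "\<dots> = card {g \<in> C \<rightarrow>\<^sub>E {..<2::nat}.
      {e \<in> edges G - flat_of G C. \<not> inj_on g (ends ?H e)} = edges G - flat_of G C}"
    by (rule arg_cong [where f = card]) (auto simp: contract_graph_def)
  also have "\<dots> = card {c \<in> verts G \<rightarrow>\<^sub>E {..<2::nat}. flat_of G C \<subseteq> monochromatic (ends G) (edges G) c \<and>
      monochromatic (ends G) (edges G) c - flat_of G C = edges G - flat_of G C}"
    by (rule card_contract_colourings [OF G C])
  also have "\<dots> = card {c \<in> verts G \<rightarrow>\<^sub>E {..<2::nat}. \<forall>e\<in>edges G. \<not> inj_on c (ends G e)}"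
    by (rule arg_cong [where f = card])
      (use flat_of_subset [of G C] in \<open>auto simp: monochromatic_def\<close>)
  also have "\<dots> = 2 ^ num_components G"
    unfolding num_components_eq
    by (rule card_colourings_constant_on) (use G in \<open>auto simp: loopless_multigraph_def\<close>)
  finally show ?thesis by simp
qed

section \<open>Chromatic polynomials and the Moebius invariant\<close>

lemma sum_Pow_neg_one:
  assumes "finite X"
  shows "(\<Sum>B\<in>Pow X. (- 1) ^ card B) = (if X = {} then 1 else 0 :: 'a :: comm_ring_1)"
proof -
  have "(\<Sum>B\<in>Pow X. (- 1) ^ card B) = (\<Prod>x\<in>X. 1 - 1 :: 'a)"
    using prod_diff_conv_sum [OF assms, of "\<lambda>_. 1 :: 'a" "\<lambda>_. 1"] by simp
  then show ?thesis using assms by (auto simp: power_0_left)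
qed

lemma coeff_neg_one_power_mult: "coeff ((- 1) ^ n * p) i = (- 1) ^ n * coeff (p :: 'a :: comm_ring_1 poly) i"
  by (cases "even n") simp_all

text \<open>For \<open>F \<subseteq> E\<close> this polynomial counts the colourings whose set of monochromatic edges is exactly
  \<open>F\<close>, by inclusion and exclusion. It is the chromatic polynomial of the contraction if \<open>F\<close> is
  a flat, and zero if \<open>F\<close> is not a flat. Therefore sums over compositions become sums over all
  sets of edges, which are easy to invert and to split.\<close>

definition colour_poly :: "('v, 'e) multigraph \<Rightarrow> 'e set \<Rightarrow> int poly" where
  "colour_poly G F = (\<Sum>B\<in>Pow (edges G - F). 
     (- 1) ^ card B * monom 1 (card (verts G) - graphic_rank (ends G) (F \<union> B)))"

lemma rk_eq_graphic_rank:
  assumes "loopless_multigraph G"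
  shows "rk G = graphic_rank (ends G) (edges G)"
  unfolding rk_eq
  by (rule graphic_rank_eq) (use assms in \<open>auto simp: loopless_multigraph_def\<close>)

lemma card_components_eq:
  assumes "loopless_multigraph G" "A \<subseteq> edges G"
  shows "card (components (verts G) (ends G) A) = card (verts G) - graphic_rank (ends G) A"
    and "graphic_rank (ends G) A \<le> card (verts G)"
proof -
  have "finite A" "finite (verts G)"
    using assms finite_subset loopless_finite by blast+
  moreover have "rank_in (verts G) (ends G) A = graphic_rank (ends G) A"
    by (rule graphic_rank_eq)
      (use assms \<open>finite A\<close> \<open>finite (verts G)\<close> in \<open>auto simp: loopless_multigraph_def\<close>)
  ultimately show "card (components (verts G) (ends G) A) = card (verts G) - graphic_rank (ends G) A"
      "graphic_rank (ends G) A \<le> card (verts G)"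
    using card_components_le [of "verts G" "ends G" A] by (auto simp: rank_in_def)
qed

lemma poly_colour_poly:
  assumes G: "loopless_multigraph G" and F: "F \<subseteq> edges G"
  shows "poly (colour_poly G F) (int k) =
    int (card {c \<in> verts G \<rightarrow>\<^sub>E {..<k}. monochromatic (ends G) (edges G) c = F})"
proof -
  let ?E = "edges G" and ?Col = "verts G \<rightarrow>\<^sub>E {..<k}"
  let ?M = "\<lambda>c. monochromatic (ends G) ?E c"
  have fin: "finite ?E" "finite (verts G)" using loopless_finite [OF G] by auto
  have finC: "finite ?Col" using fin by (intro finite_PiE) auto
  have count: "int k ^ (card (verts G) - graphic_rank (ends G) (F \<union> B)) =
      (\<Sum>c\<in>?Col. if F \<union> B \<subseteq> ?M c then 1 else 0)" if B: "B \<in> Pow (?E - F)" for B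
  proof -
    have sub: "F \<union> B \<subseteq> ?E" using F B by auto
    have "{c \<in> ?Col. F \<union> B \<subseteq> ?M c} = {c \<in> ?Col. \<forall>e\<in>F \<union> B. \<not> inj_on c (ends G e)}"
      using sub by (auto simp: monochromatic_def)
    also have "card \<dots> = k ^ card (components (verts G) (ends G) (F \<union> B))"
      by (rule card_colourings_constant_on) (use fin sub loopless_ends [OF G] in blast)+
    finally have "card {c \<in> ?Col. F \<union> B \<subseteq> ?M c} =
        k ^ card (components (verts G) (ends G) (F \<union> B))" .
    then show ?thesis
      using finC by (simp add: card_components_eq(1) [OF G sub] sum.If_cases Int_def)
  qed
  have "poly (colour_poly G F) (int k) =
      (\<Sum>B\<in>Pow (?E - F). (- 1) ^ card B * int k ^ (card (verts G) - graphic_rank (ends G) (F \<union> B)))"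
    by (simp add: colour_poly_def poly_sum poly_monom)
  also have "\<dots> = (\<Sum>B\<in>Pow (?E - F). \<Sum>c\<in>?Col. (- 1) ^ card B * (if F \<union> B \<subseteq> ?M c then 1 else 0))"
    by (intro sum.cong refl) (simp add: count sum_distrib_left)
  also have "\<dots> = (\<Sum>c\<in>?Col. \<Sum>B\<in>Pow (?E - F). (- 1) ^ card B * (if F \<union> B \<subseteq> ?M c then 1 else 0))"
    by (rule sum.swap)
  also have "\<dots> = (\<Sum>c\<in>?Col. if ?M c = F then 1 else 0)"
  proof (rule sum.cong [OF refl])
    fix c assume "c \<in> ?Col"
    have Msub: "?M c \<subseteq> ?E" by (auto simp: monochromatic_def)
    show "(\<Sum>B\<in>Pow (?E - F). (- 1) ^ card B * (if F \<union> B \<subseteq> ?M c then 1 else 0)) =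
        (if ?M c = F then 1 else 0 :: int)"
    proof (cases "F \<subseteq> ?M c")
      case True
      have "(\<Sum>B\<in>Pow (?E - F). (- 1) ^ card B * (if F \<union> B \<subseteq> ?M c then 1 else 0)) =
          (\<Sum>B\<in>Pow (?M c - F). (- 1) ^ card B :: int)"
        using fin Msub True by (intro sum.mono_neutral_cong_right) auto
      also have "\<dots> = (if ?M c = F then 1 else 0)"
        using sum_Pow_neg_one [of "?M c - F"] fin Msub True finite_subset by (auto simp: finite_subset)
      finally show ?thesis .
    qed auto
  qed
  also have "\<dots> = int (card {c \<in> ?Col. ?M c = F})"
    using finC by (simp add: sum.If_cases Int_def)
  finally show ?thesis .
qed

text \<open>Identities proved by counting colourings hold for every natural number of colours; this extends
  them to \<open>x = 1/t\<close> and to the coefficients.\<close>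

lemma poly_eqI_of_nat:
  fixes p q :: "'a :: {idom, ring_char_0} poly"
  assumes "\<And>k. poly p (of_nat k) = poly q (of_nat k)"
  shows "p = q"
proof (rule ccontr)
  assume "p \<noteq> q"
  then have "finite {x. poly (p - q) x = 0}" by (intro poly_roots_finite) simp
  moreover have "range (of_nat :: nat \<Rightarrow> 'a) \<subseteq> {x. poly (p - q) x = 0}" using assms by auto
  ultimately have "finite (range (of_nat :: nat \<Rightarrow> 'a))" by (rule finite_subset [rotated])
  then show False using finite_imageD [OF _ inj_of_nat] by blast
qed

lemma chromatic_poly_eqI:
  assumes "\<And>k. poly p (int k) = int (card (proper_colourings G k))"
  shows "chromatic_poly G = p"
  unfolding chromatic_poly_def
  by (rule the_equality) (use assms in \<open>auto intro: poly_eqI_of_nat\<close>)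

lemma chromatic_poly_eq:
  assumes "loopless_multigraph G"
  shows "chromatic_poly G = colour_poly G {}"
proof (rule chromatic_poly_eqI)
  fix k
  have "proper_colourings G k = {c \<in> verts G \<rightarrow>\<^sub>E {..<k}. monochromatic (ends G) (edges G) c = {}}"
    by (auto simp: proper_colourings_def monochromatic_def)
  then show "poly (colour_poly G {}) (int k) = int (card (proper_colourings G k))"
    using poly_colour_poly [OF assms, of "{}" k] by simp
qed

lemma chromatic_poly_contract:
  assumes "loopless_multigraph G" "C \<in> compositions G"
  shows "chromatic_poly (contract_graph G C) = colour_poly G (flat_of G C)"
  by (rule chromatic_poly_eqI)
    (simp only: poly_colour_poly [OF assms(1) flat_of_subset] card_proper_colourings_contract [OF assms])

lemma colour_poly_not_flat:
  assumes G: "loopless_multigraph G" and F: "F \<subseteq> edges G" "F \<notin> flat_of G ` compositions G"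
  shows "colour_poly G F = 0"
proof (rule poly_eqI_of_nat)
  fix k
  have "monochromatic (ends G) (edges G) c \<noteq> F" for c :: "'a \<Rightarrow> nat"
  proof
    assume "monochromatic (ends G) (edges G) c = F"
    then have "flat_of G (components (verts G) (ends G) F) = F"
      using monochromatic_is_flat [OF G] by blast
    then show False
      using F components_in_compositions [OF F(1) G] by (metis image_eqI)
  qed
  then show "poly (colour_poly G F) (of_nat k) = poly 0 (of_nat k)"
    using poly_colour_poly [OF G F(1), of k] by simp
qed

text \<open>Compositions correspond to flats, and the edge sets that are not flats contribute \<open>f F 0\<close>.\<close>

lemma sum_compositions:
  assumes G: "loopless_multigraph G" and "\<And>F. f F 0 = (0 :: 'b :: comm_monoid_add)"
  shows "(\<Sum>C\<in>compositions G. f (flat_of G C) (chromatic_poly (contract_graph G C))) =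
    (\<Sum>F\<in>Pow (edges G). f F (colour_poly G F))"
proof -
  have "(\<Sum>C\<in>compositions G. f (flat_of G C) (chromatic_poly (contract_graph G C))) =
      (\<Sum>C\<in>compositions G. f (flat_of G C) (colour_poly G (flat_of G C)))"
    by (simp add: chromatic_poly_contract [OF G])
  also have "\<dots> = (\<Sum>F\<in>flat_of G ` compositions G. f F (colour_poly G F))"
    by (simp add: sum.reindex [OF inj_on_flat_of])
  also have "\<dots> = (\<Sum>F\<in>Pow (edges G). f F (colour_poly G F))"
  proof (rule sum.mono_neutral_left)
    show "\<forall>F\<in>Pow (edges G) - flat_of G ` compositions G. f F (colour_poly G F) = 0"
      using colour_poly_not_flat [OF G] assms(2) by auto
    show "flat_of G ` compositions G \<subseteq> Pow (edges G)"
      by (rule image_subsetI) (simp add: flat_of_subset)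
  qed (use loopless_finite [OF G] in simp)
  finally show ?thesis .
qed

text \<open>By the rank increments, an edge set is closed in the matroid iff it contains every edge whose ends
  it links.\<close>

lemma flats_eq:
  assumes G: "loopless_multigraph G"
  shows "F \<in> flats G \<longleftrightarrow> F \<subseteq> edges G \<and>
    (\<forall>e\<in>edges G. \<forall>x y. ends G e = {x, y} \<longrightarrow> (x, y) \<in> linked (ends G) F \<longrightarrow> e \<in> F)"
proof -
  have "rk (G\<lparr>edges := F\<rparr>) < rk (G\<lparr>edges := insert e F\<rparr>) \<longleftrightarrow>
      (\<forall>x y. ends G e = {x, y} \<longrightarrow> (x, y) \<notin> linked (ends G) F)"
    if F: "F \<subseteq> edges G" and e: "e \<in> edges G" for e
  proof -
    obtain x y where xy: "ends G e = {x, y}" "x \<in> verts G" "y \<in> verts G"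
      by (rule loopless_endsE [OF G e])
    have "rk (G\<lparr>edges := insert e F\<rparr>) =
        rk (G\<lparr>edges := F\<rparr>) + (if (x, y) \<in> linked (ends G) F then 0 else 1)"
      unfolding rk_eq using rank_in_insert [of "verts G" "ends G" e x y F] xy loopless_finite [OF G]
      by simp
    moreover have "(\<forall>x y. ends G e = {x, y} \<longrightarrow> (x, y) \<notin> linked (ends G) F) \<longleftrightarrow>
        (x, y) \<notin> linked (ends G) F"
      using xy(1) linked_sym [of _ _ "ends G" F] by (auto simp: doubleton_eq_iff)
    ultimately show ?thesis by simp
  qed
  then show ?thesis unfolding flats_def by blast
qed

lemma graphic_rank_linked_cong:
  assumes G: "loopless_multigraph G" and "A \<subseteq> edges G" "B \<subseteq> edges G"
    and "linked (ends G) A = linked (ends G) B"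
  shows "graphic_rank (ends G) A = graphic_rank (ends G) B"
proof -
  have "components (verts G) (ends G) A = components (verts G) (ends G) B"
    by (simp add: components_def assms(4))
  then show ?thesis
    using card_components_eq [OF G assms(2)] card_components_eq [OF G assms(3)] by simp
qed

text \<open>The closure operator of the graphic matroid.\<close>

definition edge_span :: "('v, 'e) multigraph \<Rightarrow> 'e set \<Rightarrow> 'e set" where
  "edge_span G A = {e \<in> edges G. \<forall>x y. ends G e = {x, y} \<longrightarrow> (x, y) \<in> linked (ends G) A}"

lemma edge_span_superset:
  assumes "loopless_multigraph G" "A \<subseteq> edges G"
  shows "A \<subseteq> edge_span G A"
proof
  fix e assume e: "e \<in> A"
  have "(x, y) \<in> linked (ends G) A" if "ends G e = {x, y}" for x y
    using e that by (rule linked_edge)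
  then show "e \<in> edge_span G A" using e assms by (auto simp: edge_span_def)
qed

lemma linked_edge_span:
  assumes "loopless_multigraph G" "A \<subseteq> edges G"
  shows "linked (ends G) (edge_span G A) = linked (ends G) A"
proof (intro equalityI subrelI)
  fix x y assume "(x, y) \<in> linked (ends G) (edge_span G A)"
  then have "(id x, id y) \<in> linked (ends G) A"
    by (rule linked_image) (auto simp: edge_span_def)
  then show "(x, y) \<in> linked (ends G) A" by simp
next
  fix x y assume "(x, y) \<in> linked (ends G) A"
  then show "(x, y) \<in> linked (ends G) (edge_span G A)" by (rule linked_mono [OF edge_span_superset [OF assms]])
qed

text \<open>Hence every edge set has exactly one flat that contains it and has the same rank.\<close>

lemma flat_eq_edge_span_iff:
  assumes G: "loopless_multigraph G" and Z: "Z \<in> flats G" and A: "A \<subseteq> edges G"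
  shows "Z = edge_span G A \<longleftrightarrow> A \<subseteq> Z \<and> graphic_rank (ends G) A = graphic_rank (ends G) Z"
proof
  assume "Z = edge_span G A"
  then show "A \<subseteq> Z \<and> graphic_rank (ends G) A = graphic_rank (ends G) Z"
    using edge_span_superset [OF G A] linked_edge_span [OF G A]
      graphic_rank_linked_cong [OF G A, of Z] Z by (simp add: flats_def)
next
  assume AZ: "A \<subseteq> Z \<and> graphic_rank (ends G) A = graphic_rank (ends G) Z"
  have ZE: "Z \<subseteq> edges G" using Z by (simp add: flats_def)
  have fin: "finite Z" "finite A" using ZE AZ loopless_finite [OF G] by (meson finite_subset)+
  show "Z = edge_span G A"
  proof (intro equalityI subsetI)
    fix e assume e: "e \<in> Z"
    then have eE: "e \<in> edges G" using ZE by auto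
    show "e \<in> edge_span G A"
    proof (rule ccontr)
      assume "e \<notin> edge_span G A"
      then obtain x y where xy: "ends G e = {x, y}" "(x, y) \<notin> linked (ends G) A"
        using eE by (auto simp: edge_span_def)
      then have "x \<noteq> y" by auto
      have "graphic_rank (ends G) (insert e A) = graphic_rank (ends G) A + 1"
        using graphic_rank_insert [of A "ends G" e x y] xy \<open>x \<noteq> y\<close> fin A loopless_ends(2) [OF G]
        by auto
      moreover have "graphic_rank (ends G) (insert e A) \<le> graphic_rank (ends G) Z"
        by (rule graphic_rank_mono) (use fin e AZ ZE loopless_ends(2) [OF G] in auto)
      ultimately show False using AZ by simp
    qed
  next
    fix e assume e: "e \<in> edge_span G A"
    then have eE: "e \<in> edges G" by (simp add: edge_span_def)
    obtain x y where xy: "ends G e = {x, y}" by (rule loopless_endsE [OF G eE])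
    have "(x, y) \<in> linked (ends G) A" using e xy by (simp add: edge_span_def)
    then have "(x, y) \<in> linked (ends G) Z" using AZ linked_mono by metis
    then show "e \<in> Z" using Z eE xy unfolding flats_eq [OF G] by blast
  qed
qed

lemma edge_span_in_flats:
  assumes G: "loopless_multigraph G" and A: "A \<subseteq> edges G"
  shows "edge_span G A \<in> flats G"
  unfolding flats_eq [OF G] linked_edge_span [OF G A]
proof (intro conjI ballI allI impI)
  fix e x y assume e: "e \<in> edges G" "ends G e = {x, y}" "(x, y) \<in> linked (ends G) A"
  have "(x', y') \<in> linked (ends G) A" if "ends G e = {x', y'}" for x' y'
    using that e linked_sym [OF e(3)] by (auto simp: doubleton_eq_iff)
  then show "e \<in> edge_span G A" using e(1) by (simp add: edge_span_def)
qed (auto simp: edge_span_def)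

text \<open>Group the sets \<open>A \<subseteq> F\<close> by the flat that they span: the sums of \<open>(-1) ^ card A\<close> over these groups
  add up to the alternating sum over all subsets of \<open>F\<close>, which is the recursion of the Moebius
  function.\<close>

lemma moebius_flats:
  assumes G: "loopless_multigraph G" and F: "F \<in> flats G"
  shows "moebius (flats G) {} F =
    (\<Sum>A | A \<subseteq> F \<and> graphic_rank (ends G) A = graphic_rank (ends G) F. (- 1) ^ card A)"
  using F
proof (induction "card F" arbitrary: F rule: less_induct)
  case less
  let ?r = "graphic_rank (ends G)"
  let ?m = "\<lambda>Z. \<Sum>A | A \<subseteq> Z \<and> ?r A = ?r Z. (- 1) ^ card A :: int"
  have finE: "finite (edges G)" using loopless_finite [OF G] by simp
  have flE: "Z \<subseteq> edges G" if "Z \<in> flats G" for Z using that by (simp add: flats_def)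
  have finF: "finite F" using flE [OF less.prems] finE by (rule finite_subset)
  have finL: "finite (flats G)"
    by (rule finite_subset [of _ "Pow (edges G)"]) (use flE finE in auto)
  show ?case
  proof (cases "F = {}")
    case True
    then have "{A. A \<subseteq> F \<and> ?r A = ?r F} = {{}}" by auto
    then show ?thesis using True by (simp add: moebius.simps)
  next
    case False
    let ?L = "{Z \<in> flats G. Z \<subseteq> F}"
    have "(\<Sum>Z\<in>?L. ?m Z) = (\<Sum>Z\<in>?L. \<Sum>A | A \<in> Pow F \<and> edge_span G A = Z. (- 1) ^ card A)"
    proof (rule sum.cong [OF refl])
      fix Z assume Z: "Z \<in> ?L"
      have "A \<subseteq> Z \<and> ?r A = ?r Z \<longleftrightarrow> A \<in> Pow F \<and> edge_span G A = Z" for A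
      proof (cases "A \<subseteq> F")
        case True
        then have "A \<subseteq> edges G" using flE [OF less.prems] by blast
        then show ?thesis using flat_eq_edge_span_iff [OF G, of Z A] Z True by auto
      qed (use Z in auto)
      then show "?m Z = (\<Sum>A | A \<in> Pow F \<and> edge_span G A = Z. (- 1) ^ card A)" by simp
    qed
    also have "\<dots> = (\<Sum>A\<in>Pow F. (- 1) ^ card A)"
    proof (rule sum.group)
      have "edge_span G A \<subseteq> F" if "A \<subseteq> F" for A
      proof
        fix e assume e: "e \<in> edge_span G A"
        then have eE: "e \<in> edges G" by (simp add: edge_span_def)
        obtain x y where xy: "ends G e = {x, y}" by (rule loopless_endsE [OF G eE])
        have "(x, y) \<in> linked (ends G) A" using e xy by (simp add: edge_span_def)
        then have "(x, y) \<in> linked (ends G) F" using that linked_mono by metis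
        then show "e \<in> F" using less.prems eE xy unfolding flats_eq [OF G] by blast
      qed
      then show "edge_span G ` Pow F \<subseteq> ?L"
        using edge_span_in_flats [OF G] flE [OF less.prems] by auto
    qed (use finF finL in auto)
    also have "\<dots> = 0" using sum_Pow_neg_one [OF finF] False by simp
    finally have zero: "(\<Sum>Z\<in>?L. ?m Z) = 0" .
    have "?L = insert F {Z \<in> flats G. {} \<le> Z \<and> Z < F}" using less.prems by auto
    then have "(\<Sum>Z\<in>?L. ?m Z) = ?m F + (\<Sum>Z\<in>{Z \<in> flats G. {} \<le> Z \<and> Z < F}. ?m Z)"
      using finL by simp
    moreover have "(\<Sum>Z\<in>{Z \<in> flats G. {} \<le> Z \<and> Z < F}. ?m Z) =
        (\<Sum>Z\<in>{Z \<in> flats G. {} \<le> Z \<and> Z < F}. moebius (flats G) {} Z)"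
      by (rule sum.cong [OF refl])
        (use less.hyps finF in \<open>auto intro!: less.hyps [symmetric] psubset_card_mono\<close>)
    moreover have "moebius (flats G) {} F =
        - (\<Sum>Z\<in>{Z \<in> flats G. {} \<le> Z \<and> Z < F}. moebius (flats G) {} Z)"
      using False finL by (subst moebius.simps) auto
    ultimately show ?thesis using zero by simp
  qed
qed

text \<open>In the expansion of the chromatic polynomial over edge sets \<open>A\<close>, the exponent is the number of
  components of \<open>A\<close>. It equals that of \<open>G\<close> for the spanning sets, which are the terms of the Moebius
  function.\<close>

lemma moebius_invariant_eq_coeff:
  assumes G: "loopless_multigraph G"
  shows "moebius_invariant G = coeff (chromatic_poly G) (num_components G)"
proof -
  let ?E = "edges G" and ?r = "graphic_rank (ends G)"
  have finE: "finite ?E" using loopless_finite [OF G] by simp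
  have "?E \<in> flats G" by (auto simp: flats_def)
  then have "moebius_invariant G = (\<Sum>A | A \<subseteq> ?E \<and> ?r A = ?r ?E. (- 1) ^ card A)"
    using moebius_flats [OF G] by (simp add: moebius_invariant_def)
  also have "\<dots> = (\<Sum>A\<in>Pow ?E. if ?r A = ?r ?E then (- 1) ^ card A else 0)"
    using finE by (simp add: sum.If_cases Int_def Pow_def)
  also have "\<dots> = (\<Sum>A\<in>Pow ?E. coeff ((- 1) ^ card A * monom 1 (card (verts G) - ?r A)) (num_components G))"
  proof (rule sum.cong [OF refl])
    fix A assume A: "A \<in> Pow ?E"
    have "num_components G = card (verts G) - ?r ?E"
      unfolding num_components_eq by (rule card_components_eq(1) [OF G]) simp
    moreover have "?r A \<le> ?r ?E"
      by (rule graphic_rank_mono) (use A finE loopless_ends(2) [OF G] in auto)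
    moreover have "?r ?E \<le> card (verts G)" by (rule card_components_eq(2) [OF G]) simp
    ultimately have "num_components G = card (verts G) - ?r A \<longleftrightarrow> ?r A = ?r ?E" by auto
    then show "(if ?r A = ?r ?E then (- 1) ^ card A else 0) =
        coeff ((- 1 :: int poly) ^ card A * monom 1 (card (verts G) - ?r A)) (num_components G)"
      by (auto simp: coeff_neg_one_power_mult)
  qed
  also have "\<dots> = coeff (chromatic_poly G) (num_components G)"
    by (simp add: chromatic_poly_eq [OF G] colour_poly_def coeff_sum)
  finally show ?thesis .
qed

section \<open>Evaluation in the fraction field\<close>

lemma poly_at_pCons [simp]: "poly_at (pCons a p) x = of_int a + x * poly_at p x"
  by (simp add: poly_at_def map_poly_pCons)

lemma poly_at_0 [simp]: "poly_at 0 x = 0"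
  by (simp add: poly_at_def)

lemma poly_at_1 [simp]: "poly_at 1 x = 1"
  by (simp add: poly_at_def)

lemma poly_at_add [simp]: "poly_at (p + q) x = poly_at p x + poly_at q x"
proof (induction p arbitrary: q)
  case (pCons a p)
  then show ?case by (cases q) (simp add: algebra_simps)
qed simp

lemma poly_at_smult [simp]: "poly_at (smult a p) x = of_int a * poly_at p x"
  by (induction p) (simp_all add: algebra_simps)

lemma poly_at_uminus [simp]: "poly_at (- p) x = - poly_at p x"
  using poly_at_smult [of "- 1" p x] by simp

lemma poly_at_mult [simp]: "poly_at (p * q) x = poly_at p x * poly_at q x"
  by (induction p) (simp_all add: algebra_simps)

lemma poly_at_power [simp]: "poly_at (p ^ n) x = poly_at p x ^ n"
  by (induction n) simp_all

lemma poly_at_sum: "poly_at (\<Sum>i\<in>I. p i) x = (\<Sum>i\<in>I. poly_at (p i) x)"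
  by (induction I rule: infinite_finite_induct) simp_all

lemma poly_at_monom [simp]: "poly_at (monom a n) x = of_int a * x ^ n"
  by (induction n) (simp_all add: monom_0 monom_Suc)

lemma to_fract_of_nat: "to_fract (of_nat n) = of_nat n"
  by (induction n) simp_all

lemma to_fract_of_int: "to_fract (of_int a) = of_int a"
proof (cases a rule: int_cases2)
  case (nonneg n)
  then show ?thesis by (simp add: to_fract_of_nat)
next
  case (nonpos n)
  then show ?thesis by (simp add: to_fract_of_nat)
qed

lemma poly_at_tvar: "poly_at p tvar = to_fract p"
proof (induction p)
  case (pCons a p)
  have "pCons a p = of_int a + [:0, 1:] * p" by (simp add: of_int_poly)
  then have "to_fract (pCons a p) = of_int a + tvar * to_fract p"
    by (metis to_fract_add to_fract_mult to_fract_of_int)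
  then show ?case using pCons by simp
qed simp

lemma to_fract_sum: "to_fract (\<Sum>i\<in>I. f i) = (\<Sum>i\<in>I. to_fract (f i))"
  by (induction I rule: infinite_finite_induct) simp_all

lemma to_fract_power: "to_fract (p ^ n) = to_fract p ^ n"
  by (induction n) simp_all

lemma poly_at_altdef:
  assumes "degree p \<le> d"
  shows "poly_at p x = (\<Sum>i\<le>d. of_int (coeff p i) * x ^ i)"
proof -
  have "p = (\<Sum>i\<le>d. monom (coeff p i) i)"
    using assms by (rule poly_as_sum_of_monoms' [symmetric])
  then have "poly_at p x = poly_at (\<Sum>i\<le>d. monom (coeff p i) i) x" by simp
  then show ?thesis by (simp add: poly_at_sum)
qed

section \<open>Inverse Kazhdan--Lusztig polynomials of a rank function\<close>

text \<open>For a polynomial \<open>p\<close> of degree at most \<open>d\<close> this is \<open>t\<^sup>d p(1/t)\<close>.\<close>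

definition flip :: "nat \<Rightarrow> int poly \<Rightarrow> int poly" where
  "flip d p = (\<Sum>i\<le>d. monom (coeff p i) (d - i))"

lemma coeff_flip: "coeff (flip d p) i = (if i \<le> d then coeff p (d - i) else 0)"
proof -
  have "coeff (flip d p) i = (\<Sum>j\<le>d. if j = d - i \<and> i \<le> d then coeff p j else 0)"
    unfolding flip_def coeff_sum by (rule sum.cong) auto
  then show ?thesis by (cases "i \<le> d") simp_all
qed

lemma to_fract_flip:
  assumes "degree p \<le> d"
  shows "to_fract (flip d p) = tvar ^ d * poly_at p (inverse tvar)"
proof -
  have "to_fract (flip d p) = poly_at (flip d p) tvar" by (rule poly_at_tvar [symmetric])
  also have "\<dots> = (\<Sum>i\<le>d. of_int (coeff p i) * tvar ^ (d - i))"
    by (simp add: flip_def poly_at_sum)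
  also have "\<dots> = (\<Sum>i\<le>d. tvar ^ d * (of_int (coeff p i) * inverse tvar ^ i))"
    by (rule sum.cong) (simp_all add: power_diff divide_inverse power_inverse mult_ac)
  also have "\<dots> = tvar ^ d * poly_at p (inverse tvar)"
    by (simp add: poly_at_altdef [OF assms] sum_distrib_left)
  finally show ?thesis .
qed

definition palindromic :: "nat \<Rightarrow> int poly \<Rightarrow> bool" where
  "palindromic d p \<longleftrightarrow> flip d p = p"

lemma palindromic_coeff:
  "palindromic d p \<longleftrightarrow> (\<forall>i. coeff p i = (if i \<le> d then coeff p (d - i) else 0))"
  unfolding palindromic_def poly_eq_iff coeff_flip by (rule iff_allI) (rule eq_commute)

lemma palindromic_degree: "palindromic d p \<Longrightarrow> degree p \<le> d"
proof (rule degree_le, intro allI impI)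
  fix i assume p: "palindromic d p" and i: "d < i"
  have "coeff p i = coeff (flip d p) i" using p by (simp only: palindromic_def)
  then show "coeff p i = 0" using i by (simp add: coeff_flip)
qed

lemma palindromic_iff:
  assumes "degree p \<le> d"
  shows "palindromic d p \<longleftrightarrow> tvar ^ d * poly_at p (inverse tvar) = to_fract p"
  unfolding palindromic_def to_fract_flip [OF assms, symmetric] by auto

lemma palindromic_mult:
  assumes "palindromic d p" "palindromic e q"
  shows "palindromic (d + e) (p * q)"
proof -
  note deg = palindromic_degree [OF assms(1)] palindromic_degree [OF assms(2)]
  have "degree (p * q) \<le> d + e" using degree_mult_le [of p q] deg by linarith
  moreover have "tvar ^ (d + e) * poly_at (p * q) (inverse tvar) =
      (tvar ^ d * poly_at p (inverse tvar)) * (tvar ^ e * poly_at q (inverse tvar))"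
    by (simp add: power_add algebra_simps)
  moreover have "tvar ^ d * poly_at p (inverse tvar) = to_fract p"
      "tvar ^ e * poly_at q (inverse tvar) = to_fract q"
    using palindromic_iff [OF deg(1)] palindromic_iff [OF deg(2)] assms by blast+
  ultimately show ?thesis
    by (simp only: palindromic_iff to_fract_mult)
qed

lemma palindromic_diff: "palindromic d p \<Longrightarrow> palindromic d q \<Longrightarrow> palindromic d (p - q)"
proof -
  have "flip d (p - q) = flip d p - flip d q" by (rule poly_eqI) (simp add: coeff_flip)
  then show "palindromic d p \<Longrightarrow> palindromic d q \<Longrightarrow> palindromic d (p - q)"
    by (simp only: palindromic_def)
qed

lemma palindromic_low_degree:
  assumes "palindromic d p" "\<And>i. d \<le> 2 * i \<Longrightarrow> coeff p i = 0"
  shows "p = 0"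
proof (rule poly_eqI)
  fix i
  show "coeff p i = coeff 0 i"
  proof (cases "d \<le> 2 * i")
    case False
    have "coeff p i = coeff (flip d p) i" using assms(1) by (simp only: palindromic_def)
    also have "\<dots> = 0" using False assms(2) [of "d - i"] by (simp add: coeff_flip)
    finally show ?thesis by simp
  qed (simp add: assms(2))
qed

text \<open>For \<open>i \<ge> d/2\<close> the coefficient is the negative of that of \<open>S\<close>, so that the upper half of \<open>S\<close> is
  cancelled; the lower half is the mirror image, so that the result is palindromic.\<close>

definition cancel_upper :: "nat \<Rightarrow> int poly \<Rightarrow> int poly" where
  "cancel_upper d S = - (\<Sum>i\<le>d. monom (coeff S (max i (d - i))) i)"

lemma coeff_cancel_upper:
  "coeff (cancel_upper d S) i = (if i \<le> d then - coeff S (max i (d - i)) else 0)"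
proof -
  have "coeff (cancel_upper d S) i = - (\<Sum>j\<le>d. if j = i then coeff S (max j (d - j)) else 0)"
    unfolding cancel_upper_def coeff_minus coeff_sum
    by (intro arg_cong [where f = uminus] sum.cong) auto
  then show ?thesis by simp
qed

lemma palindromic_cancel_upper: "palindromic d (cancel_upper d S)"
  using max.commute [of _ "d - _"] by (auto simp: palindromic_coeff coeff_cancel_upper)

lemma cancel_upper_upper:
  assumes "degree S \<le> d" "d \<le> 2 * i"
  shows "coeff (S + cancel_upper d S) i = 0"
proof (cases "i \<le> d")
  case True
  have "max i (d - i) = i" using assms(2) by (intro max_absorb1) linarith
  then show ?thesis using True by (simp add: coeff_cancel_upper)
next
  case False
  then show ?thesis using assms(1) by (simp add: coeff_cancel_upper coeff_eq_0)
qed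

text \<open>The difference of two solutions is palindromic and has no upper half, so it has no lower half
  either.\<close>

lemma cancel_upper_unique:
  assumes "degree S \<le> d" "palindromic d h" "\<And>i. d \<le> 2 * i \<Longrightarrow> coeff (S + h) i = 0"
  shows "h = cancel_upper d S"
proof -
  have "h - cancel_upper d S = 0"
  proof (rule palindromic_low_degree)
    show "palindromic d (h - cancel_upper d S)"
      by (rule palindromic_diff [OF assms(2) palindromic_cancel_upper])
    fix i assume "d \<le> 2 * i"
    then show "coeff (h - cancel_upper d S) i = 0"
      using assms(3) [of i] cancel_upper_upper [OF assms(1), of i] by simp
  qed
  then show ?thesis by simp
qed

lemma upper_half_zero_iff:
  assumes "0 < d"
  shows "(\<forall>i. d \<le> 2 * i \<longrightarrow> coeff p i = 0) \<longleftrightarrow> 2 * degree p < d"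
proof
  assume L: "\<forall>i. d \<le> 2 * i \<longrightarrow> coeff p i = 0"
  show "2 * degree p < d"
  proof (cases "p = 0")
    case False
    then have "coeff p (degree p) \<noteq> 0" by simp
    then have "\<not> d \<le> 2 * degree p" using L by blast
    then show ?thesis by simp
  qed (use assms in simp)
qed (auto intro: coeff_eq_0)

text \<open>The kernel of \<open>A\<close> is \<open>t ^ r A\<close> times the Boolean Moebius transform at \<open>A\<close> of the weight
  \<open>(-1/t) ^ r F * Q F\<close>. The defining identity of the inverse Kazhdan--Lusztig polynomials says that
  all kernels are palindromic, and the degree bound on \<open>Q\<close> then leaves only one choice in each step.
  The kernel of the empty set is 1 because \<open>Q\<close> is 1 in rank 0, where the degree bound does not apply;
  the value at infinite sets is arbitrary.\<close>

function KL_kernel :: "('e set \<Rightarrow> nat) \<Rightarrow> 'e set \<Rightarrow> int poly" where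
  "KL_kernel r E = (if E = {} \<or> infinite E then 1
     else cancel_upper (r E) (\<Sum>A\<in>{A. A \<subset> E}. monom 1 (r E - r A) * KL_kernel r A))"
  by auto
termination
  by (relation "measure (\<lambda>(r, E). card E)") (auto intro: psubset_card_mono)

declare KL_kernel.simps [simp del]

definition rank_KL :: "('e set \<Rightarrow> nat) \<Rightarrow> 'e set \<Rightarrow> int poly" where
  "rank_KL r E = (- 1) ^ r E * (\<Sum>A\<in>Pow E. monom 1 (r E - r A) * KL_kernel r A)"

text \<open>The properties of a matroid rank function without loops on which the recursion rests.\<close>

definition loopless_rank :: "('e set \<Rightarrow> nat) \<Rightarrow> 'e set \<Rightarrow> bool" where
  "loopless_rank r E \<longleftrightarrow> finite E \<and> r {} = 0 \<and> (\<forall>B A. A \<subseteq> B \<longrightarrow> B \<subseteq> E \<longrightarrow> r A \<le> r B) \<and>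
     (\<forall>A. A \<subseteq> E \<longrightarrow> r A = 0 \<longrightarrow> A = {})"

lemma loopless_rankD:
  assumes "loopless_rank r E"
  shows "finite E" "r {} = 0" "A \<subseteq> B \<Longrightarrow> B \<subseteq> E \<Longrightarrow> r A \<le> r B" "A \<subseteq> E \<Longrightarrow> A \<noteq> {} \<Longrightarrow> 0 < r A"
proof -
  show "0 < r A" if "A \<subseteq> E" "A \<noteq> {}"
  proof -
    have "r A \<noteq> 0" using assms that unfolding loopless_rank_def by blast
    then show ?thesis by simp
  qed
qed (use assms in \<open>unfold loopless_rank_def, blast+\<close>)

lemma loopless_rank_subset:
  assumes "loopless_rank r E" "F \<subseteq> E"
  shows "loopless_rank r F"
  unfolding loopless_rank_def
proof (intro conjI allI impI)
  show "finite F" using loopless_rankD(1) [OF assms(1)] assms(2) by (rule finite_subset [rotated])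
  show "r {} = 0" by (rule loopless_rankD(2) [OF assms(1)])
  show "r A \<le> r B" if "A \<subseteq> B" "B \<subseteq> F" for A B
    using loopless_rankD(3) [OF assms(1) that(1)] that(2) assms(2) by blast
  show "A = {}" if "A \<subseteq> F" "r A = 0" for A
    using loopless_rankD(4) [OF assms(1), of A] that assms(2) by auto
qed

lemma KL_kernel_empty [simp]: "KL_kernel r {} = 1"
  by (simp add: KL_kernel.simps)

lemma palindromic_KL_kernel:
  assumes "loopless_rank r E"
  shows "palindromic (r E) (KL_kernel r E)"
proof (cases "E = {}")
  case True
  then show ?thesis
    using loopless_rankD(2) [OF assms] by (simp add: palindromic_coeff)
next
  case False
  then show ?thesis
    using loopless_rankD(1) [OF assms] palindromic_cancel_upper by (subst KL_kernel.simps) simp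
qed

lemma degree_KL_kernel_sum:
  assumes "loopless_rank r E" "\<A> \<subseteq> Pow E"
  shows "degree (\<Sum>A\<in>\<A>. monom 1 (r E - r A) * KL_kernel r A) \<le> r E"
proof (rule degree_sum_le)
  show "finite \<A>" using assms(2) loopless_rankD(1) [OF assms(1)] by (simp add: finite_subset)
  fix A assume "A \<in> \<A>"
  then have A: "A \<subseteq> E" using assms(2) by auto
  have "degree (monom 1 (r E - r A) * KL_kernel r A) \<le> (r E - r A) + degree (KL_kernel r A)"
    using degree_mult_le [of "monom 1 (r E - r A)" "KL_kernel r A"] degree_monom_le [of "1 :: int" "r E - r A"]
    by linarith
  also have "\<dots> \<le> (r E - r A) + r A"
    using palindromic_degree [OF palindromic_KL_kernel [OF loopless_rank_subset [OF assms(1) A]]] by simp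
  also have "\<dots> = r E" using loopless_rankD(3) [OF assms(1) A] by simp
  finally show "degree (monom 1 (r E - r A) * KL_kernel r A) \<le> r E" .
qed

lemma KL_kernel_sum_split:
  assumes "finite E"
  shows "(\<Sum>A\<in>Pow E. monom 1 (r E - r A) * KL_kernel r A) =
    (\<Sum>A\<in>{A. A \<subset> E}. monom 1 (r E - r A) * KL_kernel r A) + KL_kernel r E"
proof -
  have "Pow E = insert E {A. A \<subset> E}" by auto
  moreover have "finite {A. A \<subset> E}"
    by (rule finite_subset [of _ "Pow E"]) (use assms in auto)
  ultimately show ?thesis by simp
qed

lemma KL_kernel_sum_upper:
  assumes "loopless_rank r E" "E \<noteq> {}"
  shows "2 * degree (\<Sum>A\<in>Pow E. monom 1 (r E - r A) * KL_kernel r A) < r E"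
proof -
  let ?S = "\<Sum>A\<in>{A. A \<subset> E}. monom 1 (r E - r A) * KL_kernel r A"
  have pos: "0 < r E" using loopless_rankD(4) [OF assms(1) subset_refl assms(2)] .
  have fin: "finite E" using assms(1) by (rule loopless_rankD(1))
  have "KL_kernel r E = cancel_upper (r E) ?S"
    using assms(2) fin by (subst KL_kernel.simps) simp
  then have "\<forall>i. r E \<le> 2 * i \<longrightarrow> coeff (?S + KL_kernel r E) i = 0"
    using cancel_upper_upper [of ?S "r E"] degree_KL_kernel_sum [OF assms(1), of "{A. A \<subset> E}"] by auto
  then show ?thesis
    unfolding KL_kernel_sum_split [OF fin] upper_half_zero_iff [OF pos] .
qed

lemma neg_one_power_mult_self: "(- 1) ^ n * ((- 1) ^ n * x) = (x :: 'a :: comm_ring_1)"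
  by (simp flip: mult.assoc power_mult_distrib)

lemma degree_neg_one_power_mult: "degree ((- 1) ^ n * p) = degree (p :: int poly)"
  by (cases "even n") simp_all

lemma degree_rank_KL:
  assumes "loopless_rank r E" "E \<noteq> {}"
  shows "2 * degree (rank_KL r E) < r E"
  using KL_kernel_sum_upper [OF assms] by (simp add: rank_KL_def degree_neg_one_power_mult)

lemma rank_KL_empty: "r {} = 0 \<Longrightarrow> rank_KL r {} = 1"
  by (simp add: rank_KL_def)

lemma KL_kernel_cong:
  assumes "\<And>A. A \<subseteq> E \<Longrightarrow> r A = r' A"
  shows "KL_kernel r E = KL_kernel r' E"
  using assms
proof (induction "card E" arbitrary: E rule: less_induct)
  case less
  show ?case
  proof (cases "E = {} \<or> infinite E")
    case False
    have "KL_kernel r A = KL_kernel r' A" if "A \<subset> E" for A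
      using that less False by (meson order_trans psubset_card_mono psubset_imp_subset)
    then have "(\<Sum>A\<in>{A. A \<subset> E}. monom 1 (r E - r A) * KL_kernel r A) =
        (\<Sum>A\<in>{A. A \<subset> E}. monom 1 (r' E - r' A) * KL_kernel r' A)"
      using less.prems by (intro sum.cong) auto
    then show ?thesis using less.prems [of E] by (subst (1 2) KL_kernel.simps) simp
  qed (auto simp: KL_kernel.simps)
qed

lemma rank_KL_cong:
  assumes "\<And>A. A \<subseteq> E \<Longrightarrow> r A = r' A"
  shows "rank_KL r E = rank_KL r' E"
  unfolding rank_KL_def
  by (intro arg_cong2 [where f = times] sum.cong arg_cong2 [where f = "\<lambda>n p. (- 1) ^ n * p"])
    (use assms KL_kernel_cong [of _ r r'] in auto)

lemma KL_kernel_image: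
  assumes "inj_on f E"
  shows "KL_kernel r (f ` E) = KL_kernel (\<lambda>A. r (f ` A)) E"
  using assms
proof (induction "card E" arbitrary: E rule: less_induct)
  case less
  show ?case
  proof (cases "E = {} \<or> infinite E")
    case True
    then show ?thesis using finite_image_iff [OF less.prems] by (auto simp: KL_kernel.simps)
  next
    case False
    have inj: "inj_on ((`) f) {A. A \<subset> E}"
      using inj_on_image_Pow [OF less.prems] by (rule inj_on_subset) auto
    have im: "{B. B \<subset> f ` E} = (`) f ` {A. A \<subset> E}"
    proof (intro equalityI subsetI)
      fix B assume "B \<in> {B. B \<subset> f ` E}"
      then have B: "B \<subseteq> f ` E" "B \<noteq> f ` E" by auto
      then obtain A where "A \<subseteq> E" "B = f ` A" by (auto simp: subset_image_iff)
      then show "B \<in> (`) f ` {A. A \<subset> E}" using B by blast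
    next
      fix B assume "B \<in> (`) f ` {A. A \<subset> E}"
      then obtain A where A: "A \<subset> E" "B = f ` A" by auto
      then have "B \<noteq> f ` E"
        using inj_on_image_eq_iff [OF less.prems, of A E] by auto
      then show "B \<in> {B. B \<subset> f ` E}" using A by auto
    qed
    have "KL_kernel r (f ` A) = KL_kernel (\<lambda>A. r (f ` A)) A" if "A \<subset> E" for A
      using that less(1)[of A] False psubset_card_mono [of E A] inj_on_subset [OF less.prems] by auto
    then have "(\<Sum>B\<in>{B. B \<subset> f ` E}. monom 1 (r (f ` E) - r B) * KL_kernel r B) =
        (\<Sum>A\<in>{A. A \<subset> E}. monom 1 (r (f ` E) - r (f ` A)) * KL_kernel (\<lambda>A. r (f ` A)) A)"
      unfolding im by (subst sum.reindex [OF inj]) (auto intro: sum.cong)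
    then show ?thesis
      using False finite_image_iff [OF less.prems] by (subst (1 2) KL_kernel.simps) auto
  qed
qed

lemma rank_KL_image:
  assumes "inj_on f E"
  shows "rank_KL r (f ` E) = rank_KL (\<lambda>A. r (f ` A)) E"
proof -
  have "(\<Sum>B\<in>Pow (f ` E). monom 1 (r (f ` E) - r B) * KL_kernel r B) =
      (\<Sum>A\<in>Pow E. monom 1 (r (f ` E) - r (f ` A)) * KL_kernel (\<lambda>A. r (f ` A)) A)"
    unfolding image_Pow_surj [OF refl, of f E, symmetric]
    by (subst sum.reindex [OF inj_on_image_Pow [OF assms]])
      (auto intro!: sum.cong KL_kernel_image inj_on_subset [OF assms])
  then show ?thesis by (simp add: rank_KL_def)
qed

lemma monom_1_add: "monom (1 :: int) (m + n) = monom 1 m * monom 1 n"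
  by (simp add: mult_monom)

lemma bij_betw_Un_Pow:
  assumes "E \<inter> F = {}"
  shows "bij_betw (\<lambda>(A, B). A \<union> B) (Pow E \<times> Pow F) (Pow (E \<union> F))"
  by (rule bij_betw_byWitness [where f' = "\<lambda>D. (D \<inter> E, D \<inter> F)"]) (use assms in auto)

text \<open>By induction, the proper subsets of a direct sum contribute the product of the two sums, without
  the product of the two top kernels. Adding this product, which is palindromic, leaves a product of
  two polynomials of small degree, which has small degree. So it is the kernel.\<close>

lemma KL_kernel_union:
  assumes "loopless_rank r (E \<union> F)" "E \<inter> F = {}"
    and "\<And>A B. A \<subseteq> E \<Longrightarrow> B \<subseteq> F \<Longrightarrow> r (A \<union> B) = r A + r B"
  shows "KL_kernel r (E \<union> F) = KL_kernel r E * KL_kernel r F"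
  using assms
proof (induction "card (E \<union> F)" arbitrary: E F rule: less_induct)
  case less
  show ?case
  proof (cases "E = {} \<or> F = {}")
    case True
    then show ?thesis by auto
  next
    case False
    let ?U = "E \<union> F"
    have fin: "finite ?U" using less.prems(1) by (rule loopless_rankD(1))
    have lr: "loopless_rank r E" "loopless_rank r F"
      using less.prems(1) by (auto intro: loopless_rank_subset)
    have rU: "r ?U = r E + r F" using less.prems(3) by simp
    let ?p = "\<lambda>E. \<Sum>A\<in>Pow E. monom 1 (r E - r A) * KL_kernel r A"
    let ?S = "\<Sum>A\<in>{A. A \<subset> ?U}. monom 1 (r ?U - r A) * KL_kernel r A"
    let ?T = "\<lambda>A B. monom 1 (r E - r A) * KL_kernel r A * (monom 1 (r F - r B) * KL_kernel r B)"
    have summand: "monom 1 (r ?U - r (A \<union> B)) * KL_kernel r (A \<union> B) = ?T A B"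
      if "A \<subseteq> E" "B \<subseteq> F" "A \<union> B \<noteq> ?U" for A B
    proof -
      have sub: "A \<union> B \<subset> ?U" using that by auto
      have "KL_kernel r (A \<union> B) = KL_kernel r A * KL_kernel r B"
      proof (rule less.hyps)
        show "card (A \<union> B) < card ?U" using sub fin by (rule psubset_card_mono [rotated])
        show "loopless_rank r (A \<union> B)" using less.prems(1) sub loopless_rank_subset by blast
        show "A \<inter> B = {}" using that less.prems(2) by auto
        show "\<And>A' B'. A' \<subseteq> A \<Longrightarrow> B' \<subseteq> B \<Longrightarrow> r (A' \<union> B') = r A' + r B'"
          using that less.prems(3) by (meson order_trans)
      qed
      moreover have "r A \<le> r E" "r B \<le> r F"
        using loopless_rankD(3) [OF lr(1)] loopless_rankD(3) [OF lr(2)] that by blast+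
      moreover have "r (A \<union> B) = r A + r B" using that less.prems(3) by blast
      ultimately have "monom 1 (r ?U - r (A \<union> B)) * KL_kernel r (A \<union> B) =
          monom 1 ((r E - r A) + (r F - r B)) * (KL_kernel r A * KL_kernel r B)"
        using rU by simp
      also have "\<dots> = ?T A B" by (simp add: monom_1_add mult_ac)
      finally show ?thesis .
    qed
    let ?I = "Pow E \<times> Pow F"
    have "?p E * ?p F = (\<Sum>(A, B)\<in>?I. ?T A B)"
      by (simp add: sum_product sum.cartesian_product)
    \<comment> \<open>Only for the pair \<open>(E, F)\<close> the induction hypothesis is not available.\<close>
    also have "\<dots> = ?T E F + (\<Sum>(A, B)\<in>?I - {(E, F)}. ?T A B)"
      using fin by (subst sum.remove [of _ "(E, F)"]) auto
    also have "(\<Sum>(A, B)\<in>?I - {(E, F)}. ?T A B) =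
        (\<Sum>(A, B)\<in>?I - {(E, F)}. monom 1 (r ?U - r (A \<union> B)) * KL_kernel r (A \<union> B))"
    proof (rule sum.cong [OF refl])
      fix x assume x: "x \<in> ?I - {(E, F)}"
      obtain A B where AB: "x = (A, B)" by (cases x)
      have sub: "A \<subseteq> E" "B \<subseteq> F" "A \<noteq> E \<or> B \<noteq> F" using x AB by auto
      then have "A \<union> B \<noteq> ?U" using less.prems(2) by blast
      then show "(case x of (A, B) \<Rightarrow> ?T A B) =
          (case x of (A, B) \<Rightarrow> monom 1 (r ?U - r (A \<union> B)) * KL_kernel r (A \<union> B))"
        using summand [OF sub(1,2)] AB by simp
    qed
    also have "\<dots> = ?S"
    proof -
      have "bij_betw (\<lambda>(A, B). A \<union> B) (?I - {(E, F)}) (Pow ?U - {?U})"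
        using bij_betw_DiffI [OF bij_betw_Un_Pow [OF less.prems(2)], of "{(E, F)}" "{?U}"]
        by (simp add: bij_betw_def)
      moreover have "Pow ?U - {?U} = {A. A \<subset> ?U}" by auto
      ultimately have "bij_betw (\<lambda>(A, B). A \<union> B) (?I - {(E, F)}) {A. A \<subset> ?U}" by simp
      from sum.reindex_bij_betw [OF this, of "\<lambda>A. monom 1 (r ?U - r A) * KL_kernel r A"]
      show ?thesis by (simp add: case_prod_unfold)
    qed
    finally have prod: "?p E * ?p F = ?S + KL_kernel r E * KL_kernel r F" by simp
    have small: "2 * degree (?p E * ?p F) < r ?U"
      using KL_kernel_sum_upper [OF lr(1)] KL_kernel_sum_upper [OF lr(2)] False rU
        degree_mult_le [of "?p E" "?p F"] by linarith
    have "KL_kernel r E * KL_kernel r F = cancel_upper (r ?U) ?S"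
    proof (rule cancel_upper_unique)
      show "degree ?S \<le> r ?U" by (rule degree_KL_kernel_sum [OF less.prems(1)]) auto
      show "palindromic (r ?U) (KL_kernel r E * KL_kernel r F)"
        unfolding rU by (intro palindromic_mult palindromic_KL_kernel lr)
      fix i assume "r ?U \<le> 2 * i"
      then show "coeff (?S + KL_kernel r E * KL_kernel r F) i = 0"
        unfolding prod [symmetric] using small by (intro coeff_eq_0) linarith
    qed
    then show ?thesis using False fin by (subst KL_kernel.simps) simp
  qed
qed

lemma rank_KL_union:
  assumes "loopless_rank r (E \<union> F)" "E \<inter> F = {}"
    and "\<And>A B. A \<subseteq> E \<Longrightarrow> B \<subseteq> F \<Longrightarrow> r (A \<union> B) = r A + r B"
  shows "rank_KL r (E \<union> F) = rank_KL r E * rank_KL r F"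
proof -
  let ?T = "\<lambda>A B. monom 1 (r E - r A) * KL_kernel r A * (monom 1 (r F - r B) * KL_kernel r B)"
  have rU: "r (E \<union> F) = r E + r F" using assms(3) by simp
  have "(\<Sum>D\<in>Pow (E \<union> F). monom 1 (r (E \<union> F) - r D) * KL_kernel r D) =
      (\<Sum>(A, B)\<in>Pow E \<times> Pow F. monom 1 (r (E \<union> F) - r (A \<union> B)) * KL_kernel r (A \<union> B))"
    using sum.reindex_bij_betw [OF bij_betw_Un_Pow [OF assms(2)],
        of "\<lambda>D. monom 1 (r (E \<union> F) - r D) * KL_kernel r D"]
    by (simp add: case_prod_unfold)
  also have "\<dots> = (\<Sum>(A, B)\<in>Pow E \<times> Pow F. ?T A B)"
  proof (rule sum.cong [OF refl], clarify)
    fix A B assume AB: "A \<subseteq> E" "B \<subseteq> F"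
    have "KL_kernel r (A \<union> B) = KL_kernel r A * KL_kernel r B"
    proof (rule KL_kernel_union)
      show "loopless_rank r (A \<union> B)" using assms(1) AB by (auto intro: loopless_rank_subset)
    qed (use AB assms(2,3) in \<open>auto dest: order_trans\<close>)
    moreover have "r A \<le> r E" "r B \<le> r F"
      using loopless_rankD(3) [OF assms(1), of A E] loopless_rankD(3) [OF assms(1), of B F] AB by blast+
    moreover have "r (A \<union> B) = r A + r B" using AB assms(3) by blast
    ultimately have "monom 1 (r (E \<union> F) - r (A \<union> B)) * KL_kernel r (A \<union> B) =
        monom 1 ((r E - r A) + (r F - r B)) * (KL_kernel r A * KL_kernel r B)"
      using rU by simp
    also have "\<dots> = ?T A B" by (simp add: monom_1_add mult_ac)
    finally show "monom 1 (r (E \<union> F) - r (A \<union> B)) * KL_kernel r (A \<union> B) = ?T A B" .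
  qed
  also have "\<dots> = (\<Sum>A\<in>Pow E. monom 1 (r E - r A) * KL_kernel r A) *
      (\<Sum>B\<in>Pow F. monom 1 (r F - r B) * KL_kernel r B)"
    by (simp add: sum_product sum.cartesian_product)
  finally show ?thesis by (simp add: rank_KL_def rU power_add mult_ac)
qed

lemma rank_KL_singleton:
  assumes "r {} = 0" "r {e} = 1"
  shows "rank_KL r {e} = 1"
proof -
  have "{A. A \<subset> {e}} = {{}}" by auto
  then have "KL_kernel r {e} = cancel_upper 1 (monom 1 1)"
    using assms by (simp add: KL_kernel.simps [of r "{e}"])
  also have "\<dots> = - (1 + monom 1 1)"
    by (rule poly_eqI) (auto simp: coeff_cancel_upper max_def le_Suc_eq)
  finally show ?thesis using assms by (simp add: rank_KL_def Pow_insert)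
qed

lemma sum_intervals:
  assumes "finite E"
  shows "(\<Sum>F\<in>Pow E. \<Sum>B\<in>Pow (E - F). f F B) = (\<Sum>D\<in>Pow E. \<Sum>F\<in>Pow D. f F (D - F))"
proof -
  have "(\<Sum>F\<in>Pow E. \<Sum>B\<in>Pow (E - F). f F B) = (\<Sum>(F, B)\<in>(SIGMA F:Pow E. Pow (E - F)). f F B)"
    using assms by (intro sum.Sigma) auto
  also have "\<dots> = (\<Sum>(D, F)\<in>(SIGMA D:Pow E. Pow D). f F (D - F))"
    by (rule sum.reindex_bij_witness [where i = "\<lambda>(D, F). (F, D - F)" and j = "\<lambda>(F, B). (F \<union> B, F)"])
      (auto intro!: arg_cong2 [where f = f])
  also have "\<dots> = (\<Sum>D\<in>Pow E. \<Sum>F\<in>Pow D. f F (D - F))"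
    using assms by (intro sum.Sigma [symmetric]) (auto intro: finite_subset)
  finally show ?thesis .
qed

text \<open>This is the defining identity, with the reversed characteristic polynomials of the contractions
  written as alternating sums over the sets between \<open>F\<close> and \<open>E\<close>. By Boolean Moebius inversion the
  right-hand side is the sum of the kernels of all subsets of \<open>E\<close>. The left-hand side is the sum of the
  reversed kernels, which is the same.\<close>

lemma rank_KL_identity:
  assumes lr: "loopless_rank r E"
  shows "(- tvar) ^ r E * poly_at (rank_KL r E) (inverse tvar) =
    (\<Sum>F\<in>Pow E. (- 1) ^ r F * poly_at (rank_KL r F) tvar *
      (\<Sum>B\<in>Pow (E - F). (- 1) ^ card B * tvar ^ (r (F \<union> B) - r F)))"
proof -
  define g where "g A = to_fract (KL_kernel r A) / tvar ^ r A" for A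
  define s where "s F = (\<Sum>A\<in>Pow F. g A)" for F
  have fin: "finite E" using lr by (rule loopless_rankD(1))
  have mono: "r A \<le> r B" if "A \<subseteq> B" "B \<subseteq> E" for A B
    using loopless_rankD(3) [OF lr that] .
  have Q: "(- 1) ^ r F * poly_at (rank_KL r F) tvar = tvar ^ r F * s F" if F: "F \<subseteq> E" for F
  proof -
    have "(- 1) ^ r F * poly_at (rank_KL r F) tvar =
        (\<Sum>A\<in>Pow F. tvar ^ (r F - r A) * to_fract (KL_kernel r A))"
      by (simp add: rank_KL_def poly_at_sum poly_at_tvar [of "KL_kernel r _"] neg_one_power_mult_self)
    also have "\<dots> = (\<Sum>A\<in>Pow F. tvar ^ r F * g A)"
      by (rule sum.cong) (use mono F in \<open>auto simp: g_def power_diff\<close>)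
    finally show ?thesis by (simp add: s_def sum_distrib_left)
  qed
  have "(\<Sum>F\<in>Pow E. (- 1) ^ r F * poly_at (rank_KL r F) tvar *
      (\<Sum>B\<in>Pow (E - F). (- 1) ^ card B * tvar ^ (r (F \<union> B) - r F))) =
      (\<Sum>F\<in>Pow E. \<Sum>B\<in>Pow (E - F). (- 1) ^ card B * tvar ^ r (F \<union> B) * s F)"
  proof (rule sum.cong [OF refl])
    fix F assume F: "F \<in> Pow E"
    have "tvar ^ r F * s F * ((- 1) ^ card B * tvar ^ (r (F \<union> B) - r F)) =
        (- 1) ^ card B * tvar ^ r (F \<union> B) * s F" if "B \<in> Pow (E - F)" for B
    proof -
      have "r F \<le> r (F \<union> B)" using F that by (intro mono) auto
      then have "tvar ^ r (F \<union> B) = tvar ^ r F * tvar ^ (r (F \<union> B) - r F)"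
        by (simp flip: power_add)
      then show ?thesis by (simp add: mult_ac)
    qed
    then show "(- 1) ^ r F * poly_at (rank_KL r F) tvar *
        (\<Sum>B\<in>Pow (E - F). (- 1) ^ card B * tvar ^ (r (F \<union> B) - r F)) =
        (\<Sum>B\<in>Pow (E - F). (- 1) ^ card B * tvar ^ r (F \<union> B) * s F)"
      using F unfolding Q [OF PowD [OF F]] sum_distrib_left by (intro sum.cong refl) auto
  qed
  also have "\<dots> = (\<Sum>D\<in>Pow E. \<Sum>F\<in>Pow D. (- 1) ^ card (D - F) * tvar ^ r (F \<union> (D - F)) * s F)"
    by (rule sum_intervals [OF fin])
  also have "\<dots> = (\<Sum>D\<in>Pow E. to_fract (KL_kernel r D))"
  proof (rule sum.cong [OF refl])
    fix D assume "D \<in> Pow E"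
    then have D: "finite D" using fin finite_subset by auto
    have "(\<Sum>F\<in>Pow D. (- 1) ^ card (D - F) * tvar ^ r (F \<union> (D - F)) * s F) =
        tvar ^ r D * (\<Sum>F\<in>Pow D. (- 1) ^ (card D - card F) * s F)"
      unfolding sum_distrib_left
      by (rule sum.cong) (use D in \<open>auto simp: Un_absorb1 card_Diff_subset finite_subset\<close>)
    also have "(\<Sum>F\<in>Pow D. (- 1) ^ (card D - card F) * s F) = g D"
      by (rule inclusion_exclusion_mobius [symmetric]) (simp_all add: s_def D)
    finally show "(\<Sum>F\<in>Pow D. (- 1) ^ card (D - F) * tvar ^ r (F \<union> (D - F)) * s F) =
        to_fract (KL_kernel r D)" by (simp add: g_def)
  qed
  also have "\<dots> = (\<Sum>D\<in>Pow E. tvar ^ r D * poly_at (KL_kernel r D) (inverse tvar))"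
  proof (rule sum.cong [OF refl])
    fix D assume "D \<in> Pow E"
    then have "palindromic (r D) (KL_kernel r D)"
      using palindromic_KL_kernel loopless_rank_subset [OF lr] by blast
    then show "to_fract (KL_kernel r D) = tvar ^ r D * poly_at (KL_kernel r D) (inverse tvar)"
      using palindromic_iff palindromic_degree by metis
  qed
  also have "\<dots> = (\<Sum>D\<in>Pow E. tvar ^ r E * (inverse tvar ^ (r E - r D) *
      poly_at (KL_kernel r D) (inverse tvar)))"
    by (rule sum.cong) (use mono in \<open>auto simp: power_diff power_inverse field_simps\<close>)
  also have "\<dots> = (- tvar) ^ r E * poly_at (rank_KL r E) (inverse tvar)"
    by (simp add: rank_KL_def poly_at_sum sum_distrib_left power_minus [of tvar]
        neg_one_power_mult_self mult_ac)
  finally show ?thesis ..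
qed

section \<open>The inverse Kazhdan--Lusztig polynomial and the inverse Z-polynomial of a graph\<close>

definition graph_KL :: "('v, 'e) multigraph \<Rightarrow> int poly" where
  "graph_KL G = rank_KL (graphic_rank (ends G)) (edges G)"

lemma loopless_rank_graphic:
  assumes "finite E" "\<And>e. e \<in> E \<Longrightarrow> card (\<epsilon> e) = 2"
  shows "loopless_rank (graphic_rank \<epsilon>) E"
  unfolding loopless_rank_def
proof (intro conjI allI impI)
  show "graphic_rank \<epsilon> A \<le> graphic_rank \<epsilon> B" if "A \<subseteq> B" "B \<subseteq> E" for A B
    by (rule graphic_rank_mono) (use assms that finite_subset in auto)
  show "A = {}" if "A \<subseteq> E" "graphic_rank \<epsilon> A = 0" for A
    using graphic_rank_eq_0_iff [of A \<epsilon>] assms that finite_subset by auto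
qed (use assms in simp_all)

lemma loopless_restrict:
  assumes "loopless_multigraph G"
  shows "loopless_multigraph (restrict_graph G C)"
  unfolding loopless_multigraph_def
proof (intro conjI ballI)
  have "finite (flat_of G C)"
    using flat_of_subset loopless_finite [OF assms] by (meson finite_subset)
  then show "finite (edges (restrict_graph G C))" by (simp add: restrict_graph_def)
  show "card (ends (restrict_graph G C) e) = 2" if "e \<in> edges (restrict_graph G C)" for e
    using that loopless_ends(2) [OF assms, of e] flat_of_subset [of G C]
    by (auto simp: restrict_graph_def)
  then show "finite (verts (restrict_graph G C))"
    using \<open>finite (flat_of G C)\<close> by (auto simp: restrict_graph_def intro: card_ge_0_finite)
  show "ends (restrict_graph G C) e \<subseteq> verts (restrict_graph G C)"
    if "e \<in> edges (restrict_graph G C)" for e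
    using that by (auto simp: restrict_graph_def)
qed

lemma rk_restrict:
  assumes "loopless_multigraph G"
  shows "rk (restrict_graph G C) = graphic_rank (ends G) (flat_of G C)"
  using rk_eq_graphic_rank [OF loopless_restrict [OF assms, of C]] by (simp add: restrict_graph_def)

lemma card_composition:
  assumes "loopless_multigraph G" "C \<in> compositions G"
  shows "card C = card (verts G) - graphic_rank (ends G) (flat_of G C)"
  using card_components_eq(1) [OF assms(1) flat_of_subset, of C] components_flat_of [OF assms(2)] by simp

text \<open>This connects the recursion with graphs: it is the factor \<open>t\<^bsup>|C|\<^esup> \<chi>\<^bsub>G/C\<^esub>(1/t)\<close> of the defining
  identity.\<close>

lemma poly_at_colour_poly:
  assumes G: "loopless_multigraph G" and F: "F \<subseteq> edges G"
  shows "tvar ^ (card (verts G) - graphic_rank (ends G) F) * poly_at (colour_poly G F) (inverse tvar) =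
    (\<Sum>B\<in>Pow (edges G - F). (- 1) ^ card B *
      tvar ^ (graphic_rank (ends G) (F \<union> B) - graphic_rank (ends G) F))"
  unfolding colour_poly_def poly_at_sum sum_distrib_left
proof (rule sum.cong [OF refl])
  let ?N = "card (verts G)" and ?r = "graphic_rank (ends G)"
  fix B assume B: "B \<in> Pow (edges G - F)"
  have le: "?r F \<le> ?r (F \<union> B)" "?r (F \<union> B) \<le> ?N"
    using graphic_rank_mono [of "F \<union> B" "ends G" F] card_components_eq(2) [OF G, of "F \<union> B"] F B
      loopless_finite [OF G] loopless_ends(2) [OF G] finite_subset [of "F \<union> B" "edges G"] by auto
  have "tvar ^ (?N - ?r F) = tvar ^ (?N - ?r (F \<union> B)) * tvar ^ (?r (F \<union> B) - ?r F)"
    using le by (simp flip: power_add)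
  moreover have "tvar ^ (?N - ?r (F \<union> B)) * inverse tvar ^ (?N - ?r (F \<union> B)) = 1"
    by (simp flip: power_mult_distrib)
  moreover have "a * b * i = b" if "a * i = 1" for a b i :: "int poly fract"
  proof -
    have "a * b * i = b * (a * i)" by (simp only: mult_ac)
    then show ?thesis using that by simp
  qed
  ultimately have T: "tvar ^ (?N - ?r F) * inverse tvar ^ (?N - ?r (F \<union> B)) =
      tvar ^ (?r (F \<union> B) - ?r F)"
    by (simp only:)
  have "poly_at ((- 1) ^ card B * monom 1 (?N - ?r (F \<union> B))) (inverse tvar) =
      (- 1) ^ card B * inverse tvar ^ (?N - ?r (F \<union> B))"
    by simp
  then show "tvar ^ (?N - ?r F) * poly_at ((- 1) ^ card B * monom 1 (?N - ?r (F \<union> B))) (inverse tvar) =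
      (- 1) ^ card B * tvar ^ (?r (F \<union> B) - ?r F)"
    unfolding T [symmetric] by (simp only: mult.left_commute)
qed

lemma graph_KL_restrict: "graph_KL (restrict_graph G C) = rank_KL (graphic_rank (ends G)) (flat_of G C)"
  by (simp add: graph_KL_def restrict_graph_def)

lemma graph_KL_condition:
  assumes G: "loopless_multigraph G"
  shows "inverse_KL_condition graph_KL G"
proof -
  let ?r = "graphic_rank (ends G)" and ?N = "card (verts G)"
  have lr: "loopless_rank ?r (edges G)"
    by (rule loopless_rank_graphic) (use loopless_finite [OF G] loopless_ends [OF G] in auto)
  have rk: "rk G = ?r (edges G)" by (rule rk_eq_graphic_rank [OF G])
  show ?thesis
    unfolding inverse_KL_condition_def
  proof (intro conjI impI)
    assume "rk G = 0"
    then have "edges G = {}" using loopless_rankD(4) [OF lr, of "edges G"] rk by auto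
    then show "graph_KL G = 1" by (simp add: graph_KL_def rank_KL_empty)
  next
    assume "0 < rk G"
    then have "edges G \<noteq> {}" using rk by auto
    then show "2 * degree (graph_KL G) < rk G"
      using degree_rank_KL [OF lr] by (simp add: graph_KL_def rk)
  next
    define f where "f F p = (- 1) ^ ?r F * poly_at (rank_KL ?r F) tvar *
      (tvar ^ (?N - ?r F) * poly_at p (inverse tvar))" for F p
    have "(\<Sum>C\<in>compositions G. (- 1) ^ rk (restrict_graph G C) *
        poly_at (graph_KL (restrict_graph G C)) tvar *
        (tvar ^ card C * poly_at (chromatic_poly (contract_graph G C)) (inverse tvar))) =
      (\<Sum>C\<in>compositions G. f (flat_of G C) (chromatic_poly (contract_graph G C)))"
      by (rule sum.cong)
        (simp_all only: rk_restrict [OF G] card_composition [OF G] graph_KL_restrict f_def)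
    also have "\<dots> = (\<Sum>F\<in>Pow (edges G). f F (colour_poly G F))"
      by (rule sum_compositions [OF G]) (simp add: f_def)
    also have "\<dots> = (\<Sum>F\<in>Pow (edges G). (- 1) ^ ?r F * poly_at (rank_KL ?r F) tvar *
        (\<Sum>B\<in>Pow (edges G - F). (- 1) ^ card B * tvar ^ (?r (F \<union> B) - ?r F)))"
      by (rule sum.cong [OF refl]) (simp only: f_def poly_at_colour_poly [OF G] Pow_iff)
    also have "\<dots> = (- tvar) ^ rk G * poly_at (graph_KL G) (inverse tvar)"
      unfolding rk graph_KL_def by (rule rank_KL_identity [OF lr, symmetric])
    finally show "(- tvar) ^ rk G * poly_at (graph_KL G) (inverse tvar) =
        (\<Sum>C\<in>compositions G. (- 1) ^ rk (restrict_graph G C) *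
          poly_at (graph_KL (restrict_graph G C)) tvar *
          (tvar ^ card C * poly_at (chromatic_poly (contract_graph G C)) (inverse tvar)))" ..
  qed
qed

lemma poly_at_inverse_tvar_eq_0:
  assumes "poly_at p (inverse tvar) = 0"
  shows "p = 0"
proof (rule poly_eqI)
  fix i
  have "to_fract (flip (degree p) p) = 0" using to_fract_flip [of p "degree p"] assms by simp
  then have "flip (degree p) p = 0" by simp
  then have "coeff (flip (degree p) p) (degree p - i) = 0" by simp
  then show "coeff p i = coeff 0 i"
    by (cases "i \<le> degree p") (simp_all add: coeff_flip coeff_eq_0)
qed

text \<open>Two solutions for \<open>G\<close> that agree on all proper restrictions differ by a palindromic polynomial
  whose degree is less than half of the rank, hence by zero. Isolated vertices need a separate
  step: \<open>G[C]\<close> never has any, so \<open>G\<close> itself is one of the \<open>G[C]\<close> only if it has none.\<close>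

lemma inverse_KL_family_unique_no_isolated:
  assumes fam: "inverse_KL_family \<G> Q"
  shows "G \<in> \<G> \<Longrightarrow> verts G = (\<Union>e\<in>edges G. ends G e) \<Longrightarrow> Q G = graph_KL G"
proof (induction "card (edges G)" arbitrary: G rule: less_induct)
  case less
  have G: "loopless_multigraph G" and cond: "inverse_KL_condition Q G"
    and closed: "\<And>C. C \<in> compositions G \<Longrightarrow> restrict_graph G C \<in> \<G>"
    using fam less.prems(1) by (auto simp: inverse_KL_family_def)
  note cond' = graph_KL_condition [OF G]
  show ?case
  proof (cases "rk G = 0")
    case True
    then show ?thesis using cond cond' by (simp add: inverse_KL_condition_def)
  next
    case False
    \<comment> \<open>The composition into components contributes \<open>Q\<^bsub>G\<^esub>\<close> itself; all others have smaller flats.\<close>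
    let ?T = "components (verts G) (ends G) (edges G)"
    have T: "?T \<in> compositions G" by (rule components_in_compositions [OF subset_refl G])
    have flatT: "flat_of G ?T = edges G"
      unfolding flat_of_components [OF G] using linked_edge [of _ "edges G" "ends G"] by blast
    have restrT: "restrict_graph G ?T = G"
      unfolding restrict_graph_def flatT less.prems(2) [symmetric] by simp
    have finC: "finite (compositions G)"
    proof (rule finite_imageD [OF _ inj_on_flat_of])
      have "flat_of G ` compositions G \<subseteq> Pow (edges G)"
        by (rule image_subsetI) (simp add: flat_of_subset)
      then show "finite (flat_of G ` compositions G)"
        using loopless_finite [OF G] by (simp add: finite_subset)
    qed
    let ?x = "\<lambda>C. tvar ^ card C * poly_at (chromatic_poly (contract_graph G C)) (inverse tvar)"
    have xT: "?x ?T = 1"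
      using poly_at_colour_poly [OF G subset_refl]
      by (simp add: card_composition [OF G T] flatT chromatic_poly_contract [OF G T])
    have rec: "(- tvar) ^ rk G * poly_at (q G) (inverse tvar) =
        (- 1) ^ rk G * poly_at (q G) tvar +
        (\<Sum>C\<in>compositions G - {?T}. (- 1) ^ rk (restrict_graph G C) *
          poly_at (q (restrict_graph G C)) tvar * ?x C)"
      if "inverse_KL_condition q G" for q
    proof -
      have "(- tvar) ^ rk G * poly_at (q G) (inverse tvar) =
          (\<Sum>C\<in>compositions G. (- 1) ^ rk (restrict_graph G C) *
            poly_at (q (restrict_graph G C)) tvar * ?x C)"
        using that False by (simp add: inverse_KL_condition_def)
      then show ?thesis
        unfolding sum.remove [OF finC T] restrT xT by simp
    qed
    have IH: "Q (restrict_graph G C) = graph_KL (restrict_graph G C)"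
      if C: "C \<in> compositions G - {?T}" for C
    proof (rule less.hyps)
      have "flat_of G C \<noteq> edges G"
        using C T flatT inj_onD [OF inj_on_flat_of, of G C ?T] by auto
      then have "flat_of G C \<subset> edges G" using flat_of_subset [of G C] by blast
      then show "card (edges (restrict_graph G C)) < card (edges G)"
        using psubset_card_mono [of "edges G" "flat_of G C"] loopless_finite [OF G]
        by (simp add: restrict_graph_def)
      show "restrict_graph G C \<in> \<G>" using closed C by blast
      show "verts (restrict_graph G C) =
          (\<Union>e\<in>edges (restrict_graph G C). ends (restrict_graph G C) e)"
        by (simp add: restrict_graph_def)
    qed
    let ?D = "Q G - graph_KL G"
    have at_diff: "poly_at ?D x = poly_at (Q G) x - poly_at (graph_KL G) x" for x
      using poly_at_add [of "Q G" "- graph_KL G" x] by simp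
    have "(\<Sum>C\<in>compositions G - {?T}. (- 1) ^ rk (restrict_graph G C) *
          poly_at (Q (restrict_graph G C)) tvar * ?x C) =
        (\<Sum>C\<in>compositions G - {?T}. (- 1) ^ rk (restrict_graph G C) *
          poly_at (graph_KL (restrict_graph G C)) tvar * ?x C)"
      by (rule sum.cong [OF refl]) (simp only: IH)
    with rec [OF cond] rec [OF cond'] have
      "(- tvar) ^ rk G * poly_at ?D (inverse tvar) = (- 1) ^ rk G * poly_at ?D tvar"
      unfolding at_diff right_diff_distrib by simp
    then have "(- 1) ^ rk G * (tvar ^ rk G * poly_at ?D (inverse tvar)) = (- 1) ^ rk G * to_fract ?D"
      unfolding power_minus [of tvar] poly_at_tvar by (simp only: mult.assoc)
    then have "tvar ^ rk G * poly_at ?D (inverse tvar) = to_fract ?D"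
      by (metis neg_one_power_mult_self)
    moreover have deg: "2 * degree (Q G) < rk G" "2 * degree (graph_KL G) < rk G"
      using cond cond' False by (simp_all add: inverse_KL_condition_def)
    then have degD: "2 * degree ?D < rk G"
      using degree_diff_le_max [of "Q G" "graph_KL G"] by linarith
    ultimately have "palindromic (rk G) ?D"
      using palindromic_iff [of ?D "rk G"] by simp
    then have "?D = 0"
      by (rule palindromic_low_degree) (rule coeff_eq_0, use degD in linarith)
    then show ?thesis by simp
  qed
qed

lemma inverse_KL_family_unique:
  assumes fam: "inverse_KL_family \<G> Q" and mem: "G \<in> \<G>"
  shows "Q G = graph_KL G"
proof -
  have G: "loopless_multigraph G" and cond: "inverse_KL_condition Q G"
    and closed: "\<And>C. C \<in> compositions G \<Longrightarrow> restrict_graph G C \<in> \<G>"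
    using fam mem by (auto simp: inverse_KL_family_def)
  note cond' = graph_KL_condition [OF G]
  have "Q (restrict_graph G C) = graph_KL (restrict_graph G C)" if "C \<in> compositions G" for C
    by (rule inverse_KL_family_unique_no_isolated [OF fam closed [OF that]])
      (simp add: restrict_graph_def)
  then have same: "(\<Sum>C\<in>compositions G. (- 1) ^ rk (restrict_graph G C) *
        poly_at (Q (restrict_graph G C)) tvar *
        (tvar ^ card C * poly_at (chromatic_poly (contract_graph G C)) (inverse tvar))) =
      (\<Sum>C\<in>compositions G. (- 1) ^ rk (restrict_graph G C) *
        poly_at (graph_KL (restrict_graph G C)) tvar *
        (tvar ^ card C * poly_at (chromatic_poly (contract_graph G C)) (inverse tvar)))"
    by (intro sum.cong refl) simp
  show ?thesis
  proof (cases "rk G = 0")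
    case True
    then show ?thesis using cond cond' by (simp add: inverse_KL_condition_def)
  next
    case False
    then have "(- tvar) ^ rk G * poly_at (Q G) (inverse tvar) =
        (- tvar) ^ rk G * poly_at (graph_KL G) (inverse tvar)"
      using cond cond' same by (simp add: inverse_KL_condition_def)
    then have "poly_at (Q G) (inverse tvar) = poly_at (graph_KL G) (inverse tvar)" by simp
    then have "poly_at (Q G - graph_KL G) (inverse tvar) = 0"
      using poly_at_add [of "Q G" "- graph_KL G" "inverse tvar"] by simp
    then show ?thesis using poly_at_inverse_tvar_eq_0 [of "Q G - graph_KL G"] by simp
  qed
qed

lemma inverse_KL_eq:
  assumes "loopless_multigraph G"
  shows "inverse_KL G = graph_KL G"
  unfolding inverse_KL_def
proof (rule the_equality)
  have "inverse_KL_family {G. loopless_multigraph G} (graph_KL :: ('a, 'b) multigraph \<Rightarrow> _)"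
    by (auto simp: inverse_KL_family_def graph_KL_condition loopless_restrict)
  then show "\<exists>\<G> Q. G \<in> \<G> \<and> inverse_KL_family \<G> Q \<and> graph_KL G = Q G"
    using assms by blast
next
  fix q assume "\<exists>\<G> Q. G \<in> \<G> \<and> inverse_KL_family \<G> Q \<and> q = Q G"
  then show "q = graph_KL G" using inverse_KL_family_unique by blast
qed

text \<open>A graph and its contractions have the same number of components, so all the Moebius invariants
  are coefficients at the same exponent.\<close>

lemma inverse_Z_eq:
  assumes G: "loopless_multigraph G"
  shows "inverse_Z G = (- 1) ^ rk G * (\<Sum>F\<in>Pow (edges G).
    (- 1) ^ graphic_rank (ends G) F * rank_KL (graphic_rank (ends G)) F *
    monom (coeff (colour_poly G F) (num_components G)) (rk G - graphic_rank (ends G) F))"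
proof -
  let ?r = "graphic_rank (ends G)"
  define f where "f F p = (- 1) ^ ?r F * rank_KL ?r F *
    monom (coeff p (num_components G)) (rk G - ?r F)" for F p
  have "inverse_Z G = (- 1) ^ rk G *
      (\<Sum>C\<in>compositions G. f (flat_of G C) (chromatic_poly (contract_graph G C)))"
    unfolding inverse_Z_def
  proof (intro arg_cong2 [where f = times] refl sum.cong)
    fix C assume C: "C \<in> compositions G"
    note H = loopless_contract [OF G compositions_partition [OF C]]
    have "rk (contract_graph G C) = card C - num_components G"
      by (simp add: rk_def num_components_contract [OF G C]) (simp add: contract_graph_def)
    also have "\<dots> = rk G - ?r (flat_of G C)"
      unfolding card_composition [OF G C] rk_def by simp
    finally have "rk (contract_graph G C) = rk G - ?r (flat_of G C)" .
    moreover have "moebius_invariant (contract_graph G C) =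
        coeff (chromatic_poly (contract_graph G C)) (num_components G)"
      using moebius_invariant_eq_coeff [OF H] num_components_contract [OF G C] by simp
    ultimately show "(- 1) ^ rk (restrict_graph G C) * inverse_KL (restrict_graph G C) *
        monom (moebius_invariant (contract_graph G C)) (rk (contract_graph G C)) =
        f (flat_of G C) (chromatic_poly (contract_graph G C))"
      by (simp add: f_def rk_restrict [OF G] inverse_KL_eq [OF loopless_restrict [OF G]]
          graph_KL_restrict)
  qed
  also have "(\<Sum>C\<in>compositions G. f (flat_of G C) (chromatic_poly (contract_graph G C))) =
      (\<Sum>F\<in>Pow (edges G). f F (colour_poly G F))"
    by (rule sum_compositions [OF G]) (simp add: f_def)
  finally show ?thesis by (simp only: f_def)
qed

section \<open>Colourings of fans as words\<close>

text \<open>A colouring of \<open>fan n\<close> in which the hub \<open>0\<close> has colour \<open>0\<close> is a word of length \<open>n\<close>. The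
  monochromatic edges of a word are the spokes at its letters \<open>0\<close> and the links between equal
  neighbouring letters.\<close>

definition mono_spokes :: "nat list \<Rightarrow> nat set" where
  "mono_spokes w = {i. i < length w \<and> w ! i = 0}"

definition mono_links :: "nat list \<Rightarrow> nat set" where
  "mono_links w = {i. Suc i < length w \<and> w ! i = w ! Suc i}"

definition mono_edges :: "nat list \<Rightarrow> nat set set" where
  "mono_edges w = (\<lambda>i. {0, Suc i}) ` mono_spokes w \<union> (\<lambda>i. {Suc i, Suc (Suc i)}) ` mono_links w"

text \<open>The rim moves by \<open>l\<close> and the hub stays.\<close>

definition shift :: "nat \<Rightarrow> nat \<Rightarrow> nat" where
  "shift l i = (if i = 0 then 0 else i + l)"

lemma inj_shift: "inj (shift l)"
  by (auto simp: inj_def shift_def split: if_splits)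

lemma mono_spokes_run:
  "mono_spokes (replicate l a @ w) = mono_spokes (replicate l a) \<union> (+) l ` mono_spokes w"
proof (intro equalityI subsetI)
  fix i assume i: "i \<in> mono_spokes (replicate l a @ w)"
  show "i \<in> mono_spokes (replicate l a) \<union> (+) l ` mono_spokes w"
  proof (cases "i < l")
    case False
    then have "i - l \<in> mono_spokes w" "i = l + (i - l)"
      using i by (auto simp: mono_spokes_def nth_append)
    then show ?thesis by blast
  qed (use i in \<open>auto simp: mono_spokes_def nth_append\<close>)
qed (auto simp: mono_spokes_def nth_append)

lemma mono_links_run:
  assumes "w = [] \<or> hd w \<noteq> a"
  shows "mono_links (replicate l a @ w) = mono_links (replicate l a) \<union> (+) l ` mono_links w"
proof (intro equalityI subsetI)
  fix i assume i: "i \<in> mono_links (replicate l a @ w)"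
  consider "Suc i < l" | "Suc i = l" | "l \<le> i" by linarith
  then show "i \<in> mono_links (replicate l a) \<union> (+) l ` mono_links w"
  proof cases
    case 1
    then show ?thesis using i by (auto simp: mono_links_def nth_append)
  next
    case 2
    then have "w \<noteq> []" "w ! 0 = a"
      using i by (auto simp: mono_links_def nth_append)
    then show ?thesis using assms by (simp add: hd_conv_nth)
  next
    case 3
    then have "i - l \<in> mono_links w" "i = l + (i - l)"
      using i by (auto simp: mono_links_def nth_append Suc_diff_le)
    then show ?thesis by blast
  qed
qed (auto simp: mono_links_def nth_append)

text \<open>The first maximal run of a word and the rest of it only interact at the hub.\<close>

lemma mono_edges_run:
  assumes "w = [] \<or> hd w \<noteq> a"
  shows "mono_edges (replicate l a @ w) = mono_edges (replicate l a) \<union> (`) (shift l) ` mono_edges w"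
proof -
  have "(\<lambda>i. {0, Suc i}) ` (+) l ` S = (`) (shift l) ` (\<lambda>i. {0, Suc i}) ` S" for S
    unfolding image_image by (rule image_cong) (auto simp: shift_def)
  moreover have "(\<lambda>i. {Suc i, Suc (Suc i)}) ` (+) l ` S =
      (`) (shift l) ` (\<lambda>i. {Suc i, Suc (Suc i)}) ` S" for S
    unfolding image_image by (rule image_cong) (auto simp: shift_def)
  ultimately show ?thesis
    by (simp only: mono_edges_def mono_spokes_run mono_links_run [OF assms] image_Un Un_ac)
qed

lemma mono_edges_verts: "\<Union> (mono_edges w) \<subseteq> {0..length w}"
  by (auto simp: mono_edges_def mono_spokes_def mono_links_def)

lemma finite_mono_edges: "finite (mono_edges w)"
proof -
  have "mono_edges w \<subseteq> Pow {0..length w}" using mono_edges_verts by blast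
  then show ?thesis by (rule finite_subset) simp
qed

lemma card_mono_edges: "e \<in> mono_edges w \<Longrightarrow> card e = 2"
  by (auto simp: mono_edges_def)

lemma mono_edges_Nil: "mono_edges [] = {}"
  by (simp add: mono_edges_def mono_spokes_def mono_links_def)

lemma ends_fan [simp]: "ends (fan n) = (\<lambda>e. e)"
  by (simp add: fan_def)

lemma verts_fan: "verts (fan n) = {0..n}"
  by (simp add: fan_def)

lemma edges_fan_cases:
  "e \<in> edges (fan n) \<longleftrightarrow> (\<exists>i<n. e = {0, Suc i}) \<or> (\<exists>i. Suc i < n \<and> e = {Suc i, Suc (Suc i)})"
proof
  assume "e \<in> edges (fan n)"
  then consider i where "e = {0, i}" "1 \<le> i" "i \<le> n" | i where "e = {i, i + 1}" "1 \<le> i" "i < n"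
    unfolding fan_def by auto
  then show "(\<exists>i<n. e = {0, Suc i}) \<or> (\<exists>i. Suc i < n \<and> e = {Suc i, Suc (Suc i)})"
  proof cases
    case 1
    then have "i - 1 < n \<and> e = {0, Suc (i - 1)}" by simp
    then show ?thesis by blast
  next
    case 2
    then have "Suc (i - 1) < n \<and> e = {Suc (i - 1), Suc (Suc (i - 1))}" by simp
    then show ?thesis by blast
  qed
next
  assume "(\<exists>i<n. e = {0, Suc i}) \<or> (\<exists>i. Suc i < n \<and> e = {Suc i, Suc (Suc i)})"
  then show "e \<in> edges (fan n)"
  proof
    assume "\<exists>i<n. e = {0, Suc i}"
    then obtain i where "i < n" "e = {0, Suc i}" by blast
    then show ?thesis unfolding fan_def by auto
  next
    assume "\<exists>i. Suc i < n \<and> e = {Suc i, Suc (Suc i)}"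
    then obtain i where "Suc i < n" "e = {Suc i, Suc i + 1}" by auto
    then have "e \<in> {{i, i + 1} |i. 1 \<le> i \<and> i < n}" by (intro CollectI exI [of _ "Suc i"]) simp
    then show ?thesis unfolding fan_def by simp
  qed
qed

lemma edges_fan: "edges (fan n) = mono_edges (replicate n 0)"
  by (auto simp: edges_fan_cases mono_edges_def mono_spokes_def mono_links_def)

lemma loopless_fan: "loopless_multigraph (fan n)"
  unfolding loopless_multigraph_def
proof (intro conjI ballI)
  show "finite (verts (fan n))" by (simp add: verts_fan)
  show "finite (edges (fan n))" by (simp add: edges_fan finite_mono_edges)
  show "ends (fan n) e \<subseteq> verts (fan n)" if "e \<in> edges (fan n)" for e
    using that mono_edges_verts [of "replicate n 0"] by (auto simp: edges_fan verts_fan)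
  show "card (ends (fan n) e) = 2" if "e \<in> edges (fan n)" for e
    using that card_mono_edges by (simp add: edges_fan)
qed

lemma num_components_fan: "num_components (fan n) = 1"
proof -
  let ?L = "linked (\<lambda>e. e) (edges (fan n))"
  have "(0, i) \<in> ?L" if "i \<le> n" for i
  proof (cases i)
    case (Suc j)
    then have "j < n" using that by simp
    then have "{0, i} \<in> edges (fan n)" unfolding edges_fan_cases Suc by blast
    then show ?thesis by (rule linked_edge) simp
  qed simp
  then have "(i, j) \<in> ?L" if "i \<le> n" "j \<le> n" for i j
    using that linked_sym linked_trans by metis
  then have "{w \<in> {0..n}. (v, w) \<in> ?L} = {0..n}" if "v \<in> {0..n}" for v
    using that by auto
  then have "components {0..n} (\<lambda>e. e) (edges (fan n)) = {{0..n}}"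
    unfolding components_eq_image by auto
  then show ?thesis by (simp add: num_components_eq verts_fan)
qed

abbreviation set_rank :: "nat set set \<Rightarrow> nat" where
  "set_rank \<equiv> graphic_rank (\<lambda>e. e)"

lemma rk_fan: "rk (fan n) = n"
  by (simp add: rk_def num_components_fan verts_fan)

lemma set_rank_fan: "set_rank (edges (fan n)) = n"
  using rk_eq_graphic_rank [OF loopless_fan, of n] by (simp add: rk_fan)

lemma loopless_rank_fan: "loopless_rank set_rank (edges (fan n))"
  by (rule loopless_rank_graphic)
    (use loopless_finite [OF loopless_fan] loopless_ends [OF loopless_fan] in auto)

text \<open>A colouring is encoded by the colour \<open>a\<close> of the hub and the word of the colours of the rim after
  exchanging \<open>0\<close> and \<open>a\<close>. Permuting colours keeps the monochromatic edges, so all \<open>a\<close> contribute the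
  same.\<close>

definition word_colour :: "nat list \<Rightarrow> nat \<Rightarrow> nat" where
  "word_colour w i = (if i = 0 then 0 else w ! (i - 1))"

definition fan_colouring :: "nat \<times> nat list \<Rightarrow> nat \<Rightarrow> nat" where
  "fan_colouring = (\<lambda>(a, w). \<lambda>i\<in>{0..length w}. transpose 0 a (word_colour w i))"

definition words :: "nat \<Rightarrow> nat \<Rightarrow> nat list set" where
  "words k n = {w. length w = n \<and> set w \<subseteq> {..<k}}"

lemma finite_words: "finite (words k n)"
  using finite_lists_length_eq [of "{..<k}" n] by (simp add: words_def conj_commute)

lemma transpose_less: "a < k \<Longrightarrow> b < k \<Longrightarrow> c < k \<Longrightarrow> transpose a b c < (k :: nat)"
  by (auto simp: transpose_def)

lemma bij_betw_fan_colouring: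
  "bij_betw fan_colouring ({..<k} \<times> words k n) ({0..n} \<rightarrow>\<^sub>E {..<k})"
proof (rule bij_betw_byWitness
    [where f' = "\<lambda>c. (c 0, map (\<lambda>i. transpose 0 (c 0) (c (Suc i))) [0..<n])"])
  show "\<forall>x\<in>{..<k} \<times> words k n. (\<lambda>c. (c 0, map (\<lambda>i. transpose 0 (c 0) (c (Suc i))) [0..<n]))
      (fan_colouring x) = x"
    by (auto simp: fan_colouring_def word_colour_def words_def intro!: nth_equalityI)
  show "\<forall>c\<in>{0..n} \<rightarrow>\<^sub>E {..<k}. fan_colouring (c 0, map (\<lambda>i. transpose 0 (c 0) (c (Suc i))) [0..<n]) = c"
  proof
    fix c assume c: "c \<in> {0..n} \<rightarrow>\<^sub>E {..<k}"
    show "fan_colouring (c 0, map (\<lambda>i. transpose 0 (c 0) (c (Suc i))) [0..<n]) = c"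
    proof
      fix i
      show "fan_colouring (c 0, map (\<lambda>i. transpose 0 (c 0) (c (Suc i))) [0..<n]) i = c i"
        using PiE_arb [OF c, of i]
        by (cases "i \<le> n"; cases i) (simp_all add: fan_colouring_def word_colour_def)
    qed
  qed
  show "fan_colouring ` ({..<k} \<times> words k n) \<subseteq> {0..n} \<rightarrow>\<^sub>E {..<k}"
  proof (rule image_subsetI)
    fix x assume "x \<in> {..<k} \<times> words k n"
    then obtain a w where x: "x = (a, w)" "a < k" "length w = n" "set w \<subseteq> {..<k}"
      by (auto simp: words_def)
    have "transpose 0 a (word_colour w i) < k" if "i \<le> n" for i
    proof (rule transpose_less)
      have "w ! (i - 1) \<in> set w" if "i \<noteq> 0"
        using that \<open>i \<le> n\<close> x(3) by (intro nth_mem) simp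
      then show "word_colour w i < k"
        using x(2,4) by (auto simp: word_colour_def)
    qed (use x in auto)
    then show "fan_colouring x \<in> {0..n} \<rightarrow>\<^sub>E {..<k}"
      using x(3) by (simp add: x(1) fan_colouring_def)
  qed
  show "(\<lambda>c. (c 0, map (\<lambda>i. transpose 0 (c 0) (c (Suc i))) [0..<n])) ` ({0..n} \<rightarrow>\<^sub>E {..<k})
      \<subseteq> {..<k} \<times> words k n"
  proof (rule image_subsetI)
    fix c assume c: "c \<in> {0..n} \<rightarrow>\<^sub>E {..<k}"
    have ck: "c i < k" if "i \<le> n" for i using PiE_mem [OF c, of i] that by simp
    have "transpose 0 (c 0) (c (Suc i)) < k" if "i < n" for i
      by (rule transpose_less) (use ck [of 0] ck [of "Suc i"] that in auto)
    then show "(c 0, map (\<lambda>i. transpose 0 (c 0) (c (Suc i))) [0..<n]) \<in> {..<k} \<times> words k n"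
      using ck [of 0] by (auto simp: words_def)
  qed
qed

lemma monochromatic_fan_colouring:
  assumes "length w = n"
  shows "monochromatic (\<lambda>e. e) (edges (fan n)) (fan_colouring (a, w)) = mono_edges w"
proof -
  have pair: "\<not> inj_on (fan_colouring (a, w)) {i, j} \<longleftrightarrow> word_colour w i = word_colour w j"
    if "i \<noteq> j" "i \<le> n" "j \<le> n" for i j
    using that assms not_inj_on_pair [OF that(1), of "fan_colouring (a, w)"]
      injD [OF inj_transpose, of 0 a "word_colour w i" "word_colour w j"]
    by (auto simp: fan_colouring_def)
  show ?thesis
  proof (intro equalityI subsetI)
    fix e assume "e \<in> monochromatic (\<lambda>e. e) (edges (fan n)) (fan_colouring (a, w))"
    then have e: "e \<in> edges (fan n)" and inj: "\<not> inj_on (fan_colouring (a, w)) e"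
      by (auto simp: monochromatic_def)
    from e show "e \<in> mono_edges w"
      unfolding edges_fan_cases
    proof (elim disjE exE conjE)
      fix i assume i: "i < n" "e = {0, Suc i}"
      then have "i \<in> mono_spokes w"
        using inj pair [of 0 "Suc i"] assms by (simp add: mono_spokes_def word_colour_def)
      then show ?thesis using i by (auto simp: mono_edges_def)
    next
      fix i assume i: "Suc i < n" "e = {Suc i, Suc (Suc i)}"
      then have "i \<in> mono_links w"
        using inj pair [of "Suc i" "Suc (Suc i)"] assms by (simp add: mono_links_def word_colour_def)
      then show ?thesis using i by (auto simp: mono_edges_def)
    qed
  next
    fix e assume "e \<in> mono_edges w"
    then consider i where "i \<in> mono_spokes w" "e = {0, Suc i}"
      | i where "i \<in> mono_links w" "e = {Suc i, Suc (Suc i)}"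
      by (auto simp: mono_edges_def)
    then show "e \<in> monochromatic (\<lambda>e. e) (edges (fan n)) (fan_colouring (a, w))"
    proof cases
      case 1
      then show ?thesis using pair [of 0 "Suc i"] assms
        by (simp add: monochromatic_def edges_fan_cases mono_spokes_def word_colour_def) blast
    next
      case 2
      then show ?thesis using pair [of "Suc i" "Suc (Suc i)"] assms
        by (simp add: monochromatic_def edges_fan_cases mono_links_def word_colour_def) blast
    qed
  qed
qed

lemma sum_fan_colourings:
  "(\<Sum>c\<in>{0..n} \<rightarrow>\<^sub>E {..<k}. f (monochromatic (\<lambda>e. e) (edges (fan n)) c)) =
    of_nat k * (\<Sum>w\<in>words k n. f (mono_edges w) :: 'a :: comm_ring_1)"
proof -
  have "(\<Sum>c\<in>{0..n} \<rightarrow>\<^sub>E {..<k}. f (monochromatic (\<lambda>e. e) (edges (fan n)) c)) =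
      (\<Sum>x\<in>{..<k} \<times> words k n. f (monochromatic (\<lambda>e. e) (edges (fan n)) (fan_colouring x)))"
    by (rule sum.reindex_bij_betw [OF bij_betw_fan_colouring, symmetric])
  also have "\<dots> = (\<Sum>(a, w)\<in>{..<k} \<times> words k n. f (mono_edges w))"
    by (rule sum.cong) (auto simp: monochromatic_fan_colouring words_def)
  also have "\<dots> = (\<Sum>a<k. \<Sum>w\<in>words k n. f (mono_edges w))"
    by (rule sum.cartesian_product [symmetric])
  finally show ?thesis by simp
qed

section \<open>Sums over words by maximal runs\<close>

text \<open>Let the weight of a word be the product of the weights of its maximal runs, where a run of the
  letter \<open>a\<close> has the generating function \<open>A a\<close>. Splitting off the first run expresses the words that
  begin with \<open>a\<close> through all words, and the generating function of all words is the reciprocal of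
  \<open>1 - (\<Sum>a. A a / (1 + A a))\<close>.\<close>

lemma sum_words_by_run:
  fixes \<omega> :: "nat list \<Rightarrow> 'a :: comm_ring_1"
  assumes run: "\<And>l w. 0 < l \<Longrightarrow> w = [] \<or> hd w \<noteq> a \<Longrightarrow> \<omega> (replicate l a @ w) = c l * \<omega> w"
    and a: "a < k" and n: "0 < n"
  shows "(\<Sum>w | w \<in> words k n \<and> hd w = a. \<omega> w) =
    (\<Sum>l=1..n. c l * (\<Sum>w | w \<in> words k (n - l) \<and> (w = [] \<or> hd w \<noteq> a). \<omega> w))"
proof -
  let ?R = "\<lambda>l. {w. w \<in> words k (n - l) \<and> (w = [] \<or> hd w \<noteq> a)}"
  have finR: "finite (?R l)" for l using finite_words by (rule finite_subset [rotated]) auto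
  have "(\<Sum>l=1..n. c l * (\<Sum>w\<in>?R l. \<omega> w)) = (\<Sum>(l, w)\<in>(SIGMA l:{1..n}. ?R l). c l * \<omega> w)"
    by (simp add: sum_distrib_left sum.Sigma finR)
  also have "\<dots> = (\<Sum>w | w \<in> words k n \<and> hd w = a. \<omega> w)"
  proof (rule sum.reindex_bij_witness
      [where i = "\<lambda>w. (length (takeWhile (\<lambda>x. x = a) w), dropWhile (\<lambda>x. x = a) w)"
        and j = "\<lambda>(l, w). replicate l a @ w"])
    fix x assume "x \<in> (SIGMA l:{1..n}. ?R l)"
    then obtain l w where x: "x = (l, w)" "1 \<le> l" "l \<le> n" "w \<in> words k (n - l)" "w = [] \<or> hd w \<noteq> a"
      by auto
    have tw: "takeWhile (\<lambda>x. x = a) w = []" "dropWhile (\<lambda>x. x = a) w = w"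
      using x(5) by (cases w; simp)+
    have "takeWhile (\<lambda>x. x = a) (replicate l a @ w) = replicate l a"
        "dropWhile (\<lambda>x. x = a) (replicate l a @ w) = w"
      using takeWhile_append2 [of "replicate l a" "\<lambda>x. x = a" w]
        dropWhile_append2 [of "replicate l a" "\<lambda>x. x = a" w] tw by simp_all
    then show "(length (takeWhile (\<lambda>x. x = a) (case x of (l, w) \<Rightarrow> replicate l a @ w)),
        dropWhile (\<lambda>x. x = a) (case x of (l, w) \<Rightarrow> replicate l a @ w)) = x"
      by (simp add: x(1))
    have "hd (replicate l a @ w) = a" using x(2) by (cases l) auto
    then show "(case x of (l, w) \<Rightarrow> replicate l a @ w) \<in> {w. w \<in> words k n \<and> hd w = a}"
      using x a by (auto simp: words_def set_replicate_conv_if)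
    show "\<omega> (case x of (l, w) \<Rightarrow> replicate l a @ w) = (case x of (l, w) \<Rightarrow> c l * \<omega> w)"
      using run [of l w] x by simp
  next
    fix w assume w: "w \<in> {w. w \<in> words k n \<and> hd w = a}"
    let ?t = "takeWhile (\<lambda>x. x = a) w" and ?d = "dropWhile (\<lambda>x. x = a) w"
    have t: "?t = replicate (length ?t) a"
      by (rule replicate_eqI) (auto dest: set_takeWhileD)
    show eq: "(case (length ?t, ?d) of (l, w) \<Rightarrow> replicate l a @ w) = w"
      using t takeWhile_dropWhile_id [of "\<lambda>x. x = a" w] by simp
    have "w \<noteq> []" "hd w = a" using w n by (auto simp: words_def)
    then have "?t \<noteq> []" by (cases w) auto
    then have l: "1 \<le> length ?t" by (cases ?t) auto
    have len: "length ?t + length ?d = n"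
    proof -
      have "length ?t + length ?d = length (?t @ ?d)" by (simp only: length_append)
      also have "\<dots> = n" using w by (simp add: words_def)
      finally show ?thesis .
    qed
    have "set ?d \<subseteq> {..<k}" using w set_dropWhileD [of _ "\<lambda>x. x = a" w] by (auto simp: words_def)
    moreover have "?d = [] \<or> hd ?d \<noteq> a" using hd_dropWhile [of "\<lambda>x. x = a" w] by auto
    ultimately show "(length ?t, ?d) \<in> (SIGMA l:{1..n}. ?R l)"
      using l len by (auto simp: words_def)
  qed
  finally show ?thesis ..
qed

lemma words_generating_function:
  fixes \<omega> :: "nat list \<Rightarrow> 'a :: field" and A :: "nat \<Rightarrow> 'a fps"
  assumes nil: "\<omega> [] = 1"
    and run: "\<And>a l w. 0 < l \<Longrightarrow> w = [] \<or> hd w \<noteq> a \<Longrightarrow> \<omega> (replicate l a @ w) = A a $ l * \<omega> w"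
    and A0: "\<And>a. A a $ 0 = 0"
  shows "Abs_fps (\<lambda>n. \<Sum>w\<in>words k n. \<omega> w) * (1 - (\<Sum>a<k. A a * inverse (1 + A a))) = 1"
proof -
  let ?W = "Abs_fps (\<lambda>n. \<Sum>w\<in>words k n. \<omega> w)"
  define T where "T a = Abs_fps (\<lambda>n. if n = 0 then 0 else \<Sum>w | w \<in> words k n \<and> hd w = a. \<omega> w)" for a
  have w0: "words k 0 = {[]}" by (auto simp: words_def)
  have fin: "finite {w \<in> words k n. P w}" for n P using finite_words by simp
  have T: "T a = A a * (?W - T a)" if a: "a < k" for a
  proof (rule fps_ext)
    fix n
    show "T a $ n = (A a * (?W - T a)) $ n"
    proof (cases "n = 0")
      case True
      then show ?thesis by (simp add: T_def A0)
    next
      case False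
      have rest: "(\<Sum>w | w \<in> words k m \<and> (w = [] \<or> hd w \<noteq> a). \<omega> w) = (?W - T a) $ m" for m
      proof (cases "m = 0")
        case True
        then have "{w. w \<in> words k m \<and> (w = [] \<or> hd w \<noteq> a)} = {[]}" using w0 by auto
        then show ?thesis using True by (simp add: T_def w0)
      next
        case False
        then have "[] \<notin> words k m" by (auto simp: words_def)
        then have "{w. w \<in> words k m \<and> (w = [] \<or> hd w \<noteq> a)} = words k m - {w \<in> words k m. hd w = a}"
          by auto
        then show ?thesis
          using False finite_words [of k m] by (simp add: T_def sum_diff)
      qed
      have "T a $ n = (\<Sum>l=1..n. A a $ l * (?W - T a) $ (n - l))"
        using sum_words_by_run [of a \<omega> "\<lambda>l. A a $ l" k n, OF run a] False
        by (simp add: T_def [of a] rest del: fps_sub_nth)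
      also have "\<dots> = (\<Sum>l=0..n. A a $ l * (?W - T a) $ (n - l))"
        by (rule sum.mono_neutral_left) (auto simp: A0 not_le)
      finally show ?thesis by (simp only: fps_mult_nth)
    qed
  qed
  have W: "?W = 1 + (\<Sum>a<k. T a)"
  proof (rule fps_ext)
    fix n
    show "?W $ n = (1 + (\<Sum>a<k. T a)) $ n"
    proof (cases "n = 0")
      case True
      then show ?thesis by (simp add: T_def w0 nil fps_sum_nth)
    next
      case False
      have "(\<Sum>w\<in>words k n. \<omega> w) = (\<Sum>a<k. \<Sum>w | w \<in> words k n \<and> hd w = a. \<omega> w)"
      proof (rule sum.group [symmetric])
        show "hd ` words k n \<subseteq> {..<k}"
        proof (rule image_subsetI)
          fix w assume "w \<in> words k n"
          then have "w \<noteq> []" "set w \<subseteq> {..<k}" using False by (auto simp: words_def)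
          then show "hd w \<in> {..<k}" using hd_in_set [of w] by blast
        qed
      qed (use finite_words in auto)
      then show ?thesis using False by (simp add: T_def fps_sum_nth)
    qed
  qed
  have "T a = ?W * (A a * inverse (1 + A a))" if a: "a < k" for a
  proof -
    have "T a * (1 + A a) = ?W * A a" using T [OF a] by (simp add: algebra_simps)
    moreover have "(1 + A a) * inverse (1 + A a) = 1" using A0 by (simp add: inverse_mult_eq_1')
    ultimately show ?thesis by (metis mult.assoc mult.right_neutral)
  qed
  then have "(\<Sum>a<k. T a) = ?W * (\<Sum>a<k. A a * inverse (1 + A a))"
    by (simp add: sum_distrib_left)
  then have "?W * (1 - (\<Sum>a<k. A a * inverse (1 + A a))) = ?W - (\<Sum>a<k. T a)"
    by (simp only: right_diff_distrib mult_1_right)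
  also have "\<dots> = 1" by (subst W) simp
  finally show ?thesis .
qed

section \<open>Weights of edge sets\<close>

text \<open>Up to the normalisation by a power of \<open>t\<close>, this is the factor of \<open>F\<close> both in the defining identity
  of \<open>Q\<close> and in the inverse Z-polynomial.\<close>

definition edge_weight :: "nat set set \<Rightarrow> int poly fract" where
  "edge_weight F = (- inverse tvar) ^ set_rank F * to_fract (rank_KL set_rank F)"

lemma edge_weight_empty: "edge_weight {} = 1"
  by (simp add: edge_weight_def rank_KL_empty)

lemma edge_weight_singleton: "card e = 2 \<Longrightarrow> edge_weight {e} = - inverse tvar"
  using graphic_rank_singleton [of "\<lambda>e. e" e]
  by (simp add: edge_weight_def rank_KL_singleton)

lemma edge_weight_union:
  assumes "finite A" "finite B" "\<And>e. e \<in> A \<union> B \<Longrightarrow> card e = 2" "\<Union>A \<inter> \<Union>B \<subseteq> {z}"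
  shows "edge_weight (A \<union> B) = edge_weight A * edge_weight B"
proof -
  have add: "set_rank (C \<union> D) = set_rank C + set_rank D" if "C \<subseteq> A" "D \<subseteq> B" for C D
  proof (rule graphic_rank_union)
    show "finite C" "finite D" using that assms finite_subset by blast+
    show "(\<Union>e\<in>C. e) \<inter> (\<Union>e\<in>D. e) \<subseteq> {z}" using that assms(4) by auto
  qed (use that assms(3) in blast)
  have disj: "A \<inter> B = {}"
  proof (rule ccontr)
    assume "A \<inter> B \<noteq> {}"
    then obtain e where e: "e \<in> A" "e \<in> B" by auto
    then have "e \<subseteq> {z}" using assms(4) by auto
    then have "card e \<le> card {z}" by (intro card_mono) auto
    then show False using assms(3) [of e] e by simp
  qed
  have "loopless_rank set_rank (A \<union> B)"
    by (rule loopless_rank_graphic) (use assms in auto)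
  then have "rank_KL set_rank (A \<union> B) = rank_KL set_rank A * rank_KL set_rank B"
    using disj add by (rule rank_KL_union)
  then show ?thesis
    using add [OF subset_refl subset_refl] by (simp add: edge_weight_def power_add)
qed

lemma edge_weight_image:
  assumes "finite A" "\<And>e. e \<in> A \<Longrightarrow> card e = 2" "inj g"
  shows "edge_weight ((`) g ` A) = edge_weight A"
proof -
  have inj: "inj_on ((`) g) A"
    using assms(3) by (auto simp: inj_on_def inj_image_eq_iff)
  have r: "set_rank ((`) g ` B) = set_rank B" if "B \<subseteq> A" for B
  proof (rule graphic_rank_image [OF _ _ assms(3)])
    show "finite B" using that assms(1) by (rule finite_subset)
    show "inj_on ((`) g) B" using inj that by (rule inj_on_subset)
  qed (use that assms in auto)
  have "rank_KL set_rank ((`) g ` A) = rank_KL (\<lambda>B. set_rank ((`) g ` B)) A"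
    by (rule rank_KL_image [OF inj])
  also have "\<dots> = rank_KL set_rank A" by (rule rank_KL_cong) (rule r)
  finally show ?thesis by (simp add: edge_weight_def r)
qed

text \<open>The power of \<open>t\<close> corresponds to the substitution of \<open>t u\<close> for \<open>u\<close> in the generating functions. It
  removes the powers of \<open>1/t\<close> from the weights of runs.\<close>

definition word_weight :: "nat list \<Rightarrow> int poly fract" where
  "word_weight w = tvar ^ length w * edge_weight (mono_edges w)"

lemma word_weight_Nil: "word_weight [] = 1"
  by (simp add: word_weight_def mono_edges_Nil edge_weight_empty)

text \<open>The edges of the first run and those of the rest share only the hub, and the rest is an isomorphic
  copy of the graph of the remaining word.\<close>

lemma word_weight_run:
  assumes "w = [] \<or> hd w \<noteq> a"
  shows "word_weight (replicate l a @ w) = word_weight (replicate l a) * word_weight w"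
proof -
  let ?A = "mono_edges (replicate l a)" and ?B = "(`) (shift l) ` mono_edges w"
  have "edge_weight (?A \<union> ?B) = edge_weight ?A * edge_weight ?B"
  proof (rule edge_weight_union)
    show "\<Union>?A \<inter> \<Union>?B \<subseteq> {0}"
      using mono_edges_verts [of "replicate l a"] by (auto simp: shift_def split: if_splits)
    show "card e = 2" if "e \<in> ?A \<union> ?B" for e
      using that card_mono_edges inj_shift [of l] by (auto simp: card_image inj_on_subset)
  qed (simp_all add: finite_mono_edges)
  also have "edge_weight ?B = edge_weight (mono_edges w)"
    by (rule edge_weight_image) (auto simp: finite_mono_edges card_mono_edges inj_shift)
  finally show ?thesis
    by (simp add: word_weight_def mono_edges_run [OF assms] power_add)
qed

lemma word_weight_hub_run:
  "word_weight (replicate l 0) = (- 1) ^ l * to_fract (graph_KL (fan l))"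
proof -
  have "tvar ^ l * (- inverse tvar) ^ l = (- 1) ^ l"
    by (simp flip: power_mult_distrib)
  moreover have "set_rank (mono_edges (replicate l 0)) = l"
    using set_rank_fan [of l] by (simp add: edges_fan)
  ultimately show ?thesis
    by (simp add: word_weight_def edge_weight_def graph_KL_def edges_fan mult.assoc [symmetric])
qed

lemma edge_weight_path:
  assumes "a \<noteq> 0"
  shows "edge_weight (mono_edges (replicate (Suc m) a)) = (- inverse tvar) ^ m"
proof (induction m)
  case 0
  have "mono_edges (replicate (Suc 0) a) = {}"
    using assms by (auto simp: mono_edges_def mono_spokes_def mono_links_def nth_Cons')
  then show ?case by (simp add: edge_weight_empty)
next
  case (Suc m)
  let ?A = "mono_edges (replicate (Suc m) a)" and ?e = "{Suc m, Suc (Suc m)}"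
  have links: "mono_links (replicate l a) = {i. Suc i < l}" for l
    by (auto simp: mono_links_def)
  have spokes: "mono_spokes (replicate l a) = {}" for l
    using assms by (auto simp: mono_spokes_def)
  have "{i. Suc i < Suc (Suc m)} = insert m {i. Suc i < Suc m}" by auto
  then have "mono_edges (replicate (Suc (Suc m)) a) = ?A \<union> {?e}"
    unfolding mono_edges_def links spokes by simp
  also have "edge_weight \<dots> = edge_weight ?A * edge_weight {?e}"
  proof (rule edge_weight_union)
    show "\<Union>?A \<inter> \<Union>{?e} \<subseteq> {Suc m}"
      using mono_edges_verts [of "replicate (Suc m) a"] by auto
  qed (use card_mono_edges finite_mono_edges in auto)
  finally show ?case using Suc by (simp add: edge_weight_singleton)
qed

lemma word_weight_path:
  assumes "a \<noteq> 0"
  shows "word_weight (replicate (Suc m) a) = tvar * (- 1) ^ m"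
proof -
  have "tvar ^ m * (- inverse tvar) ^ m = (- 1) ^ m"
    by (simp flip: power_mult_distrib)
  then show ?thesis
    by (simp add: word_weight_def edge_weight_path [OF assms] mult.assoc del: replicate_Suc)
qed

section \<open>The functional equations\<close>

text \<open>The coefficient of \<open>u\<^sup>n\<close> is the weight of the run \<open>0\<^sup>n\<close>.\<close>

definition phi :: "int poly fps" where
  "phi = Abs_fps (\<lambda>n. (- 1) ^ n * graph_KL (fan n))"

definition fract_fps :: "int poly fps \<Rightarrow> int poly fract fps" where
  "fract_fps S = Abs_fps (\<lambda>n. to_fract (S $ n))"

definition s_fps :: "int poly fract fps" where
  "s_fps = 1 + u_fps + t_fps * u_fps"

text \<open>The generating function of the weighted words in \<open>x\<close> letters, extended from natural numbers to all
  field elements \<open>x\<close>. Of the letters, \<open>0\<close> contributes \<open>1/\<phi>\<close> to the reciprocal and each of the \<open>x - 1\<close>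
  others contributes \<open>- t u / s\<close>.\<close>

definition letters_fps :: "int poly fract \<Rightarrow> int poly fract fps" where
  "letters_fps x = inverse (inverse (fract_fps phi) - fps_const (x - 1) * (t_fps * u_fps * inverse s_fps))"

lemma graph_KL_fan_0: "graph_KL (fan 0) = 1"
  by (simp add: graph_KL_def edges_fan mono_edges_Nil rank_KL_empty)

lemma fract_phi_nth: "fract_fps phi $ n = (- 1) ^ n * to_fract (graph_KL (fan n))"
  by (simp add: fract_fps_def phi_def to_fract_power)

lemma fract_phi_0: "fract_fps phi $ 0 = 1"
  by (simp add: fract_phi_nth graph_KL_fan_0)

lemma s_fps_0: "s_fps $ 0 = 1"
  by (simp add: s_fps_def)

lemma inverse_fps_mult:
  fixes f :: "'a :: field fps"
  assumes "f $ 0 \<noteq> 0"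
  shows "f * inverse f = 1"
  using assms by (rule inverse_mult_eq_1')

lemma words_fps:
  assumes "0 < k"
  shows "Abs_fps (\<lambda>n. \<Sum>w\<in>words k n. word_weight w) = letters_fps (of_nat k)"
proof -
  define A where "A a = Abs_fps (\<lambda>l. if l = 0 then 0 else word_weight (replicate l a))" for a
  let ?W = "Abs_fps (\<lambda>n. \<Sum>w\<in>words k n. word_weight w)"
  have gf: "?W * (1 - (\<Sum>a<k. A a * inverse (1 + A a))) = 1"
    by (rule words_generating_function)
      (simp_all add: word_weight_Nil word_weight_run A_def)
  have hub: "1 + A 0 = fract_fps phi"
    by (rule fps_ext) (simp add: A_def fract_phi_nth word_weight_hub_run graph_KL_fan_0)
  have path: "A a * inverse (1 + A a) = t_fps * u_fps * inverse s_fps" if "a \<noteq> 0" for a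
  proof -
    have Aa: "A a * (1 + u_fps) = t_fps * u_fps"
    proof (rule fps_ext)
      fix n
      consider "n = 0" | "n = 1" | m where "n = Suc (Suc m)"
        by (metis One_nat_def not0_implies_Suc)
      then show "(A a * (1 + u_fps)) $ n = (t_fps * u_fps) $ n"
      proof cases
        case 3
        then show ?thesis
          using word_weight_path [OF that, of m] word_weight_path [OF that, of "Suc m"]
          by (simp add: distrib_left A_def del: replicate_Suc)
      qed (use word_weight_path [OF that, of 0] in \<open>simp_all add: distrib_left A_def\<close>)
    qed
    then have s: "(1 + A a) * (1 + u_fps) = s_fps" by (simp add: s_fps_def algebra_simps)
    have "A a * inverse (1 + A a) * s_fps = A a * (1 + u_fps) * ((1 + A a) * inverse (1 + A a))"
      by (simp only: s [symmetric] mult_ac)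
    also have "(1 + A a) * inverse (1 + A a) = 1"
      by (rule inverse_fps_mult) (simp add: A_def)
    finally have "A a * inverse (1 + A a) * s_fps * inverse s_fps = t_fps * u_fps * inverse s_fps"
      using Aa by simp
    moreover have "s_fps * inverse s_fps = 1"
      by (rule inverse_fps_mult) (simp add: s_fps_0)
    ultimately show ?thesis by (simp only: mult.assoc mult_1_right)
  qed
  have "1 - A 0 * inverse (1 + A 0) = inverse (1 + A 0)"
  proof -
    have "(1 + A 0) * inverse (1 + A 0) = 1"
      by (rule inverse_fps_mult) (simp add: A_def)
    then show ?thesis by (simp only: distrib_right mult_1_left diff_eq_eq)
  qed
  moreover have "{..<k} = insert 0 {1..<k}" using assms by auto
  moreover have "(\<Sum>a\<in>{1..<k}. A a * inverse (1 + A a)) =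
      fps_const (of_nat k - 1) * (t_fps * u_fps * inverse s_fps)"
  proof -
    have "(\<Sum>a\<in>{1..<k}. A a * inverse (1 + A a)) = (\<Sum>a\<in>{1..<k}. t_fps * u_fps * inverse s_fps)"
      by (rule sum.cong) (auto intro: path)
    also have "\<dots> = of_nat (k - 1) * (t_fps * u_fps * inverse s_fps)" by simp
    also have "(of_nat (k - 1) :: int poly fract fps) = fps_const (of_nat k - 1)"
      using assms by (simp add: fps_of_nat [symmetric] of_nat_diff)
    finally show ?thesis .
  qed
  ultimately have "1 - (\<Sum>a<k. A a * inverse (1 + A a)) =
      inverse (fract_fps phi) - fps_const (of_nat k - 1) * (t_fps * u_fps * inverse s_fps)"
    by (simp add: hub algebra_simps)
  with gf have "?W * (inverse (fract_fps phi) - fps_const (of_nat k - 1) * (t_fps * u_fps * inverse s_fps)) = 1"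
    by simp
  then show ?thesis
    unfolding letters_fps_def by (metis fps_inverse_unique mult.commute)
qed

text \<open>The recursion \<open>W = \<phi> + (x - 1) \<phi> (t u / s) W\<close> for the series \<open>W\<close> of words computes each coefficient
  from earlier ones, and \<open>x\<close> enters only through the factor \<open>x - 1\<close>.\<close>

lemma letters_fps_poly: "\<exists>p. \<forall>x. letters_fps x $ n = poly p x"
proof (induction n rule: less_induct)
  case (less n)
  let ?b = "fract_fps phi * (t_fps * u_fps * inverse s_fps)"
  have rec: "letters_fps x = fract_fps phi + fps_const (x - 1) * (?b * letters_fps x)" for x
  proof -
    let ?d = "inverse (fract_fps phi) - fps_const (x - 1) * (t_fps * u_fps * inverse s_fps)"
    have "?d * letters_fps x = 1"
      unfolding letters_fps_def by (rule inverse_fps_mult) (simp add: fract_phi_0 mult.assoc)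
    then have "fract_fps phi = fract_fps phi * ?d * letters_fps x" by (simp add: mult.assoc)
    also have "fract_fps phi * ?d = 1 - fps_const (x - 1) * ?b"
      using inverse_fps_mult [of "fract_fps phi"] by (simp add: fract_phi_0 right_diff_distrib mult_ac)
    finally show ?thesis by (simp add: algebra_simps)
  qed
  from less obtain p where p: "\<And>m x. m < n \<Longrightarrow> letters_fps x $ m = poly (p m) x" by metis
  have "letters_fps x $ n =
      poly ([:fract_fps phi $ n:] + [:- 1, 1:] * (\<Sum>i=1..n. smult (?b $ i) (p (n - i)))) x" for x
  proof -
    have "(?b * letters_fps x) $ n = (\<Sum>i=0..n. ?b $ i * letters_fps x $ (n - i))"
      by (rule fps_mult_nth)
    also have "\<dots> = (\<Sum>i=1..n. ?b $ i * letters_fps x $ (n - i))"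
      by (rule sum.mono_neutral_right) (auto simp: not_le mult.assoc)
    also have "\<dots> = (\<Sum>i=1..n. ?b $ i * poly (p (n - i)) x)"
      by (rule sum.cong) (auto simp: p)
    finally have b: "(?b * letters_fps x) $ n = (\<Sum>i=1..n. ?b $ i * poly (p (n - i)) x)" .
    have "letters_fps x $ n = (fract_fps phi + fps_const (x - 1) * (?b * letters_fps x)) $ n"
      by (rule arg_cong [OF rec])
    also have "\<dots> = fract_fps phi $ n + (x - 1) * (\<Sum>i=1..n. ?b $ i * poly (p (n - i)) x)"
      by (simp only: fps_add_nth fps_mult_left_const_nth b)
    finally show ?thesis by (simp add: poly_sum left_diff_distrib)
  qed
  then show ?case by blast
qed

lemma set_rank_le:
  assumes "F \<subseteq> edges (fan n)"
  shows "set_rank F \<le> n"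
  using loopless_rankD(3) [OF loopless_rank_fan assms subset_refl] set_rank_fan by simp

text \<open>The weighted sum over all compositions, as a polynomial in the number \<open>x\<close> of colours. Its value at
  \<open>1/t\<close> is the right-hand side of the defining identity of \<open>Q\<close>, and its coefficient at \<open>x\<close> is the
  inverse Z-polynomial, in both cases up to a sign and a power of \<open>t\<close>.\<close>

definition fan_poly :: "nat \<Rightarrow> int poly fract poly" where
  "fan_poly n = (\<Sum>F\<in>Pow (edges (fan n)).
     smult (tvar ^ n * edge_weight F) (map_poly of_int (colour_poly (fan n) F)))"

lemma poly_fan_poly:
  "poly (fan_poly n) x = (\<Sum>F\<in>Pow (edges (fan n)).
    tvar ^ n * edge_weight F * poly_at (colour_poly (fan n) F) x)"
  by (simp add: fan_poly_def poly_sum poly_at_def)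

lemma poly_at_of_int: "poly_at p (of_int m) = of_int (poly p m)"
  by (induction p) simp_all

text \<open>Both sides are polynomials in \<open>x\<close>, and if \<open>x\<close> is a natural number both count colourings by
  weight; the factor \<open>x\<close> stands for the colour of the hub.\<close>

lemma fan_poly_letters: "poly (fan_poly n) x = x * letters_fps x $ n"
proof -
  obtain p where p: "\<And>x. letters_fps x $ n = poly p x" using letters_fps_poly by metis
  have "fan_poly n = pCons 0 p"
  proof (rule poly_eqI_of_nat)
    fix k :: nat
    let ?E = "edges (fan n)" and ?Col = "{0..n} \<rightarrow>\<^sub>E {..<k}"
    let ?M = "monochromatic (\<lambda>e. e) ?E"
    have finE: "finite ?E" using loopless_finite [OF loopless_fan] by blast
    have finC: "finite ?Col" by (intro finite_PiE) auto
    have "poly (fan_poly n) (of_nat k) =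
        (\<Sum>F\<in>Pow ?E. tvar ^ n * edge_weight F * of_nat (card {c \<in> ?Col. ?M c = F}))"
      unfolding poly_fan_poly
    proof (rule sum.cong [OF refl])
      fix F assume "F \<in> Pow ?E"
      then have "poly (colour_poly (fan n) F) (int k) = int (card {c \<in> ?Col. ?M c = F})"
        using poly_colour_poly [OF loopless_fan, of F n k] by (simp add: verts_fan)
      then show "tvar ^ n * edge_weight F * poly_at (colour_poly (fan n) F) (of_nat k) =
          tvar ^ n * edge_weight F * of_nat (card {c \<in> ?Col. ?M c = F})"
        using poly_at_of_int [of "colour_poly (fan n) F" "int k"] by simp
    qed
    also have "\<dots> = (\<Sum>F\<in>Pow ?E. \<Sum>c | c \<in> ?Col \<and> ?M c = F. tvar ^ n * edge_weight (?M c))"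
      by (rule sum.cong) (simp_all add: mult.commute)
    also have "\<dots> = (\<Sum>c\<in>?Col. tvar ^ n * edge_weight (?M c))"
      by (rule sum.group) (use finE finC in \<open>auto simp: monochromatic_def\<close>)
    also have "\<dots> = of_nat k * (\<Sum>w\<in>words k n. tvar ^ n * edge_weight (mono_edges w))"
      by (rule sum_fan_colourings)
    also have "(\<Sum>w\<in>words k n. tvar ^ n * edge_weight (mono_edges w)) = (\<Sum>w\<in>words k n. word_weight w)"
      by (rule sum.cong) (auto simp: words_def word_weight_def)
    also have "of_nat k * \<dots> = of_nat k * letters_fps (of_nat k) $ n"
    proof (cases "k = 0")
      case False
      have "(\<Sum>w\<in>words k n. word_weight w) = Abs_fps (\<lambda>n. \<Sum>w\<in>words k n. word_weight w) $ n"
        by simp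
      also have "\<dots> = letters_fps (of_nat k) $ n"
        using False by (subst words_fps) simp_all
      finally show ?thesis by simp
    qed simp
    finally show "poly (fan_poly n) (of_nat k) = poly (pCons 0 p) (of_nat k)" by (simp add: p)
  qed
  then show ?thesis by (simp add: p)
qed

lemma weight_shift:
  assumes "set_rank F \<le> m"
  shows "tvar ^ m * edge_weight F = (- 1) ^ set_rank F * to_fract (rank_KL set_rank F) * tvar ^ (m - set_rank F)"
proof -
  have "tvar ^ m = tvar ^ set_rank F * tvar ^ (m - set_rank F)"
    using assms by (simp flip: power_add)
  then have "tvar ^ m * edge_weight F =
      (tvar ^ set_rank F * (- inverse tvar) ^ set_rank F) * to_fract (rank_KL set_rank F) *
      tvar ^ (m - set_rank F)"
    by (simp only: edge_weight_def mult_ac)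
  also have "tvar ^ set_rank F * (- inverse tvar) ^ set_rank F = (- 1) ^ set_rank F"
    by (simp flip: power_mult_distrib)
  finally show ?thesis .
qed

lemma KL_fan_letters:
  "(- tvar) ^ n * poly_at (graph_KL (fan n)) (inverse tvar) = letters_fps (inverse tvar) $ n"
proof -
  let ?E = "edges (fan n)"
  have "(- tvar) ^ n * poly_at (graph_KL (fan n)) (inverse tvar) =
      (\<Sum>F\<in>Pow ?E. (- 1) ^ set_rank F * poly_at (rank_KL set_rank F) tvar *
        (\<Sum>B\<in>Pow (?E - F). (- 1) ^ card B * tvar ^ (set_rank (F \<union> B) - set_rank F)))"
    using rank_KL_identity [OF loopless_rank_fan] by (simp only: graph_KL_def set_rank_fan ends_fan)
  also have "\<dots> = (\<Sum>F\<in>Pow ?E. tvar * (tvar ^ n * edge_weight F * poly_at (colour_poly (fan n) F) (inverse tvar)))"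
  proof (rule sum.cong [OF refl])
    fix F assume F: "F \<in> Pow ?E"
    have "(\<Sum>B\<in>Pow (?E - F). (- 1) ^ card B * tvar ^ (set_rank (F \<union> B) - set_rank F)) =
        tvar ^ (Suc n - set_rank F) * poly_at (colour_poly (fan n) F) (inverse tvar)"
      using poly_at_colour_poly [OF loopless_fan PowD [OF F]] by (simp add: verts_fan)
    moreover have "tvar ^ (Suc n) * edge_weight F =
        (- 1) ^ set_rank F * to_fract (rank_KL set_rank F) * tvar ^ (Suc n - set_rank F)"
      by (rule weight_shift) (use set_rank_le F in \<open>auto intro: le_SucI\<close>)
    ultimately show "(- 1) ^ set_rank F * poly_at (rank_KL set_rank F) tvar *
        (\<Sum>B\<in>Pow (?E - F). (- 1) ^ card B * tvar ^ (set_rank (F \<union> B) - set_rank F)) =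
        tvar * (tvar ^ n * edge_weight F * poly_at (colour_poly (fan n) F) (inverse tvar))"
    proof -
      assume e1: "(\<Sum>B\<in>Pow (?E - F). (- 1) ^ card B * tvar ^ (set_rank (F \<union> B) - set_rank F)) =
          tvar ^ (Suc n - set_rank F) * poly_at (colour_poly (fan n) F) (inverse tvar)"
        and e2: "tvar ^ (Suc n) * edge_weight F =
          (- 1) ^ set_rank F * to_fract (rank_KL set_rank F) * tvar ^ (Suc n - set_rank F)"
      have "tvar * (tvar ^ n * edge_weight F * poly_at (colour_poly (fan n) F) (inverse tvar)) =
          tvar ^ (Suc n) * edge_weight F * poly_at (colour_poly (fan n) F) (inverse tvar)"
        by (simp only: power_Suc mult.assoc)
      then show ?thesis unfolding e1 e2 poly_at_tvar by (simp only: mult.assoc)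
    qed
  qed
  also have "\<dots> = tvar * poly (fan_poly n) (inverse tvar)"
    by (simp only: poly_fan_poly sum_distrib_left)
  also have "\<dots> = letters_fps (inverse tvar) $ n"
    by (simp add: fan_poly_letters)
  finally show ?thesis .
qed

lemma inverse_Z_fan_letters: "to_fract (inverse_Z (fan n)) = (- 1) ^ n * letters_fps 0 $ n"
proof -
  let ?E = "edges (fan n)"
  have "to_fract (monom a m) = of_int a * tvar ^ m" for a m
    using poly_at_tvar [of "monom a m"] by simp
  then have "to_fract (inverse_Z (fan n)) = (- 1) ^ n * (\<Sum>F\<in>Pow ?E.
      (- 1) ^ set_rank F * to_fract (rank_KL set_rank F) *
      (of_int (coeff (colour_poly (fan n) F) 1) * tvar ^ (n - set_rank F)))"
    by (simp add: inverse_Z_eq [OF loopless_fan] rk_fan num_components_fan to_fract_sum to_fract_power)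
  also have "(\<Sum>F\<in>Pow ?E. (- 1) ^ set_rank F * to_fract (rank_KL set_rank F) *
      (of_int (coeff (colour_poly (fan n) F) 1) * tvar ^ (n - set_rank F))) =
      (\<Sum>F\<in>Pow ?E. tvar ^ n * edge_weight F * of_int (coeff (colour_poly (fan n) F) 1))"
  proof (rule sum.cong [OF refl])
    fix F assume "F \<in> Pow ?E"
    then show "(- 1) ^ set_rank F * to_fract (rank_KL set_rank F) *
        (of_int (coeff (colour_poly (fan n) F) 1) * tvar ^ (n - set_rank F)) =
        tvar ^ n * edge_weight F * of_int (coeff (colour_poly (fan n) F) 1)"
      using weight_shift [OF set_rank_le, of F n] by (simp only: Pow_iff mult_ac)
  qed
  also have "\<dots> = coeff (fan_poly n) 1"
    by (simp add: fan_poly_def coeff_sum coeff_map_poly)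
  also have "\<dots> = letters_fps 0 $ n"
  proof -
    obtain p where p: "\<And>x. letters_fps x $ n = poly p x" using letters_fps_poly by metis
    have "fan_poly n = pCons 0 p"
      by (rule poly_eqI_of_nat) (simp add: fan_poly_letters p)
    then show ?thesis by (simp add: p poly_0_coeff_0)
  qed
  finally show ?thesis .
qed

section \<open>Solving the functional equations\<close>

text \<open>Substitute \<open>z u\<close> for \<open>u\<close> and apply the ring homomorphism \<open>h\<close> to the coefficients.\<close>

definition twist :: "('a :: comm_ring_1 \<Rightarrow> 'b :: comm_ring_1) \<Rightarrow> 'b \<Rightarrow> 'a fps \<Rightarrow> 'b fps" where
  "twist h z S = Abs_fps (\<lambda>n. z ^ n * h (S $ n))"

definition hom_fun :: "('a :: comm_ring_1 \<Rightarrow> 'b :: comm_ring_1) \<Rightarrow> bool" where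
  "hom_fun h \<longleftrightarrow> h 1 = 1 \<and> (\<forall>a b. h (a + b) = h a + h b) \<and> (\<forall>a b. h (a * b) = h a * h b)"

lemma hom_funD:
  assumes "hom_fun h"
  shows "h 1 = 1" "h (a + b) = h a + h b" "h (a * b) = h a * h b" "h 0 = 0" "h (a - b) = h a - h b"
proof -
  show add: "h (a + b) = h a + h b" for a b using assms by (simp add: hom_fun_def)
  show "h 1 = 1" "h (a * b) = h a * h b" using assms by (simp_all add: hom_fun_def)
  show "h 0 = 0" using add [of 0 0] by simp
  show "h (a - b) = h a - h b" using add [of "a - b" b] by simp
qed

lemma hom_fun_sum:
  assumes "hom_fun h"
  shows "h (\<Sum>i\<in>I. f i) = (\<Sum>i\<in>I. h (f i))"
  by (induction I rule: infinite_finite_induct) (simp_all add: hom_funD [OF assms])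

lemma twist_mult:
  assumes "hom_fun h"
  shows "twist h z (S * T) = twist h z S * twist h z T"
proof (rule fps_ext)
  fix n
  have "z ^ n * h (\<Sum>i=0..n. S $ i * T $ (n - i)) =
      (\<Sum>i=0..n. z ^ n * (h (S $ i) * h (T $ (n - i))))"
    by (simp add: hom_fun_sum [OF assms] hom_funD(3) [OF assms] sum_distrib_left)
  also have "\<dots> = (\<Sum>i=0..n. z ^ i * h (S $ i) * (z ^ (n - i) * h (T $ (n - i))))"
  proof (rule sum.cong [OF refl])
    fix i assume "i \<in> {0..n}"
    then have "z ^ n = z ^ i * z ^ (n - i)" by (simp flip: power_add)
    then show "z ^ n * (h (S $ i) * h (T $ (n - i))) =
        z ^ i * h (S $ i) * (z ^ (n - i) * h (T $ (n - i)))" by (simp add: mult_ac)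
  qed
  finally show "twist h z (S * T) $ n = (twist h z S * twist h z T) $ n"
    by (simp add: twist_def fps_mult_nth)
qed

lemma twist_add: "hom_fun h \<Longrightarrow> twist h z (S + T) = twist h z S + twist h z T"
  by (rule fps_ext) (simp add: twist_def hom_funD distrib_left)

lemma twist_diff: "hom_fun h \<Longrightarrow> twist h z (S - T) = twist h z S - twist h z T"
  by (rule fps_ext) (simp add: twist_def hom_funD right_diff_distrib)

lemma twist_const: "hom_fun h \<Longrightarrow> twist h z (fps_const a) = fps_const (h a)"
  by (rule fps_ext) (simp add: twist_def hom_funD)

lemma twist_1: "hom_fun h \<Longrightarrow> twist h z 1 = 1"
  using twist_const [of h z 1] by (simp add: hom_funD)

lemma twist_X: "hom_fun h \<Longrightarrow> twist h z fps_X = fps_const z * fps_X"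
  by (rule fps_ext) (auto simp: twist_def hom_funD fps_X_def)

lemmas twist_simps = twist_add twist_diff twist_mult twist_const twist_1 twist_X

text \<open>The substitution \<open>t \<mapsto> 1/t\<close>, \<open>u \<mapsto> t u\<close>, which turns the coefficient of \<open>u ^ n\<close> into its
  reversal of degree \<open>n\<close>.\<close>

definition reversed :: "int poly fps \<Rightarrow> int poly fract fps" where
  "reversed = twist (\<lambda>p. poly_at p (inverse tvar)) tvar"

definition alternating :: "int poly fract fps \<Rightarrow> int poly fract fps" where
  "alternating = twist (\<lambda>x. x) (- 1)"

lemma fract_fps_twist: "fract_fps = twist to_fract 1"
  by (rule ext) (simp add: fract_fps_def twist_def)

lemma hom_reversed: "hom_fun (\<lambda>p. poly_at p (inverse tvar))"
  by (simp add: hom_fun_def)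

lemma hom_to_fract: "hom_fun (to_fract :: int poly \<Rightarrow> int poly fract)"
  by (simp add: hom_fun_def)

lemma hom_id: "hom_fun (\<lambda>x. x :: int poly fract)"
  by (simp add: hom_fun_def)

lemmas reversed_simps = twist_simps [OF hom_reversed, of tvar, folded reversed_def]
lemmas fract_simps = twist_simps [OF hom_to_fract, of 1, folded fract_fps_twist]
lemmas alternating_simps = twist_simps [OF hom_id, of "- 1", folded alternating_def]

lemma fract_fps_eq_iff: "fract_fps S = fract_fps T \<longleftrightarrow> S = T"
  by (auto simp: fract_fps_def fps_eq_iff)

text \<open>The root of \<open>c = t u\<^sup>2 + c\<^sup>2\<close> with constant term 0. Working with this equation avoids all further
  reference to the square root.\<close>

definition c_fps :: "int poly fract fps" where
  "c_fps = fps_const (1 / 2) * (1 - fps_sqrt1 (1 - 4 * t_fps * u_fps ^ 2))"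

lemma sqrt_eq: "fps_sqrt1 (1 - 4 * t_fps * u_fps ^ 2) = 1 - 2 * c_fps"
proof -
  have "2 * fps_const (1 / 2 :: int poly fract) = 1"
    by (simp add: numeral_fps_const fps_const_mult del: fps_const_mult_left)
  moreover have "2 * c_fps = (2 * fps_const (1 / 2)) * (1 - fps_sqrt1 (1 - 4 * t_fps * u_fps ^ 2))"
    by (simp only: c_fps_def mult.assoc)
  ultimately have "2 * c_fps = 1 - fps_sqrt1 (1 - 4 * t_fps * u_fps ^ 2)"
    by (simp only: mult_1_left)
  then show ?thesis by simp
qed

lemma sqrt_square: "fps_sqrt1 (1 - 4 * t_fps * u_fps ^ 2) ^ 2 = 1 - 4 * t_fps * u_fps ^ 2"
proof -
  let ?a = "1 - 4 * t_fps * u_fps ^ 2"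
  have "?a $ 0 = 1" by (simp add: mult.assoc)
  then show ?thesis
    using power_radical [of ?a "\<lambda>_ _. 1" 1] unfolding fps_sqrt1_def
    by (simp add: numeral_2_eq_2 del: power_Suc)
qed

lemma c_eq: "c_fps = t_fps * u_fps ^ 2 + c_fps ^ 2"
proof -
  have "(1 - 2 * c_fps) ^ 2 = 1 - 4 * t_fps * u_fps ^ 2"
    using sqrt_square unfolding sqrt_eq .
  then have "4 * c_fps = 4 * (t_fps * u_fps ^ 2 + c_fps ^ 2)"
    by (simp add: power2_eq_square algebra_simps)
  then show ?thesis
    by (rule mult_left_cancel [THEN iffD1, rotated]) simp
qed

lemma c_0: "c_fps $ 0 = 0"
  by (simp add: c_fps_def fps_sqrt1_def)

text \<open>The other root has constant term 1. By uniqueness \<open>c\<close> is invariant under every substitution that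
  preserves \<open>t u\<^sup>2\<close>: the reversal below and the sign change of \<open>u\<close>.\<close>

lemma c_unique:
  assumes "S = t_fps * u_fps ^ 2 + S ^ 2" "S $ 0 = 0"
  shows "S = c_fps"
proof -
  have "(S - c_fps) * (1 - (S + c_fps)) = (S - S ^ 2) - (c_fps - c_fps ^ 2)"
    by (simp add: power2_eq_square algebra_simps)
  also have "S - S ^ 2 = t_fps * u_fps ^ 2" using assms(1) by (metis add_diff_cancel_right')
  also have "c_fps - c_fps ^ 2 = t_fps * u_fps ^ 2" using c_eq by (metis add_diff_cancel_right')
  finally have "(S - c_fps) * (1 - (S + c_fps)) = 0" by simp
  moreover have "(1 - (S + c_fps)) $ 0 = 1" using assms(2) c_0 by simp
  then have "1 - (S + c_fps) \<noteq> 0" by (metis fps_zero_nth zero_neq_one)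
  ultimately show ?thesis by simp
qed

lemma c_coeff: "\<exists>p. c_fps $ n = to_fract p \<and> 2 * degree p \<le> n"
proof (induction n rule: less_induct)
  case (less n)
  then obtain p where p: "\<And>m. m < n \<Longrightarrow> c_fps $ m = to_fract (p m)" "\<And>m. m < n \<Longrightarrow> 2 * degree (p m) \<le> m"
    by metis
  let ?q = "(if n = 2 then [:0, 1:] else 0) + (\<Sum>i\<in>{1..<n}. p i * p (n - i))"
  have "c_fps $ n = (t_fps * u_fps ^ 2) $ n + (\<Sum>i=0..n. c_fps $ i * c_fps $ (n - i))"
    by (subst c_eq) (simp only: fps_add_nth power2_eq_square [of c_fps] fps_mult_nth [of c_fps])
  also have "(t_fps * u_fps ^ 2) $ n = to_fract (if n = 2 then [:0, 1:] else 0)"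
    by (simp add: fps_X_power_nth)
  also have "(\<Sum>i=0..n. c_fps $ i * c_fps $ (n - i)) = (\<Sum>i\<in>{1..<n}. c_fps $ i * c_fps $ (n - i))"
  proof (rule sum.mono_neutral_right)
    show "\<forall>i\<in>{0..n} - {1..<n}. c_fps $ i * c_fps $ (n - i) = 0"
    proof
      fix i assume "i \<in> {0..n} - {1..<n}"
      then have "i = 0 \<or> i = n" by auto
      then show "c_fps $ i * c_fps $ (n - i) = 0" by (auto simp: c_0)
    qed
  qed auto
  also have "\<dots> = to_fract (\<Sum>i\<in>{1..<n}. p i * p (n - i))"
    unfolding to_fract_sum by (rule sum.cong) (auto simp: p)
  finally have "c_fps $ n = to_fract ?q" by simp
  moreover have "2 * degree ?q \<le> n"
  proof -
    have "degree (\<Sum>i\<in>{1..<n}. p i * p (n - i)) \<le> n div 2"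
    proof (rule degree_sum_le)
      fix i assume i: "i \<in> {1..<n}"
      have "2 * degree (p i * p (n - i)) \<le> 2 * degree (p i) + 2 * degree (p (n - i))"
        using degree_mult_le [of "p i" "p (n - i)"] by simp
      also have "\<dots> \<le> i + (n - i)"
        by (rule add_mono) (use p(2) [of i] p(2) [of "n - i"] i in auto)
      also have "\<dots> = n" using i by simp
      finally show "degree (p i * p (n - i)) \<le> n div 2" by simp
    qed simp
    then have "degree ?q \<le> n div 2"
      by (intro degree_add_le) auto
    then show ?thesis by simp
  qed
  ultimately show ?case by blast
qed

text \<open>A coefficient of the reciprocal is a sum of products whose exponents, and so also the degree
  bounds, add up to that of the coefficient. The cases of interest are \<open>2 deg \<le> n\<close>, which is \<open>e = 0\<close>,
  and \<open>2 deg < n\<close>, which is \<open>e = 1\<close>.\<close>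

lemma reciprocal_degree_bound:
  fixes S T :: "int poly fps"
  assumes ST: "S * T = 1" and S0: "S $ 0 = 1" and T0: "T $ 0 = 1"
    and S: "\<And>n. 0 < n \<Longrightarrow> 2 * degree (S $ n) + e \<le> n"
  shows "0 < n \<Longrightarrow> 2 * degree (T $ n) + e \<le> n"
proof (induction n rule: less_induct)
  case (less n)
  have "0 = (S * T) $ n" using ST less.prems by simp
  also have "\<dots> = T $ n + (\<Sum>i=1..n. S $ i * T $ (n - i))"
    by (simp add: fps_mult_nth sum.atLeast_Suc_atMost S0)
  finally have Tn: "T $ n = - (\<Sum>i=1..n. S $ i * T $ (n - i))"
    by (simp add: eq_neg_iff_add_eq_0)
  have "degree (\<Sum>i=1..n. S $ i * T $ (n - i)) \<le> (n - e) div 2"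
  proof (rule degree_sum_le)
    fix i assume i: "i \<in> {1..n}"
    have "2 * degree (S $ i * T $ (n - i)) \<le> 2 * degree (S $ i) + 2 * degree (T $ (n - i))"
      using degree_mult_le [of "S $ i" "T $ (n - i)"] by simp
    moreover have "2 * degree (S $ i) + e \<le> i" using S [of i] i by simp
    moreover have "2 * degree (T $ (n - i)) \<le> n - i"
    proof (cases "i = n")
      case False
      then show ?thesis using less.IH [of "n - i"] i by simp
    qed (simp add: T0)
    moreover have "i \<le> n" using i by simp
    ultimately have "2 * degree (S $ i * T $ (n - i)) \<le> n - e" by linarith
    then show "degree (S $ i * T $ (n - i)) \<le> (n - e) div 2" by simp
  qed simp
  then have "2 * degree (T $ n) \<le> n - e" by (simp add: Tn)
  moreover have "e \<le> n" using S [OF less.prems] by simp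
  ultimately show ?case by simp
qed

lemma reciprocal_exists:
  fixes S :: "int poly fps"
  assumes "S $ 0 = 1"
  obtains T where "S * T = 1" "T $ 0 = 1"
proof
  show "S * fps_right_inverse S 1 = 1" by (rule fps_right_inverse) (simp add: assms)
  show "fps_right_inverse S 1 $ 0 = 1" by simp
qed

lemma reversed_phi: "reversed phi = letters_fps (inverse tvar)"
proof (rule fps_ext)
  fix n
  have "reversed phi $ n = (- tvar) ^ n * poly_at (graph_KL (fan n)) (inverse tvar)"
    by (simp add: reversed_def twist_def phi_def power_minus [of tvar] mult_ac)
  then show "reversed phi $ n = letters_fps (inverse tvar) $ n" by (simp add: KL_fan_letters)
qed

lemma inverse_letters_fps:
  "inverse (letters_fps x) = inverse (fract_fps phi) - fps_const (x - 1) * (t_fps * u_fps * inverse s_fps)"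
  unfolding letters_fps_def by (rule fps_inverse_idempotent) (simp add: fract_phi_0 mult.assoc)

lemma letters_fps_0: "letters_fps x $ 0 = 1"
  by (simp add: letters_fps_def fract_phi_0 mult.assoc)

lemma degree_phi:
  assumes "0 < n"
  shows "2 * degree (phi $ n) + 1 \<le> n"
proof -
  have "2 * degree (graph_KL (fan n)) < n"
    using graph_KL_condition [OF loopless_fan, of n] assms
    by (simp add: inverse_KL_condition_def rk_fan)
  then show ?thesis by (simp add: phi_def degree_neg_one_power_mult)
qed

text \<open>Because \<open>c - c\<^sup>2 = t u\<^sup>2\<close>, the quotient \<open>(u + c) / s\<close> is \<open>u / (1 + u - c)\<close>. In the second form, the
  denominator has constant term 1 and all degrees are visibly small. The other equation is the image
  of this one under the reversal.\<close>

lemma c_factor: "(u_fps + c_fps) * (1 + u_fps - c_fps) = u_fps * s_fps"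
    and c_factor': "(t_fps * u_fps + c_fps) * (1 + t_fps * u_fps - c_fps) = t_fps * u_fps * s_fps"
proof -
  have c: "c_fps - c_fps ^ 2 = t_fps * u_fps ^ 2" using c_eq by (metis add_diff_cancel_right')
  have "(u_fps + c_fps) * (1 + u_fps - c_fps) = u_fps + u_fps ^ 2 + (c_fps - c_fps ^ 2)"
    by (simp add: power2_eq_square algebra_simps)
  then show "(u_fps + c_fps) * (1 + u_fps - c_fps) = u_fps * s_fps"
    unfolding c by (simp add: s_fps_def power2_eq_square algebra_simps)
  have "(t_fps * u_fps + c_fps) * (1 + t_fps * u_fps - c_fps) =
      t_fps * u_fps + (t_fps * u_fps) ^ 2 + (c_fps - c_fps ^ 2)"
    by (simp add: power2_eq_square algebra_simps del: fps_const_mult)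
  then show "(t_fps * u_fps + c_fps) * (1 + t_fps * u_fps - c_fps) = t_fps * u_fps * s_fps"
    unfolding c by (simp add: s_fps_def power2_eq_square algebra_simps del: fps_const_mult)
qed

text \<open>By the functional equation, \<open>1/\<phi>\<close> and \<open>1 + u / (1 + u - c)\<close> change by the same amount under
  the reversal. So their difference has palindromic coefficients; as the degrees of these are
  less than half of the exponent, it vanishes.\<close>

lemma inverse_phi: "inverse (fract_fps phi) = 1 + (u_fps + c_fps) * inverse s_fps"
proof -
  obtain \<theta> where \<theta>: "phi * \<theta> = 1" "\<theta> $ 0 = 1"
    by (rule reciprocal_exists [of phi]) (simp add: phi_def graph_KL_fan_0)
  obtain p where p: "\<And>n. c_fps $ n = to_fract (p n)" "\<And>n. 2 * degree (p n) \<le> n"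
    using c_coeff by metis
  define c where "c = Abs_fps p"
  have fc: "fract_fps c = c_fps" by (rule fps_ext) (simp add: fract_fps_def c_def p)
  have cn: "2 * degree (c $ n) \<le> n" for n by (simp add: c_def p)
  have "to_fract (c $ 0) = 0" using p(1) [of 0] by (simp add: c_def c_0)
  then have c0: "c $ 0 = 0" by simp
  let ?t = "fps_const [:0, 1:] :: int poly fps"
  have c_rec: "c = ?t * fps_X ^ 2 + c ^ 2"
  proof -
    have "fract_fps (?t * fps_X ^ 2 + c ^ 2) = t_fps * u_fps ^ 2 + c_fps ^ 2"
      by (simp add: fract_simps power2_eq_square fc del: fps_const_mult)
    also have "\<dots> = c_fps" by (rule c_eq [symmetric])
    finally have "fract_fps (?t * fps_X ^ 2 + c ^ 2) = fract_fps c" by (simp only: fc)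
    then show ?thesis by (simp only: fract_fps_eq_iff)
  qed
  have rc: "reversed c = c_fps"
  proof (rule c_unique)
    have "reversed c = reversed (?t * fps_X ^ 2 + c ^ 2)" using c_rec by (rule arg_cong)
    also have "\<dots> = fps_const (inverse tvar) * (t_fps * u_fps) * (t_fps * u_fps) + reversed c ^ 2"
      by (simp add: reversed_simps power2_eq_square mult.assoc del: fps_const_mult)
    also have "fps_const (inverse tvar) * (t_fps * u_fps) * (t_fps * u_fps) = t_fps * u_fps ^ 2"
      by (simp add: power2_eq_square flip: mult.assoc)
    finally show "reversed c = t_fps * u_fps ^ 2 + reversed c ^ 2" .
    show "reversed c $ 0 = 0" by (simp add: reversed_def twist_def c0)
  qed
  obtain w where w: "(1 + fps_X - c) * w = 1" "w $ 0 = 1"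
    by (rule reciprocal_exists [of "1 + fps_X - c"]) (simp add: c0)
  have wn: "2 * degree (w $ n) \<le> n" for n
  proof (cases "n = 0")
    case False
    have "2 * degree (w $ n) + 0 \<le> n"
    proof (rule reciprocal_degree_bound [OF w(1) _ w(2)])
      show "(1 + fps_X - c) $ 0 = 1" by (simp add: c0)
      fix m :: nat assume m: "0 < m"
      have "(1 + fps_X - c) $ m = (if m = 1 then 1 else 0) - c $ m"
        using m by (simp add: fps_X_def)
      moreover have "degree ((if m = 1 then 1 else 0) - c $ m) \<le> m div 2"
        by (rule degree_diff_le) (use cn [of m] in auto)
      ultimately show "2 * degree ((1 + fps_X - c) $ m) + 0 \<le> m" by simp
    qed (use False in simp)
    then show ?thesis by simp
  qed (simp add: w)
  \<comment> \<open>The candidate for \<open>1/\<phi>\<close>. Its coefficients at \<open>u\<^sup>n\<close> come from \<open>w\<close> at \<open>n - 1\<close>, so the bound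
    \<open>2 deg \<le> n\<close> for \<open>w\<close> becomes strict.\<close>
  define \<eta> where "\<eta> = 1 + fps_X * w"
  have fw: "fract_fps w = inverse (1 + u_fps - c_fps)"
  proof -
    have "(1 + u_fps - c_fps) * fract_fps w = fract_fps ((1 + fps_X - c) * w)"
      by (simp add: fract_simps fc)
    also have "\<dots> = 1" unfolding w(1) by (simp add: fract_simps)
    finally show ?thesis by (metis fps_inverse_unique)
  qed
  have rw: "reversed w = inverse (1 + t_fps * u_fps - c_fps)"
  proof -
    have "(1 + t_fps * u_fps - c_fps) * reversed w = reversed ((1 + fps_X - c) * w)"
      by (simp add: reversed_simps rc)
    also have "\<dots> = 1" unfolding w(1) by (simp add: reversed_simps)
    finally show ?thesis by (metis fps_inverse_unique)
  qed
  have div: "v * inverse d = n * inverse s_fps" if "n * d = v * s_fps" "d $ 0 \<noteq> 0"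
    for v d n :: "int poly fract fps"
  proof -
    have "v * inverse d = v * inverse d * (s_fps * inverse s_fps)"
      using inverse_fps_mult [of s_fps] by (simp add: s_fps_0)
    also have "\<dots> = (v * s_fps) * inverse d * inverse s_fps" by (simp only: mult_ac)
    also have "\<dots> = n * (d * inverse d) * inverse s_fps" by (simp only: that(1) [symmetric] mult.assoc)
    also have "\<dots> = n * inverse s_fps" using inverse_fps_mult [OF that(2)] by simp
    finally show ?thesis .
  qed
  have f\<eta>: "fract_fps \<eta> = 1 + (u_fps + c_fps) * inverse s_fps"
    using div [OF c_factor] by (simp add: \<eta>_def fract_simps fw c_0)
  have r\<eta>: "reversed \<eta> = 1 + (t_fps * u_fps + c_fps) * inverse s_fps"
    using div [OF c_factor'] by (simp add: \<eta>_def reversed_simps rw c_0 mult.assoc)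
  have f\<theta>: "fract_fps \<theta> = inverse (fract_fps phi)"
  proof -
    have "fract_fps phi * fract_fps \<theta> = fract_fps (phi * \<theta>)" by (simp add: fract_simps)
    also have "\<dots> = 1" unfolding \<theta>(1) by (simp add: fract_simps)
    finally show ?thesis by (metis fps_inverse_unique)
  qed
  have r\<theta>: "reversed \<theta> = inverse (letters_fps (inverse tvar))"
  proof -
    have "letters_fps (inverse tvar) * reversed \<theta> = reversed (phi * \<theta>)"
      by (simp add: reversed_simps reversed_phi)
    also have "\<dots> = 1" unfolding \<theta>(1) by (simp add: reversed_simps)
    finally show ?thesis by (metis fps_inverse_unique)
  qed
  have tt: "fps_const (inverse tvar - 1) * t_fps = 1 - t_fps"
    by (simp add: left_diff_distrib fps_const_sub [symmetric] del: fps_const_sub)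
  have "fract_fps \<theta> - reversed \<theta> = (1 - t_fps) * (u_fps * inverse s_fps)"
    unfolding f\<theta> r\<theta> inverse_letters_fps tt [symmetric] by (simp add: mult.assoc)
  moreover have "fract_fps \<eta> - reversed \<eta> = (1 - t_fps) * (u_fps * inverse s_fps)"
    unfolding f\<eta> r\<eta> by (simp add: algebra_simps)
  ultimately have "fract_fps \<theta> - reversed \<theta> = fract_fps \<eta> - reversed \<eta>" by (simp only:)
  then have "fract_fps \<theta> - fract_fps \<eta> = reversed \<theta> - reversed \<eta>" by (simp add: algebra_simps)
  then have sym: "fract_fps (\<theta> - \<eta>) = reversed (\<theta> - \<eta>)"
    by (simp only: fract_simps reversed_simps)
  have "\<theta> - \<eta> = 0"
  proof (rule fps_ext)
    fix n
    show "(\<theta> - \<eta>) $ n = 0 $ n"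
    proof (cases "n = 0")
      case True
      then show ?thesis by (simp add: \<theta> \<eta>_def)
    next
      case False
      have "2 * degree (\<theta> $ n) + 1 \<le> n"
        using reciprocal_degree_bound [OF \<theta>(1) _ \<theta>(2) degree_phi, of n] False
        by (simp add: phi_def graph_KL_fan_0)
      moreover have "2 * degree (\<eta> $ n) + 1 \<le> n"
        using wn [of "n - 1"] False by (simp add: \<eta>_def)
      ultimately have deg: "2 * degree ((\<theta> - \<eta>) $ n) < n"
        using degree_diff_le_max [of "\<theta> $ n" "\<eta> $ n"] by simp
      have "to_fract ((\<theta> - \<eta>) $ n) = tvar ^ n * poly_at ((\<theta> - \<eta>) $ n) (inverse tvar)"
        using arg_cong [OF sym, of "\<lambda>S. S $ n"] by (simp only: fract_fps_def reversed_def twist_def fps_nth_Abs_fps)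
      then have "palindromic n ((\<theta> - \<eta>) $ n)"
        using palindromic_iff [of "(\<theta> - \<eta>) $ n" n] deg by simp
      then have "(\<theta> - \<eta>) $ n = 0"
      proof (rule palindromic_low_degree)
        fix i assume "n \<le> 2 * i"
        then show "coeff ((\<theta> - \<eta>) $ n) i = 0" by (intro coeff_eq_0) (use deg in linarith)
      qed
      then show ?thesis by simp
    qed
  qed
  then have "\<theta> = \<eta>" by simp
  then show ?thesis using f\<theta> f\<eta> by simp
qed

lemma alternating_c: "alternating c_fps = c_fps"
proof (rule c_unique)
  have "alternating c_fps = alternating (t_fps * u_fps ^ 2 + c_fps ^ 2)"
    using c_eq by (rule arg_cong)
  also have "\<dots> = t_fps * u_fps ^ 2 + alternating c_fps ^ 2"
    by (simp add: alternating_simps power2_eq_square)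
  finally show "alternating c_fps = t_fps * u_fps ^ 2 + alternating c_fps ^ 2" .
  show "alternating c_fps $ 0 = 0" by (simp add: alternating_def twist_def c_0)
qed

lemma Psi_Y_alternating: "Psi_Y = alternating (letters_fps 0)"
  by (rule fps_ext) (simp add: Psi_Y_def alternating_def twist_def inverse_Z_fan_letters)

theorem theorem3p1:
  shows "Psi_Y =
    2 * (- 1 + u_fps + t_fps * u_fps) /
    (- 3 + 4 * (1 + t_fps) * u_fps + fps_sqrt1 (1 - 4 * t_fps * u_fps ^ 2))"
proof -
  have ss: "s_fps * inverse s_fps = 1" by (rule inverse_fps_mult) (simp add: s_fps_0)
  \<comment> \<open>The words in 0 letters give the inverse Z-polynomials up to sign; their series turns out to
    be \<open>s / (2 s - 1 + c)\<close>, since \<open>u + t u = s - 1\<close>.\<close>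
  have "inverse (letters_fps 0) = 1 + (u_fps + c_fps) * inverse s_fps + t_fps * u_fps * inverse s_fps"
    unfolding inverse_letters_fps inverse_phi
    by (simp add: fps_const_neg [symmetric] del: fps_const_neg)
  also have "\<dots> = s_fps * inverse s_fps + (s_fps - 1 + c_fps) * inverse s_fps"
    unfolding ss by (simp add: s_fps_def algebra_simps)
  finally have inv: "inverse (letters_fps 0) = (2 * s_fps - 1 + c_fps) * inverse s_fps"
    by (simp add: algebra_simps)
  have "letters_fps 0 * (2 * s_fps - 1 + c_fps) =
      letters_fps 0 * inverse (letters_fps 0) * s_fps"
    unfolding inv using ss by (simp add: mult_ac)
  also have "letters_fps 0 * inverse (letters_fps 0) = 1"
    by (rule inverse_fps_mult) (simp add: letters_fps_0)
  finally have L: "letters_fps 0 * (2 * s_fps - 1 + c_fps) = s_fps" by simp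
  \<comment> \<open>Now replace \<open>u\<close> by \<open>-u\<close>; only \<open>s\<close> changes.\<close>
  let ?s = "1 - u_fps - t_fps * u_fps"
  have as: "alternating s_fps = ?s"
    unfolding s_fps_def by (simp add: alternating_simps)
  have "Psi_Y * (2 * ?s - 1 + c_fps) = alternating (letters_fps 0 * (s_fps + s_fps - 1 + c_fps))"
    by (simp only: Psi_Y_alternating alternating_simps as alternating_c mult_2)
  also have "letters_fps 0 * (s_fps + s_fps - 1 + c_fps) = s_fps" using L by simp
  finally have P: "Psi_Y * (2 * ?s - 1 + c_fps) = ?s" by (simp only: as)
  let ?den = "- 3 + 4 * (1 + t_fps) * u_fps + fps_sqrt1 (1 - 4 * t_fps * u_fps ^ 2)"
  have den: "?den = - 2 * (2 * ?s - 1 + c_fps)"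
    unfolding sqrt_eq by (simp add: algebra_simps)
  have "Psi_Y * ?den = - 2 * (Psi_Y * (2 * ?s - 1 + c_fps))"
    unfolding den by (rule mult.left_commute)
  also have "\<dots> = - 2 * ?s" by (simp only: P)
  also have "\<dots> = 2 * (- 1 + u_fps + t_fps * u_fps)" by (simp add: algebra_simps)
  finally have "2 * (- 1 + u_fps + t_fps * u_fps) = Psi_Y * ?den" by simp
  moreover have "?den \<noteq> 0"
  proof
    assume "?den = 0"
    then have "?den $ 0 = 0" by simp
    then show False unfolding den by (simp add: c_0)
  qed
  ultimately show ?thesis by simp
qed

end
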